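(* Let $n\ge1$ and $f\in\mathcal{W}^{(1)}_n$. Then \[ \frac15\,U^{(1)}(f)\in\mathcal{V}^{(0)}_{5n-4}\qquad\text{and}\qquad \frac1{5^2}\,U^{(0)}\!\left(U^{(1)}(f)\right)\in\mathcal{W}^{(1)}_{25n-22}. \]
   Context: $q=e^{2\pi i\tau}$, $E_2(\tau)=1-24\sum_{n\ge1}\frac{nq^n}{1-q^n}$, $F(\tau)=\frac1{24}(50E_2(10\tau)-25E_2(5\tau)-2E_2(2\tau)+E_2(\tau))$, $Z(\tau)=q^2\prod_{m\ge1}\frac{1-q^{50m}}{1-q^{2m}}$, $y=y(\tau)=q\prod_{m\ge1}\frac{(1-q^{2m})(1-q^{10m})^3}{(1-q^m)^3(1-q^{5m})}$. For $f=\sum_{m\ge M}a(m)q^m$, $U_5(f)=\sum_{5m\ge M}a(5m)q^m$; $U^{(1)}(f)=U_5(Ff)/F$, $U^{(0)}(f)=U_5(FZf)/F$. A function $s:\mathbb{Z}\to\mathbb{Z}$ is discrete if $s(m)=0$ for all sufficiently large $m$. Let $\theta(m)=\lfloor\frac{5m-5}{6}\rfloor$ for $m=1,2$ and $\theta(m)=\lfloor\frac{5m-5}{6}\rfloor-1$ for $m\ge3$; $\phi(m)=\lfloor\frac{5m-5}{6}\rfloor$ for $1\le m\le3$ and $\phi(m)=\lfloor\frac{5m-5}{6}\rfloor-1$ for $m\ge4$. For $n\ge1$ define $\mathcal{V}^{(0)}_n=\{(1+5y)^{-n}\sum_{m\ge1}s(m)5^{\phi(m)}y^m : s\text{ discrete}\}$,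 $\mathcal{V}^{(1)}_n=\{(1+5y)^{-n}\sum_{m\ge1}s(m)5^{\theta(m)}y^m : s\text{ discrete}\}$, and $\mathcal{W}^{(1)}_n=\{(1+5y)^{-n}\sum_{m\ge1}s(m)5^{\theta(m)}y^m : s\text{ discrete},\ s(1)+s(2)+s(3)\equiv0\pmod5\}$. *)

theory Defs
  imports "HOL-Analysis.Analysis" "HOL-Computational_Algebra.Computational_Algebra"
    "HOL-Number_Theory.Cong"
begin

text \<open>
  Functions of \<open>\<tau>\<close> are represented by their expansions in \<open>q = exp (2 \<pi> i \<tau>)\<close>, as formal Laurent
  series with complex coefficients and \<open>q = fls_X\<close>; the substitution of \<open>k \<tau>\<close> for \<open>\<tau>\<close> becomes
  \<open>q \<mapsto> q^k\<close>, i.e. \<^const>\<open>fls_compose_power\<close>.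
  Infinite sums and products over \<open>m \<ge> 1\<close> are the library's \<^const>\<open>suminf\<close> and \<^const>\<open>prodinf\<close> in
  the topology of formal power series, with the index shifted so that it starts at 0; that they
  converge is shown below.
\<close>

definition qE2 :: "complex fls" where
  "qE2 = fps_to_fls
     (1 - 24 * (\<Sum>n. of_nat (Suc n) * fps_X ^ Suc n / (1 - fps_X ^ Suc n)))"

definition qF :: "complex fls" where
  "qF = 1 / 24 * (50 * fls_compose_power qE2 10 - 25 * fls_compose_power qE2 5
                  - 2 * fls_compose_power qE2 2 + qE2)"

definition qZ :: "complex fls" where
  "qZ = fps_to_fls
     (fps_X ^ 2 * (\<Prod>m. (1 - fps_X ^ (50 * Suc m)) / (1 - fps_X ^ (2 * Suc m))))"

definition qy :: "complex fls" where
  "qy = fps_to_fls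
     (fps_X * (\<Prod>m. ((1 - fps_X ^ (2 * Suc m)) * (1 - fps_X ^ (10 * Suc m)) ^ 3)
                   / ((1 - fps_X ^ Suc m) ^ 3 * (1 - fps_X ^ (5 * Suc m)))))"

lift_definition U5 :: "complex fls \<Rightarrow> complex fls" is "\<lambda>a m. a (5 * m)"
proof -
  fix a :: "int \<Rightarrow> complex"
  assume "eventually (\<lambda>n. a (- int n) = 0) cofinite"
  hence "eventually (\<lambda>n. a (- int n) = 0) at_top"
    by (simp add: cofinite_eq_sequentially)
  hence "eventually (\<lambda>n. a (- int (5 * n)) = 0) at_top"
    by (rule eventually_compose_filterlim)
       (rule filterlim_at_top_mono[OF filterlim_ident], simp)
  thus "eventually (\<lambda>n. a (5 * - int n) = 0) cofinite"
    by (simp add: cofinite_eq_sequentially)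
qed

definition U_one :: "complex fls \<Rightarrow> complex fls" where
  "U_one f = U5 (qF * f) / qF"

definition U_zero :: "complex fls \<Rightarrow> complex fls" where
  "U_zero f = U5 (qF * qZ * f) / qF"

definition discrete_fun :: "(int \<Rightarrow> int) \<Rightarrow> bool" where
  "discrete_fun s \<longleftrightarrow> (\<exists>N. \<forall>m\<ge>N. s m = 0)"

text \<open>Only the values at \<open>m \<ge> 1\<close> are used; they are nonnegative.\<close>

definition \<theta> :: "int \<Rightarrow> int" where
  "\<theta> m = (if m \<le> 2 then \<lfloor>(5 * real_of_int m - 5) / 6\<rfloor> else \<lfloor>(5 * real_of_int m - 5) / 6\<rfloor> - 1)"

definition \<phi> :: "int \<Rightarrow> int" where
  "\<phi> m = (if m \<le> 3 then \<lfloor>(5 * real_of_int m - 5) / 6\<rfloor> else \<lfloor>(5 * real_of_int m - 5) / 6\<rfloor> - 1)"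

text \<open>
  The summation is over all \<open>m \<ge> 1\<close>: for discrete \<open>s\<close> only finitely many terms are nonzero, and
  restricting to these makes the index set of \<^const>\<open>sum\<close> finite.
\<close>

definition y_series :: "int \<Rightarrow> (int \<Rightarrow> int) \<Rightarrow> (int \<Rightarrow> int) \<Rightarrow> complex fls" where
  "y_series n e s = (1 + 5 * qy) powi (- n) *
     (\<Sum>m | 1 \<le> m \<and> s m \<noteq> 0. of_int (s m) * 5 powi e m * qy powi m)"

definition V_zero :: "int \<Rightarrow> complex fls set" where
  "V_zero n = {y_series n \<phi> s | s. discrete_fun s}"

definition V_one :: "int \<Rightarrow> complex fls set" where
  "V_one n = {y_series n \<theta> s | s. discrete_fun s}"

definition W_one :: "int \<Rightarrow> complex fls set" where
  "W_one n = {y_series n \<theta> s | s. discrete_fun s \<and> [s 1 + s 2 + s 3 = 0] (mod 5)}"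

lemma finite_support_discrete_fun:
  assumes "discrete_fun s"
  shows   "finite {m. 1 \<le> m \<and> s m \<noteq> 0}"
proof -
  from assms obtain N where "\<And>m. m \<ge> N \<Longrightarrow> s m = 0"
    by (auto simp: discrete_fun_def)
  hence "{m. 1 \<le> m \<and> s m \<noteq> 0} \<subseteq> {1..N}"
    by (intro subsetI) (metis (mono_tags) atLeastAtMost_iff linorder_le_cases mem_Collect_eq)
  thus ?thesis
    by (rule finite_subset) auto
qed

lemma fps_nth_mult_cong:
  assumes "\<And>i. i \<le> k \<Longrightarrow> fps_nth f i = fps_nth f' i" "\<And>i. i \<le> k \<Longrightarrow> fps_nth g i = fps_nth g' i"
  shows   "fps_nth (f * g) k = fps_nth (f' * g') k"
  unfolding fps_mult_nth by (intro sum.cong) (use assms in auto)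

lemma convergent_prod_fps:
  fixes f :: "nat \<Rightarrow> complex fps"
  assumes "\<And>m k. k \<le> m \<Longrightarrow> fps_nth (f m) k = (if k = 0 then 1 else 0)"
  shows   "convergent_prod f"
proof -
  define P where "P = (\<lambda>n. \<Prod>i\<le>n. f i)"
  have step: "fps_nth (P (Suc n)) k = fps_nth (P n) k" if "k \<le> n" for n k
  proof -
    have "fps_nth (P n * f (Suc n)) k = fps_nth (P n * 1) k"
      by (rule fps_nth_mult_cong) (use assms that in auto)
    thus ?thesis by (simp add: P_def)
  qed
  have stable: "fps_nth (P n) k = fps_nth (P k) k" if "k \<le> n" for n k
    using that by (induction n rule: dec_induct) (auto simp: step)
  define L where "L = Abs_fps (\<lambda>k. fps_nth (P k) k)"
  have "P \<longlonglongrightarrow> L"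
  proof (rule tendsto_fpsI)
    fix k
    show "eventually (\<lambda>n. fps_nth (P n) k = fps_nth L k) sequentially"
      using eventually_ge_at_top[of k] by eventually_elim (auto simp: L_def intro: stable)
  qed
  moreover have "fps_nth L 0 = 1"
    using assms[of 0 0] by (simp add: L_def P_def)
  hence "L \<noteq> 0" by auto
  ultimately show ?thesis
    unfolding convergent_prod_def raw_has_prod_def P_def by (intro exI[of _ 0] exI[of _ L]) auto
qed

definition one_upto :: "nat \<Rightarrow> complex fps \<Rightarrow> bool" where
  "one_upto m f \<longleftrightarrow> (\<forall>k\<le>m. fps_nth f k = (if k = 0 then 1 else 0))"

lemma one_upto_altdef: "one_upto m f \<longleftrightarrow> (\<forall>k\<le>m. fps_nth f k = fps_nth 1 k)"
  by (simp add: one_upto_def)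

lemma one_upto_mult: "one_upto m f \<Longrightarrow> one_upto m g \<Longrightarrow> one_upto m (f * g)"
proof -
  assume *: "one_upto m f" "one_upto m g"
  have "fps_nth (f * g) k = fps_nth (1 * 1) k" if "k \<le> m" for k
    by (rule fps_nth_mult_cong) (use * that in \<open>auto simp: one_upto_def\<close>)
  thus ?thesis by (simp add: one_upto_altdef)
qed

lemma one_upto_power: "one_upto m f \<Longrightarrow> one_upto m (f ^ n)"
  by (induction n) (simp_all add: one_upto_mult, simp add: one_upto_def)

lemma one_upto_divide:
  assumes "one_upto m f" "one_upto m g"
  shows   "one_upto m (f / g)"
proof -
  have g0: "fps_nth g 0 \<noteq> 0"
    using assms by (auto simp: one_upto_def)
  hence eq: "(f / g) * g = f"
    by (simp add: fps_divide_unit mult.assoc inverse_mult_eq_1)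
  have "fps_nth (f / g) k = fps_nth f k" if "k \<le> m" for k
  proof -
    have "fps_nth ((f / g) * g) k = fps_nth ((f / g) * 1) k"
      by (rule fps_nth_mult_cong) (use assms that in \<open>auto simp: one_upto_def\<close>)
    thus ?thesis by (simp add: eq)
  qed
  thus ?thesis using assms by (simp add: one_upto_def)
qed

lemma one_upto_factor: "k > m \<Longrightarrow> one_upto m (1 - fps_X ^ k)"
  by (auto simp: one_upto_def fps_X_power_nth)

lemma convergent_prod_qZ:
  "convergent_prod (\<lambda>m. (1 - fps_X ^ (50 * Suc m)) / (1 - fps_X ^ (2 * Suc m)) :: complex fps)"
proof (rule convergent_prod_fps)
  fix m k :: nat
  assume "k \<le> m"
  moreover have "one_upto m ((1 - fps_X ^ (50 * Suc m)) / (1 - fps_X ^ (2 * Suc m)))"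
    by (intro one_upto_divide one_upto_factor) auto
  ultimately show "fps_nth ((1 - fps_X ^ (50 * Suc m)) / (1 - fps_X ^ (2 * Suc m)) :: complex fps) k =
      (if k = 0 then 1 else 0)"
    unfolding one_upto_def by blast
qed

lemma convergent_prod_qy:
  "convergent_prod (\<lambda>m. ((1 - fps_X ^ (2 * Suc m)) * (1 - fps_X ^ (10 * Suc m)) ^ 3)
     / ((1 - fps_X ^ Suc m) ^ 3 * (1 - fps_X ^ (5 * Suc m))) :: complex fps)"
proof (rule convergent_prod_fps)
  fix m k :: nat
  assume "k \<le> m"
  moreover have "one_upto m (((1 - fps_X ^ (2 * Suc m)) * (1 - fps_X ^ (10 * Suc m)) ^ 3)
     / ((1 - fps_X ^ Suc m) ^ 3 * (1 - fps_X ^ (5 * Suc m))))"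
    by (intro one_upto_divide one_upto_mult one_upto_power one_upto_factor) auto
  ultimately show "fps_nth (((1 - fps_X ^ (2 * Suc m)) * (1 - fps_X ^ (10 * Suc m)) ^ 3)
     / ((1 - fps_X ^ Suc m) ^ 3 * (1 - fps_X ^ (5 * Suc m))) :: complex fps) k =
      (if k = 0 then 1 else 0)"
    unfolding one_upto_def by blast
qed

lemma summable_fps:
  fixes f :: "nat \<Rightarrow> complex fps"
  assumes "\<And>m k. k \<le> m \<Longrightarrow> fps_nth (f m) k = 0"
  shows   "summable f"
proof -
  have stable: "(\<Sum>i<n. fps_nth (f i) k) = (\<Sum>i<k. fps_nth (f i) k)" if "k \<le> n" for n k
    using that by (intro sum.mono_neutral_right) (auto simp: assms)
  have "(\<lambda>n. \<Sum>i<n. f i) \<longlonglongrightarrow> Abs_fps (\<lambda>k. \<Sum>i<k. fps_nth (f i) k)"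
  proof (rule tendsto_fpsI)
    fix k
    show "eventually (\<lambda>n. fps_nth (\<Sum>i<n. f i) k =
            fps_nth (Abs_fps (\<lambda>k. \<Sum>i<k. fps_nth (f i) k)) k) sequentially"
      using eventually_ge_at_top[of k] by eventually_elim (auto simp: fps_sum_nth intro: stable)
  qed
  thus ?thesis by (auto simp: summable_def sums_def)
qed

lemma summable_qE2:
  "summable (\<lambda>n. of_nat (Suc n) * fps_X ^ Suc n / (1 - fps_X ^ Suc n) :: complex fps)"
proof (rule summable_fps)
  fix m k :: nat
  assume km: "k \<le> m"
  define h :: "complex fps" where "h = of_nat (Suc m) * inverse (1 - fps_X ^ Suc m)"
  have "of_nat (Suc m) * fps_X ^ Suc m / (1 - fps_X ^ Suc m) = fps_X ^ Suc m * h"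
    by (simp add: fps_divide_unit h_def mult_ac del: power_Suc of_nat_Suc)
  thus "fps_nth (of_nat (Suc m) * fps_X ^ Suc m / (1 - fps_X ^ Suc m) :: complex fps) k = 0"
    using km by (simp add: fps_X_power_mult_nth del: power_Suc of_nat_Suc)
qed

end

theory Submission
  imports Defs
begin

text \<open>
  The triple product turns products over residue classes modulo 5 and 10 into theta series, and
  splitting double theta series along sublattices yields algebraic relations between these products.
  Writing \<open>r\<close> for the Rogers--Ramanujan continued fraction at \<open>5 \<tau>\<close> and \<open>\<rho> = r / (1 - r - r\<^sup>2)\<close>, they express
  \<open>y\<close> and \<open>Z y\<close> through \<open>\<rho>\<close> with coefficients in \<open>t = y(5 \<tau>)\<close>, and \<open>\<rho>\<close> satisfies an equation of
  degree 5 over \<open>\<rat>(t)\<close>; hence so does \<open>y\<close>. As \<open>U\<^sub>5\<close> annihilates the powers of \<open>r\<close> not divisible by 5,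
  \<open>U\<^sub>5(y\<^sup>i)\<close> is a polynomial in \<open>y\<close> for \<open>i \<le> 4\<close>, and \<open>F (1 + 4 y)\<close> being the logarithmic derivative
  of \<open>y\<close>, so is \<open>U\<^sup>(\<^sup>1\<^sup>)(y\<^sup>i)\<close> for \<open>1 \<le> i \<le> 5\<close>. Since \<open>Z y\<^sup>i\<close> is a combination of \<open>1, y, \<dots>, y\<^sup>4\<close> over
  \<open>\<rat>(t)\<close>, the same holds for \<open>U\<^sup>(\<^sup>0\<^sup>)\<close>. The modular equation extends these values to all powers of \<open>y\<close>
  with bounds on the powers of 5 in the coefficients, and its analogue for \<open>1 + 5 y\<close> reduces the
  denominators \<open>(1 + 5 y)\<^sup>n\<close> to smaller \<open>n\<close>.
\<close>

text \<open>Write x = 1 + 5 y. The recurrence that reduces denominators carries the factor x(5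
  \<tau>)^5, so by itself it sends x^(-n) to x^(-5n). The sharper exponents 5n - 4 and 5n - 2 come
  from the single value U(y/x), whose denominator is x for U^(1) and x^3 for U^(0) instead of x^5;
  the saving of 4 or 2 is passed on unchanged by the induction. Integrality survives the
  cancellation of x because x has constant term 1, and the powers of 5 survive because \<theta> and
  \<phi> grow by at most 1 per step while the y in x comes with a factor 5. The congruence for s(1)
  + s(2) + s(3) serves the lowest coefficient: U^(1) of y, y^2, y^3 starts with 1, 51, 41 times y,
  all 1 modulo 5, so the general bounds yield no factor 5 there. It reappears after U^(0) because
  the coefficients of y, y^2, y^3 in U^(0)(y^i) have a sum divisible by 25 for i = 1, 2 and by 5 for
  i = 3, 4, while \<phi>(3) = \<phi>(4) = 1 and \<phi>(i) \<ge> 2 for larger i.\<close>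

unbundle no vec_syntax

section \<open>Infinite products of formal power series\<close>

lemma tendsto_mult_fps:
  fixes f g :: "'b \<Rightarrow> complex fps"
  assumes "(f \<longlongrightarrow> a) F" "(g \<longlongrightarrow> b) F"
  shows   "((\<lambda>x. f x * g x) \<longlongrightarrow> a * b) F"
proof (rule tendsto_fpsI)
  fix n
  have "eventually (\<lambda>x. \<forall>k\<in>{..n}. f x $ k = a $ k) F" "eventually (\<lambda>x. \<forall>k\<in>{..n}. g x $ k = b $ k) F"
    using assms by (auto simp: eventually_ball_finite_distrib tendsto_fps_iff)
  thus "eventually (\<lambda>x. (f x * g x) $ n = (a * b) $ n) F"
    by eventually_elim (auto intro: fps_nth_mult_cong)
qed

lemma tendsto_power_fps:
  fixes f :: "'b \<Rightarrow> complex fps"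
  assumes "(f \<longlongrightarrow> a) F"
  shows   "((\<lambda>x. f x ^ n) \<longlongrightarrow> a ^ n) F"
  by (induction n) (auto intro: tendsto_mult_fps assms)

lemma tendsto_diff_fps:
  fixes f g :: "'b \<Rightarrow> complex fps"
  assumes "(f \<longlongrightarrow> a) F" "(g \<longlongrightarrow> b) F"
  shows   "((\<lambda>x. f x - g x) \<longlongrightarrow> a - b) F"
proof (rule tendsto_fpsI)
  fix n
  have "eventually (\<lambda>x. f x $ n = a $ n) F" "eventually (\<lambda>x. g x $ n = b $ n) F"
    using assms unfolding tendsto_fps_iff by blast+
  thus "eventually (\<lambda>x. (f x - g x) $ n = (a - b) $ n) F"
    by eventually_elim simp
qed

lemma tendsto_null_mult_fps:
  fixes f g :: "'b \<Rightarrow> complex fps"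
  assumes "(f \<longlongrightarrow> 0) F"
  shows   "((\<lambda>x. g x * f x) \<longlongrightarrow> 0) F"
proof (rule tendsto_fpsI)
  fix n
  have "eventually (\<lambda>x. \<forall>k\<in>{..n}. f x $ k = 0) F"
    using assms by (auto simp: eventually_ball_finite_distrib tendsto_fps_iff)
  thus "eventually (\<lambda>x. (g x * f x) $ n = 0 $ n) F"
    by eventually_elim (auto simp: fps_mult_nth)
qed

lemma tendsto_inverse_fps:
  fixes f :: "'b \<Rightarrow> complex fps"
  assumes lim: "(f \<longlongrightarrow> a) F" and nz: "\<And>x. f x $ 0 \<noteq> 0" "a $ 0 \<noteq> 0"
  shows   "((\<lambda>x. inverse (f x)) \<longlongrightarrow> inverse a) F"
proof -
  have "((\<lambda>x. inverse (f x) * inverse a * (a - f x)) \<longlongrightarrow> 0) F"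
    using tendsto_diff_fps[OF tendsto_const lim, of a] by (intro tendsto_null_mult_fps) simp
  moreover have "inverse (f x) * inverse a * (a - f x) = inverse (f x) - inverse a" for x
  proof -
    have "inverse (f x) * inverse a * (a - f x) =
        inverse (f x) * (inverse a * a) - (inverse (f x) * f x) * inverse a"
      by (simp add: algebra_simps)
    thus ?thesis by (simp only: inverse_mult_eq_1[OF nz(1)] inverse_mult_eq_1[OF nz(2)]) simp
  qed
  ultimately have "((\<lambda>x. inverse (f x) - inverse a) \<longlongrightarrow> 0) F" by simp
  thus ?thesis unfolding tendsto_fps_iff by simp
qed

lemma tendsto_compose_X_power_fps:
  fixes f :: "'b \<Rightarrow> complex fps"
  assumes "(f \<longlongrightarrow> a) F"
  shows   "((\<lambda>x. f x oo fps_X ^ d) \<longlongrightarrow> a oo fps_X ^ d) F"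
  using assms by (auto simp: tendsto_fps_iff fps_nth_compose_X_power)

lemma prod_nth_0: "(\<Prod>i\<in>A. f i) $ 0 = (\<Prod>i\<in>A. (f i :: complex fps) $ 0)"
  by (induction A rule: infinite_finite_induct) auto

text \<open>Convergence of a product only supplies a nonzero limit from some index \<open>M\<close>
  on; the finitely many nonzero factors before \<open>M\<close> are put back, so that the product
  converges from index 0.\<close>

lemma LIMSEQ_prodinf_fps:
  fixes f :: "nat \<Rightarrow> complex fps"
  assumes "convergent_prod f" and nz: "\<And>i. f i \<noteq> 0"
  shows   "(\<lambda>n. \<Prod>i<n. f i) \<longlonglongrightarrow> prodinf f"
proof -
  obtain M p where "(\<lambda>n. \<Prod>i\<le>n. f (i + M)) \<longlonglongrightarrow> p" "p \<noteq> 0"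
    using assms(1) unfolding convergent_prod_def raw_has_prod_def by blast
  hence "(\<lambda>n. (\<Prod>i<M. f i) * (\<Prod>i\<le>n. f (i + M))) \<longlonglongrightarrow> (\<Prod>i<M. f i) * p"
    by (intro tendsto_mult_fps tendsto_const)
  also have "(\<lambda>n. (\<Prod>i<M. f i) * (\<Prod>i\<le>n. f (i + M))) = (\<lambda>n. \<Prod>i\<le>n+M. f i)"
  proof
    fix n
    have "(\<Prod>i\<le>n+M. f i) = (\<Prod>i<M. f i) * (\<Prod>i\<in>{M..n+M}. f i)"
      by (subst prod.union_disjoint [symmetric]) (auto intro!: prod.cong)
    also have "(\<Prod>i\<in>{M..n+M}. f i) = (\<Prod>i\<le>n. f (i + M))"
      by (rule prod.reindex_bij_witness[of _ "\<lambda>i. i + M" "\<lambda>i. i - M"]) auto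
    finally show "(\<Prod>i<M. f i) * (\<Prod>i\<le>n. f (i + M)) = (\<Prod>i\<le>n+M. f i)" ..
  qed
  finally have "(\<lambda>n. \<Prod>i\<le>n. f i) \<longlonglongrightarrow> (\<Prod>i<M. f i) * p"
    by (rule LIMSEQ_offset)
  moreover have "(\<Prod>i<M. f i) * p \<noteq> 0" using nz \<open>p \<noteq> 0\<close> by simp
  ultimately have "f has_prod ((\<Prod>i<M. f i) * p)"
    unfolding has_prod_def raw_has_prod_def by simp
  thus ?thesis using has_prod_unique has_prod_imp_tendsto' by metis
qed

section \<open>The q-Pochhammer products (\<delta> q^a; q^N)_infinity\<close>

definition qp :: "complex fps \<Rightarrow> nat \<Rightarrow> nat \<Rightarrow> complex fps" where
  "qp \<delta> a N = (\<Prod>j. 1 - \<delta> * fps_X ^ (a + N * j))"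

lemma qp_factor_nth:
  assumes "k \<le> j" "a > 0" "N > 0"
  shows   "(1 - \<delta> * fps_X ^ (a + N * j)) $ k = (if k = 0 then 1 else 0 :: complex)"
proof -
  have "j \<le> N * j" using assms(3) by simp
  hence "k < a + N * j" using assms by linarith
  thus ?thesis by (auto simp: fps_X_power_mult_right_nth)
qed

lemma LIMSEQ_qp:
  assumes "a > 0" "N > 0"
  shows   "(\<lambda>n. \<Prod>j<n. 1 - \<delta> * fps_X ^ (a + N * j)) \<longlonglongrightarrow> qp \<delta> a N"
proof -
  have "convergent_prod (\<lambda>j. 1 - \<delta> * fps_X ^ (a + N * j) :: complex fps)"
    by (rule convergent_prod_fps, rule qp_factor_nth) (use assms in auto)
  thus ?thesis
    unfolding qp_def
  proof (rule LIMSEQ_prodinf_fps)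
    fix j
    have "(1 - \<delta> * fps_X ^ (a + N * j)) $ 0 = 1"
      using qp_factor_nth[of 0 j a N \<delta>] assms by simp
    thus "1 - \<delta> * fps_X ^ (a + N * j) \<noteq> 0" by (metis fps_zero_nth zero_neq_one)
  qed
qed

lemma qp_eqI:
  assumes "a > 0" "N > 0" "(\<lambda>n. \<Prod>j<n. 1 - \<delta> * fps_X ^ (a + N * j)) \<longlonglongrightarrow> P"
  shows   "qp \<delta> a N = P"
  using LIMSEQ_unique[OF LIMSEQ_qp[OF assms(1,2)] assms(3)] .

lemma qp_nth_0 [simp]:
  assumes "a > 0" "N > 0"
  shows   "qp \<delta> a N $ 0 = 1"
proof -
  have "eventually (\<lambda>n. (\<Prod>j<n. 1 - \<delta> * fps_X ^ (a + N * j)) $ 0 = qp \<delta> a N $ 0) sequentially"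
    using LIMSEQ_qp[OF assms, of \<delta>] unfolding tendsto_fps_iff by blast
  moreover have "(\<Prod>j<n. 1 - \<delta> * fps_X ^ (a + N * j)) $ 0 = 1" for n
    unfolding prod_nth_0 by (intro prod.neutral ballI) (use qp_factor_nth[of 0 _ a N] assms in simp)
  ultimately show ?thesis by (auto simp: eventually_sequentially)
qed

lemma qp_nonzero [simp]: "a > 0 \<Longrightarrow> N > 0 \<Longrightarrow> qp \<delta> a N \<noteq> 0"
  using qp_nth_0[of a N \<delta>] by (metis fps_zero_nth zero_neq_one)

lemma filterlim_mult_const: "k > 0 \<Longrightarrow> filterlim (\<lambda>n. n * k :: nat) sequentially sequentially"
  by (rule filterlim_at_top_mono[OF filterlim_ident]) (auto intro!: always_eventually)

text \<open>Sorting the factors by the residue of j modulo k does not change a finite product of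
  length n k, so both sides are limits of the same sequence.\<close>

lemma qp_split:
  assumes "a > 0" "N > 0" "k > 0"
  shows   "qp \<delta> a N = (\<Prod>i<k. qp \<delta> (a + N * i) (N * k))"
proof (rule LIMSEQ_unique)
  show "(\<lambda>n. \<Prod>j<n * k. 1 - \<delta> * fps_X ^ (a + N * j)) \<longlonglongrightarrow> qp \<delta> a N"
    by (rule filterlim_compose[OF LIMSEQ_qp filterlim_mult_const]) (use assms in auto)
  have *: "(\<Prod>j<n * k. 1 - \<delta> * fps_X ^ (a + N * j)) =
          (\<Prod>i<k. \<Prod>m<n. 1 - \<delta> * fps_X ^ (a + N * i + N * k * m))" for n
  proof -
    have "(\<Prod>j<n * k. 1 - \<delta> * fps_X ^ (a + N * j)) =
       (\<Prod>m<n. \<Prod>j\<in>{m*k..<m*k+k}. 1 - \<delta> * fps_X ^ (a + N * j))"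
      by (rule prod.nat_group [symmetric])
    also have "\<dots> = (\<Prod>m<n. \<Prod>i<k. 1 - \<delta> * fps_X ^ (a + N * i + N * k * m))"
    proof (rule prod.cong [OF refl])
      fix m
      have "(\<Prod>j\<in>{m*k..<m*k+k}. 1 - \<delta> * fps_X ^ (a + N * j)) =
            (\<Prod>i<k. 1 - \<delta> * fps_X ^ (a + N * (m * k + i)))"
        by (rule prod.reindex_bij_witness[of _ "\<lambda>i. m * k + i" "\<lambda>j. j - m * k"]) auto
      also have "\<dots> = (\<Prod>i<k. 1 - \<delta> * fps_X ^ (a + N * i + N * k * m))"
        by (intro prod.cong refl) (simp add: algebra_simps)
      finally show "(\<Prod>j\<in>{m*k..<m*k+k}. 1 - \<delta> * fps_X ^ (a + N * j)) =
            (\<Prod>i<k. 1 - \<delta> * fps_X ^ (a + N * i + N * k * m))" .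
    qed
    also have "\<dots> = (\<Prod>i<k. \<Prod>m<n. 1 - \<delta> * fps_X ^ (a + N * i + N * k * m))"
      by (rule prod.swap)
    finally show ?thesis .
  qed
  have lim: "(\<lambda>n. \<Prod>i\<in>A. \<Prod>m<n. 1 - \<delta> * fps_X ^ (a + N * i + N * k * m))
          \<longlonglongrightarrow> (\<Prod>i\<in>A. qp \<delta> (a + N * i) (N * k))" if "finite A" for A
    using that
  proof (induction A rule: finite_induct)
    case (insert i A)
    have "(\<lambda>n. (\<Prod>m<n. 1 - \<delta> * fps_X ^ (a + N * i + N * k * m)) *
             (\<Prod>i\<in>A. \<Prod>m<n. 1 - \<delta> * fps_X ^ (a + N * i + N * k * m)))
          \<longlonglongrightarrow> qp \<delta> (a + N * i) (N * k) * (\<Prod>i\<in>A. qp \<delta> (a + N * i) (N * k))"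
      by (rule tendsto_mult_fps[OF LIMSEQ_qp insert.IH]) (use assms in auto)
    thus ?case using insert.hyps by simp
  qed simp
  show "(\<lambda>n. \<Prod>j<n * k. 1 - \<delta> * fps_X ^ (a + N * j)) \<longlonglongrightarrow> (\<Prod>i<k. qp \<delta> (a + N * i) (N * k))"
    unfolding * by (rule lim) auto
qed

lemma qp_compose:
  assumes "a > 0" "N > 0" "d > 0" "\<delta> oo fps_X ^ d = \<delta>"
  shows   "qp \<delta> a N oo fps_X ^ d = qp \<delta> (d * a) (d * N)"
proof (rule qp_eqI [symmetric])
  have c0: "(fps_X ^ d :: complex fps) $ 0 = 0" using assms by simp
  have "(1 - \<delta> * fps_X ^ (a + N * j)) oo fps_X ^ d = 1 - \<delta> * fps_X ^ (d * a + d * N * j)" for j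
  proof -
    have "(1 - \<delta> * fps_X ^ (a + N * j)) oo fps_X ^ d = 1 - \<delta> * (fps_X ^ d) ^ (a + N * j)"
      by (simp only: fps_compose_sub_distrib fps_compose_1 fps_compose_mult_distrib[OF c0] assms(4)
            fps_compose_power[OF c0, symmetric] fps_X_fps_compose_startby0[OF c0])
    also have "(fps_X ^ d) ^ (a + N * j) = (fps_X :: complex fps) ^ (d * a + d * N * j)"
      by (simp only: power_mult [symmetric] distrib_left mult.assoc)
    finally show ?thesis .
  qed
  hence "(\<Prod>j<n. 1 - \<delta> * fps_X ^ (a + N * j)) oo fps_X ^ d =
         (\<Prod>j<n. 1 - \<delta> * fps_X ^ (d * a + d * N * j))" for n
    by (simp only: fps_compose_prod_distrib[OF c0])
  thus "(\<lambda>n. \<Prod>j<n. 1 - \<delta> * fps_X ^ (d * a + d * N * j)) \<longlonglongrightarrow> (qp \<delta> a N oo fps_X ^ d)"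
    using tendsto_compose_X_power_fps[OF LIMSEQ_qp[OF assms(1,2), of \<delta>], of d] by simp
qed (use assms in auto)

lemma qp_neg_mult:
  assumes "a > 0" "N > 0"
  shows   "qp 1 a N * qp (-1) a N = qp 1 (2 * a) (2 * N)"
proof (rule qp_eqI [symmetric])
  have *: "(1 - 1 * fps_X ^ m) * (1 - (-1) * fps_X ^ m) = 1 - 1 * (fps_X :: complex fps) ^ (2 * m)" for m
    by (simp only: mult_2 power_add) (simp add: algebra_simps)
  have "(\<lambda>n. (\<Prod>j<n. 1 - 1 * fps_X ^ (a + N * j)) * (\<Prod>j<n. 1 - (-1) * fps_X ^ (a + N * j)))
          \<longlonglongrightarrow> qp 1 a N * qp (-1) a N"
    by (intro tendsto_mult_fps LIMSEQ_qp assms)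
  also have "(\<lambda>n. (\<Prod>j<n. 1 - 1 * fps_X ^ (a + N * j)) * (\<Prod>j<n. 1 - (-1) * fps_X ^ (a + N * j))) =
     (\<lambda>n. (\<Prod>j<n. 1 - 1 * fps_X ^ (2 * a + 2 * N * j)) :: complex fps)"
    by (simp only: prod.distrib [symmetric] * distrib_left mult.assoc)
  finally show "(\<lambda>n. \<Prod>j<n. 1 - 1 * fps_X ^ (2 * a + 2 * N * j)) \<longlonglongrightarrow> qp 1 a N * qp (-1) a N" .
qed (use assms in auto)

section \<open>Sums of power series over arbitrary index sets\<close>

lemma has_sum_mult_fps:
  fixes f :: "'a \<Rightarrow> complex fps" and g :: "'b \<Rightarrow> complex fps"
  assumes f: "(f has_sum F) A" and g: "(g has_sum G) B"
  shows   "((\<lambda>(a, b). f a * g b) has_sum (F * G)) (A \<times> B)"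
proof (rule has_sum_fpsI)
  fix n
  \<comment> \<open>Coefficient n of a product sees only coefficients up to n, and for each of these
    only finitely many indices contribute.\<close>
  define A' where "A' = (\<Union>i\<le>n. {a\<in>A. f a $ i \<noteq> 0})"
  define B' where "B' = (\<Union>i\<le>n. {b\<in>B. g b $ i \<noteq> 0})"
  have fin: "finite A'" "finite B'"
    using has_sum_fpsD(1)[OF f] has_sum_fpsD(1)[OF g] by (auto simp: A'_def B'_def)
  have sub: "{x \<in> A \<times> B. (case x of (a, b) \<Rightarrow> f a * g b) $ n \<noteq> 0} \<subseteq> A' \<times> B'"
  proof
    fix x assume "x \<in> {x \<in> A \<times> B. (case x of (a, b) \<Rightarrow> f a * g b) $ n \<noteq> 0}"
    then obtain a b where x: "x = (a, b)" "a \<in> A" "b \<in> B" "(f a * g b) $ n \<noteq> 0"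
      by auto
    then obtain i where "i \<in> {0..n}" "f a $ i * g b $ (n - i) \<noteq> 0"
      unfolding fps_mult_nth by (meson sum.not_neutral_contains_not_neutral)
    thus "x \<in> A' \<times> B'" using x by (auto simp: A'_def B'_def)
  qed
  show "finite {x \<in> A \<times> B. (case x of (a, b) \<Rightarrow> f a * g b) $ n \<noteq> 0}"
    by (rule finite_subset[OF sub]) (use fin in auto)
  have F: "F $ i = (\<Sum>a\<in>A'. f a $ i)" if "i \<le> n" for i
    unfolding has_sum_fpsD(2)[OF f, of i] using fin that
    by (intro sum.mono_neutral_left) (auto simp: A'_def)
  have G: "G $ i = (\<Sum>b\<in>B'. g b $ i)" if "i \<le> n" for i
    unfolding has_sum_fpsD(2)[OF g, of i] using fin that
    by (intro sum.mono_neutral_left) (auto simp: B'_def)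
  have "(F * G) $ n = ((\<Sum>a\<in>A'. f a) * (\<Sum>b\<in>B'. g b)) $ n"
    by (rule fps_nth_mult_cong) (auto simp: F G fps_sum_nth)
  also have "\<dots> = (\<Sum>x\<in>A' \<times> B'. (case x of (a, b) \<Rightarrow> f a * g b) $ n)"
    by (simp add: sum_product sum.cartesian_product fps_sum_nth case_prod_unfold)
  also have "\<dots> = (\<Sum>x | x \<in> A \<times> B \<and> (case x of (a, b) \<Rightarrow> f a * g b) $ n \<noteq> 0.
                   (case x of (a, b) \<Rightarrow> f a * g b) $ n)"
    by (rule sum.mono_neutral_right) (use fin sub in \<open>auto simp: A'_def B'_def\<close>)
  finally show "(F * G) $ n = (\<Sum>x | x \<in> A \<times> B \<and> (case x of (a, b) \<Rightarrow> f a * g b) $ n \<noteq> 0.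
                   (case x of (a, b) \<Rightarrow> f a * g b) $ n)" .
qed

lemma has_sum_Un_disjoint_fps:
  fixes f :: "'a \<Rightarrow> complex fps"
  assumes "(f has_sum F) A" "(f has_sum G) B" "A \<inter> B = {}"
  shows   "(f has_sum (F + G)) (A \<union> B)"
proof (rule has_sum_fpsI)
  fix n
  have *: "{x\<in>A \<union> B. f x $ n \<noteq> 0} = {x\<in>A. f x $ n \<noteq> 0} \<union> {x\<in>B. f x $ n \<noteq> 0}" by auto
  note fin = has_sum_fpsD(1)[OF assms(1), of n] has_sum_fpsD(1)[OF assms(2), of n]
  show "finite {x\<in>A \<union> B. f x $ n \<noteq> 0}" unfolding * using fin by simp
  show "(F + G) $ n = (\<Sum>x | x \<in> A \<union> B \<and> f x $ n \<noteq> 0. f x $ n)"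
    unfolding * using fin assms(3)
    by (subst sum.union_disjoint) (auto simp: has_sum_fpsD(2)[OF assms(1)] has_sum_fpsD(2)[OF assms(2)])
qed

lemma has_sum_UN_disjoint_fps:
  fixes f :: "'a \<Rightarrow> complex fps"
  assumes "finite I" "\<And>i. i \<in> I \<Longrightarrow> (f has_sum F i) (A i)" "disjoint_family_on A I"
  shows   "(f has_sum (\<Sum>i\<in>I. F i)) (\<Union>i\<in>I. A i)"
  using assms
proof (induction I rule: finite_induct)
  case (insert i I)
  have "(f has_sum (F i + (\<Sum>i\<in>I. F i))) (A i \<union> (\<Union>i\<in>I. A i))"
  proof (rule has_sum_Un_disjoint_fps)
    show "A i \<inter> (\<Union>i\<in>I. A i) = {}"
      using insert.prems(2) insert.hyps(2) by (fastforce simp: disjoint_family_on_def)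
  qed (use insert in \<open>auto intro: insert.IH simp: disjoint_family_on_def\<close>)
  thus ?case using insert by simp
qed auto

lemma has_sum_cmult_fps:
  fixes f :: "'a \<Rightarrow> complex fps"
  assumes "(f has_sum F) A"
  shows   "((\<lambda>x. c * f x) has_sum (c * F)) A"
proof -
  have "((\<lambda>x. c * sum f x) \<longlongrightarrow> c * F) (finite_subsets_at_top A)"
    using assms unfolding has_sum_def by (intro tendsto_mult_fps tendsto_const)
  thus ?thesis unfolding has_sum_def by (simp add: sum_distrib_left)
qed

lemma has_sum_compose_X_power_fps:
  fixes f :: "'a \<Rightarrow> complex fps"
  assumes "(f has_sum F) A"
  shows   "((\<lambda>x. f x oo fps_X ^ d) has_sum (F oo fps_X ^ d)) A"
  using tendsto_compose_X_power_fps[of "sum f" F "finite_subsets_at_top A" d] assms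
  unfolding has_sum_def by (simp add: fps_compose_sum_distrib)

section \<open>The triple product identity\<close>

text \<open>The sum of \<epsilon>^n q^(theta_exp a b n) over all integers n is Ramanujan's theta
  function f(\<epsilon> q^a, \<epsilon> q^b) for \<epsilon> = 1 or -1. The truncation by
  \<open>nat\<close> never takes effect.\<close>

definition theta_exp :: "nat \<Rightarrow> nat \<Rightarrow> int \<Rightarrow> nat" where
  "theta_exp a b n = nat (int a * (n * (n + 1) div 2) + int b * (n * (n - 1) div 2))"

definition alt_sign :: "complex fps \<Rightarrow> int \<Rightarrow> complex fps" where
  "alt_sign \<epsilon> n = (if even n then 1 else \<epsilon>)"

lemma tri_nonneg: "0 \<le> (n::int) * (n + 1) div 2" "0 \<le> (n::int) * (n - 1) div 2"
proof -
  have "0 \<le> n * (n + 1)" "0 \<le> n * (n - 1)"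
    by (cases "n \<ge> 0"; cases "n \<ge> 1"; simp add: zero_le_mult_iff)+
  thus "0 \<le> n * (n + 1) div 2" "0 \<le> n * (n - 1) div 2" by simp_all
qed

lemma two_tri: "2 * ((n::int) * (n + 1) div 2) = n * (n + 1)" "2 * ((n::int) * (n - 1) div 2) = n * (n - 1)"
  by (auto intro!: dvd_mult_div_cancel)

lemma two_theta_exp: "2 * int (theta_exp a b n) = int a * (n * (n + 1)) + int b * (n * (n - 1))"
proof -
  have "int (theta_exp a b n) = int a * (n * (n + 1) div 2) + int b * (n * (n - 1) div 2)"
    using tri_nonneg[of n] by (simp add: theta_exp_def)
  hence "2 * int (theta_exp a b n) = int a * (2 * (n * (n + 1) div 2)) + int b * (2 * (n * (n - 1) div 2))"
    by (simp add: algebra_simps)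
  thus ?thesis by (simp only: two_tri)
qed

text \<open>Quadratic growth makes each coefficient of a theta series a finite sum and bounds the
  contributing indices by the degree.\<close>

lemma theta_exp_ge_square:
  assumes "a > 0" "b > 0"
  shows   "n\<^sup>2 \<le> int (theta_exp a b n)"
proof -
  have "0 \<le> n * (n + 1)" "0 \<le> n * (n - 1)" using two_tri[of n] tri_nonneg[of n] by linarith+
  hence "1 * (n * (n + 1)) \<le> int a * (n * (n + 1))" "1 * (n * (n - 1)) \<le> int b * (n * (n - 1))"
    using assms by (intro mult_right_mono; simp)+
  thus ?thesis using two_theta_exp[of a b n] by (simp add: algebra_simps power2_eq_square)
qed

lemma two_int_cancel: "2 * int m = 2 * int n \<Longrightarrow> m = n"
  by linarith

locale theta_poly =
  fixes a b :: nat and \<epsilon> :: "complex fps"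
  assumes pos: "a > 0" "b > 0" and eps: "\<epsilon> * \<epsilon> = 1"
begin

definition P :: "nat \<Rightarrow> complex fps" where
  "P n = (\<Prod>j<n. 1 - fps_X ^ ((a + b) * Suc j))"

text \<open>1/P extended by zero to negative indices, which removes the boundary cases. With it
  \<open>C\<close> is the Gaussian binomial coefficient (2n choose n+k) in base q^(a+b), zero for
  |k| > n.\<close>

definition I :: "int \<Rightarrow> complex fps" where
  "I m = (if m < 0 then 0 else inverse (P (nat m)))"

definition C :: "nat \<Rightarrow> int \<Rightarrow> complex fps" where
  "C n k = P (2 * n) * I (int n - k) * I (int n + k)"

definition fin_prod :: "nat \<Rightarrow> complex fps" where
  "fin_prod n = (\<Prod>j<n. (1 + \<epsilon> * fps_X ^ (a + (a + b) * j)) * (1 + \<epsilon> * fps_X ^ (b + (a + b) * j)))"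

definition trm :: "int \<Rightarrow> complex fps" where
  "trm k = alt_sign \<epsilon> k * fps_X ^ theta_exp a b k"

lemma P_nth_0 [simp]: "P n $ 0 = 1"
  unfolding P_def prod_nth_0 using pos by (intro prod.neutral) simp

lemma P_Suc: "P (Suc n) = P n * (1 - fps_X ^ ((a + b) * Suc n))"
  by (simp add: P_def del: mult_Suc_right)

text \<open>At m = 0 the extension by zero is consistent because the factor 1 - q^0
  vanishes.\<close>

lemma I_minus_1: "I (m - 1) = (1 - fps_X ^ ((a + b) * nat m)) * I m"
proof (cases "m \<le> 0")
  case True
  thus ?thesis by (auto simp: I_def)
next
  case False
  define n where "n = nat (m - 1)"
  have m: "m = int (Suc n)" using False by (simp add: n_def)
  have "I m = inverse (P n) * inverse (1 - fps_X ^ ((a + b) * Suc n))"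
    unfolding I_def m nat_int P_Suc fps_inverse_mult by simp
  hence "(1 - fps_X ^ ((a + b) * Suc n)) * I m =
      inverse (P n) * (inverse (1 - fps_X ^ ((a + b) * Suc n)) * (1 - fps_X ^ ((a + b) * Suc n)))"
    by (simp only: mult_ac)
  also have "inverse (1 - fps_X ^ ((a + b) * Suc n)) * (1 - fps_X ^ ((a + b) * Suc n)) = (1 :: complex fps)"
    by (rule inverse_mult_eq_1) (use pos in simp)
  finally have "(1 - fps_X ^ ((a + b) * Suc n)) * I m = inverse (P n)" by simp
  moreover have "m - 1 = int n" "nat m = Suc n" using m by simp_all
  ultimately show ?thesis by (simp only:) (simp add: I_def)
qed

lemma C_outside: "k > int n \<or> k < - int n \<Longrightarrow> C n k = 0"
  by (auto simp: C_def I_def)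

text \<open>Two steps of the q-Pascal rule at once. After taking out P(2n) A B the claim is
  (1-x)(1-z)(1+M) + x(1-z)(1-z') + z(1-x)(1-x') = (1-M)(1-xz), which follows from x z' = z x' =
  M.\<close>

lemma C_Suc:
  assumes "int i = int n + 1 - k" "int j = int n + 1 + k"
  shows   "C (Suc n) k = C n k * (1 + fps_X ^ ((a + b) * (2 * n + 1))) +
             fps_X ^ ((a + b) * i) * C n (k - 1) + fps_X ^ ((a + b) * j) * C n (k + 1)"
proof -
  define x z x' z' :: "complex fps" where "x = fps_X ^ ((a + b) * i)" and "z = fps_X ^ ((a + b) * j)"
    and "x' = fps_X ^ ((a + b) * nat (int i - 1))" and "z' = fps_X ^ ((a + b) * nat (int j - 1))"
  define M A B :: "complex fps" where "M = fps_X ^ ((a + b) * (2 * n + 1))" and "A = I (int i)" and "B = I (int j)"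
  have ij: "i + j = 2 * n + 2" using assms by linarith
  have I: "I (int n - k) = (1 - x) * A" "I (int n + k) = (1 - z) * B"
    "I (int n - (k - 1)) = A" "I (int n + (k - 1)) = (1 - z') * ((1 - z) * B)"
    "I (int n - (k + 1)) = (1 - x') * ((1 - x) * A)" "I (int n + (k + 1)) = B"
  proof -
    have *: "int n - k = int i - 1" "int n + k = int j - 1" "int n - (k - 1) = int i"
      "int n + (k - 1) = (int j - 1) - 1" "int n - (k + 1) = (int i - 1) - 1" "int n + (k + 1) = int j"
      using assms by simp_all
    show "I (int n - k) = (1 - x) * A" "I (int n + k) = (1 - z) * B"
      "I (int n - (k - 1)) = A" "I (int n + (k - 1)) = (1 - z') * ((1 - z) * B)"
      "I (int n - (k + 1)) = (1 - x') * ((1 - x) * A)" "I (int n + (k + 1)) = B"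
      unfolding * I_minus_1 nat_int x_def z_def x'_def z'_def A_def B_def by (rule refl)+
  qed
  have I': "I (int (Suc n) - k) = A" "I (int (Suc n) + k) = B"
  proof -
    have *: "int (Suc n) - k = int i" "int (Suc n) + k = int j" using assms by simp_all
    show "I (int (Suc n) - k) = A" "I (int (Suc n) + k) = B" unfolding * A_def B_def by (rule refl)+
  qed
  have "P (2 * Suc n) = P (2 * n) * (1 - fps_X ^ ((a + b) * Suc (2 * n))) * (1 - fps_X ^ ((a + b) * Suc (Suc (2 * n))))"
    by (simp only: mult_Suc_right add_2_eq_Suc P_Suc)
  also have "fps_X ^ ((a + b) * Suc (Suc (2 * n))) = x * z"
    unfolding x_def z_def power_add [symmetric] distrib_left [symmetric] ij by simp
  finally have P: "P (2 * Suc n) = P (2 * n) * (1 - M) * (1 - x * z)"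
    by (simp add: M_def)
  \<comment> \<open>For j = 0 the truncated exponent of z' is off by one, but then 1 - z =
    0.\<close>
  have xz: "x * (1 - z) * (1 - z') = (x - M) * (1 - z)"
  proof (cases "j = 0")
    case True
    thus ?thesis by (simp add: z_def)
  next
    case False
    hence "i + nat (int j - 1) = 2 * n + 1" using ij by linarith
    hence "(a + b) * i + (a + b) * nat (int j - 1) = (a + b) * (2 * n + 1)"
      by (simp only: distrib_left [symmetric])
    hence "x * z' = M" by (simp add: x_def z'_def M_def flip: power_add)
    thus ?thesis by (simp add: algebra_simps)
  qed
  have zx: "z * (1 - x) * (1 - x') = (z - M) * (1 - x)"
  proof (cases "i = 0")
    case True
    thus ?thesis by (simp add: x_def)
  next
    case False
    hence "j + nat (int i - 1) = 2 * n + 1" using ij by linarith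
    hence "(a + b) * j + (a + b) * nat (int i - 1) = (a + b) * (2 * n + 1)"
      by (simp only: distrib_left [symmetric])
    hence "z * x' = M" by (simp add: z_def x'_def M_def flip: power_add)
    thus ?thesis by (simp add: algebra_simps)
  qed
  have "C n k * (1 + M) + x * C n (k - 1) + z * C n (k + 1) =
        P (2 * n) * A * B * ((1 - x) * (1 - z) * (1 + M) + x * (1 - z) * (1 - z') + z * (1 - x) * (1 - x'))"
    unfolding C_def I by (simp add: algebra_simps)
  also have "\<dots> = P (2 * n) * A * B * ((1 - M) * (1 - x * z))"
    unfolding xz zx by (simp add: algebra_simps)
  also have "\<dots> = C (Suc n) k"
    unfolding C_def I' P by (simp add: algebra_simps)
  finally show ?thesis by (simp add: M_def x_def z_def)
qed

lemma eps_alt_sign: "\<epsilon> * alt_sign \<epsilon> k = alt_sign \<epsilon> (k + 1)" "\<epsilon> * alt_sign \<epsilon> k = alt_sign \<epsilon> (k - 1)"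
  using eps by (auto simp: alt_sign_def)

lemma theta_exp_shift:
  assumes "int i = int n + 1 - k"
  shows   "theta_exp a b (k - 1) + (a + (a + b) * n) = theta_exp a b k + (a + b) * i"
          "int j = int n + 1 + k \<Longrightarrow> theta_exp a b (k + 1) + (b + (a + b) * n) = theta_exp a b k + (a + b) * j"
proof -
  have "2 * int (theta_exp a b (k - 1) + (a + (a + b) * n)) = 2 * int (theta_exp a b k + (a + b) * i)"
    unfolding of_nat_add of_nat_mult distrib_left two_theta_exp assms by (simp add: algebra_simps)
  thus "theta_exp a b (k - 1) + (a + (a + b) * n) = theta_exp a b k + (a + b) * i" by (rule two_int_cancel)
  assume j: "int j = int n + 1 + k"
  have "2 * int (theta_exp a b (k + 1) + (b + (a + b) * n)) = 2 * int (theta_exp a b k + (a + b) * j)"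
    unfolding of_nat_add of_nat_mult distrib_left two_theta_exp j by (simp add: algebra_simps)
  thus "theta_exp a b (k + 1) + (b + (a + b) * n) = theta_exp a b k + (a + b) * j" by (rule two_int_cancel)
qed

text \<open>Cauchy's finite form of the triple product. In the product of the two new factors the
  constant and the quadratic term stay at index k, as \<epsilon>^2 = 1, and the two linear terms
  shift k by 1 in either direction; since \<open>C\<close> vanishes outside its range, all sums
  extend to a common one.\<close>

lemma fin_prod_eq: "fin_prod n = (\<Sum>k\<in>{- int n..int n}. trm k * C n k)"
proof (induction n)
  case 0
  show ?case by (simp add: fin_prod_def trm_def C_def I_def P_def alt_sign_def theta_exp_def)
next
  case (Suc n)
  define R where "R = {- int (Suc n)..int (Suc n)}"
  define M where "M = (fps_X :: complex fps) ^ ((a + b) * (2 * n + 1))"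
  have ext: "(\<Sum>k\<in>S. g k * C n k) = (\<Sum>k\<in>{- int n..int n}. g k * C n k)"
    if "finite S" "{- int n..int n} \<subseteq> S" for g S
    using that by (intro sum.mono_neutral_right) (auto intro!: C_outside)
  have "fin_prod (Suc n) = fin_prod n * ((1 + \<epsilon> * fps_X ^ (a + (a + b) * n)) * (1 + \<epsilon> * fps_X ^ (b + (a + b) * n)))"
    by (simp add: fin_prod_def)
  also have "(1 + \<epsilon> * fps_X ^ (a + (a + b) * n)) * (1 + \<epsilon> * fps_X ^ (b + (a + b) * n)) =
      1 + \<epsilon> * fps_X ^ (a + (a + b) * n) + \<epsilon> * fps_X ^ (b + (a + b) * n) +
       (\<epsilon> * \<epsilon>) * fps_X ^ ((a + (a + b) * n) + (b + (a + b) * n))"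
    unfolding power_add[of _ "a + (a + b) * n"] by (simp add: algebra_simps)
  also have "(a + (a + b) * n) + (b + (a + b) * n) = (a + b) * (2 * n + 1)" by (simp add: algebra_simps)
  also have "1 + \<epsilon> * fps_X ^ (a + (a + b) * n) + \<epsilon> * fps_X ^ (b + (a + b) * n) + (\<epsilon> * \<epsilon>) * fps_X ^ ((a + b) * (2 * n + 1))
     = (1 + M) + \<epsilon> * fps_X ^ (a + (a + b) * n) + \<epsilon> * fps_X ^ (b + (a + b) * n)"
    by (simp add: eps M_def)
  finally have "fin_prod (Suc n) = fin_prod n * (1 + M) + fin_prod n * (\<epsilon> * fps_X ^ (a + (a + b) * n)) +
      fin_prod n * (\<epsilon> * fps_X ^ (b + (a + b) * n))"
    by (simp add: algebra_simps)
  also have "fin_prod n * (1 + M) = (\<Sum>k\<in>R. trm k * (C n k * (1 + M)))"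
    unfolding Suc.IH using ext[of R "\<lambda>k. trm k * (1 + M)"]
    by (simp add: R_def sum_distrib_left sum_distrib_right mult_ac)
  also have "fin_prod n * (\<epsilon> * fps_X ^ (a + (a + b) * n)) =
      (\<Sum>k\<in>{- int n - 2..int n}. (trm k * (\<epsilon> * fps_X ^ (a + (a + b) * n))) * C n k)"
    unfolding Suc.IH using ext[of "{- int n - 2..int n}" "\<lambda>k. trm k * (\<epsilon> * fps_X ^ (a + (a + b) * n))"]
    by (simp add: sum_distrib_left sum_distrib_right mult_ac)
  also have "\<dots> = (\<Sum>k\<in>R. trm k * (fps_X ^ ((a + b) * nat (int n + 1 - k)) * C n (k - 1)))"
  proof (rule sum.reindex_bij_witness[of _ "\<lambda>k. k - 1" "\<lambda>k. k + 1"])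
    fix k assume k: "k \<in> {- int n - 2..int n}"
    have "trm (k + 1) * fps_X ^ ((a + b) * nat (int n - k)) =
          alt_sign \<epsilon> (k + 1) * fps_X ^ (theta_exp a b (k + 1) + (a + b) * nat (int n - k))"
      by (simp add: trm_def power_add mult_ac)
    also have "theta_exp a b (k + 1) + (a + b) * nat (int n - k) = theta_exp a b k + (a + (a + b) * n)"
      using theta_exp_shift(1)[of "nat (int n - k)" n "k + 1"] k by simp
    also have "alt_sign \<epsilon> (k + 1) * fps_X ^ (theta_exp a b k + (a + (a + b) * n)) =
        trm k * (\<epsilon> * fps_X ^ (a + (a + b) * n))"
      by (simp add: trm_def power_add mult_ac flip: eps_alt_sign(1))
    finally show "trm (k + 1) * (fps_X ^ ((a + b) * nat (int n + 1 - (k + 1))) * C n (k + 1 - 1)) =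
        trm k * (\<epsilon> * fps_X ^ (a + (a + b) * n)) * C n k"
      by (simp add: mult_ac)
  qed (auto simp: R_def)
  also have "fin_prod n * (\<epsilon> * fps_X ^ (b + (a + b) * n)) =
      (\<Sum>k\<in>{- int n..int n + 2}. (trm k * (\<epsilon> * fps_X ^ (b + (a + b) * n))) * C n k)"
    unfolding Suc.IH using ext[of "{- int n..int n + 2}" "\<lambda>k. trm k * (\<epsilon> * fps_X ^ (b + (a + b) * n))"]
    by (simp add: sum_distrib_left sum_distrib_right mult_ac)
  also have "\<dots> = (\<Sum>k\<in>R. trm k * (fps_X ^ ((a + b) * nat (int n + 1 + k)) * C n (k + 1)))"
  proof (rule sum.reindex_bij_witness[of _ "\<lambda>k. k + 1" "\<lambda>k. k - 1"])
    fix k assume k: "k \<in> {- int n..int n + 2}"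
    have "trm (k - 1) * fps_X ^ ((a + b) * nat (int n + k)) =
          alt_sign \<epsilon> (k - 1) * fps_X ^ (theta_exp a b (k - 1) + (a + b) * nat (int n + k))"
      by (simp add: trm_def power_add mult_ac)
    also have "theta_exp a b (k - 1) + (a + b) * nat (int n + k) = theta_exp a b k + (b + (a + b) * n)"
      using theta_exp_shift(2)[of "nat (int n + 2 - k)" n "k - 1" "nat (int n + k)"] k by simp
    also have "alt_sign \<epsilon> (k - 1) * fps_X ^ (theta_exp a b k + (b + (a + b) * n)) =
        trm k * (\<epsilon> * fps_X ^ (b + (a + b) * n))"
      by (simp add: trm_def power_add mult_ac flip: eps_alt_sign(2))
    finally show "trm (k - 1) * (fps_X ^ ((a + b) * nat (int n + 1 + (k - 1))) * C n (k - 1 + 1)) =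
        trm k * (\<epsilon> * fps_X ^ (b + (a + b) * n)) * C n k"
      by (simp add: mult_ac)
  qed (auto simp: R_def)
  also have "(\<Sum>k\<in>R. trm k * (C n k * (1 + M))) +
       (\<Sum>k\<in>R. trm k * (fps_X ^ ((a + b) * nat (int n + 1 - k)) * C n (k - 1))) +
       (\<Sum>k\<in>R. trm k * (fps_X ^ ((a + b) * nat (int n + 1 + k)) * C n (k + 1))) =
     (\<Sum>k\<in>R. trm k * C (Suc n) k)"
    unfolding sum.distrib [symmetric]
  proof (intro sum.cong refl)
    fix k assume "k \<in> R"
    hence "int (nat (int n + 1 - k)) = int n + 1 - k" "int (nat (int n + 1 + k)) = int n + 1 + k"
      by (auto simp: R_def)
    from C_Suc[OF this] show "trm k * (C n k * (1 + M)) + trm k * (fps_X ^ ((a + b) * nat (int n + 1 - k)) * C n (k - 1)) +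
        trm k * (fps_X ^ ((a + b) * nat (int n + 1 + k)) * C n (k + 1)) = trm k * C (Suc n) k"
      by (simp add: M_def distrib_left)
  qed
  finally show ?case by (simp add: R_def)
qed

definition Pinf :: "complex fps" where "Pinf = qp 1 (a + b) (a + b)"

lemma LIMSEQ_P: "P \<longlonglongrightarrow> Pinf"
  using LIMSEQ_qp[of "a + b" "a + b" 1] pos by (simp add: P_def[abs_def] Pinf_def)

lemma Pinf_nth_0 [simp]: "Pinf $ 0 = 1"
  using pos by (simp add: Pinf_def)

text \<open>The three factors tend to the Euler product and twice to its inverse, so one inverse is
  left.\<close>

lemma LIMSEQ_C: "(\<lambda>n. C n k) \<longlonglongrightarrow> inverse Pinf"
proof -
  have lim: "(\<lambda>n. inverse (P n)) \<longlonglongrightarrow> inverse Pinf"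
    by (rule tendsto_inverse_fps[OF LIMSEQ_P]) auto
  have I: "(\<lambda>n. I (int n + l)) \<longlonglongrightarrow> inverse Pinf" for l
  proof -
    have "filterlim (\<lambda>n. nat (int n + l)) sequentially sequentially"
    proof (unfold filterlim_at_top, safe)
      fix Z
      show "eventually (\<lambda>n. Z \<le> nat (int n + l)) sequentially"
        using eventually_ge_at_top[of "nat (int Z - l)"] by eventually_elim linarith
    qed
    from filterlim_compose[OF lim this] have "(\<lambda>n. inverse (P (nat (int n + l)))) \<longlonglongrightarrow> inverse Pinf" .
    moreover have "eventually (\<lambda>n. inverse (P (nat (int n + l))) = I (int n + l)) sequentially"
      using eventually_ge_at_top[of "nat (- l)"] by eventually_elim (auto simp: I_def)
    ultimately show ?thesis by (rule Lim_transform_eventually)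
  qed
  have "(\<lambda>n. P (2 * n)) \<longlonglongrightarrow> Pinf"
    using filterlim_compose[OF LIMSEQ_P filterlim_mult_const[of 2]] by (simp add: mult.commute)
  from tendsto_mult_fps[OF tendsto_mult_fps[OF this I[of "-k"]] I[of k]]
  have "(\<lambda>n. C n k) \<longlonglongrightarrow> Pinf * inverse Pinf * inverse Pinf" by (simp add: C_def)
  also have "Pinf * inverse Pinf = 1" using inverse_mult_eq_1'[of Pinf] by simp
  finally show ?thesis by simp
qed

lemma LIMSEQ_fin_prod: "fin_prod \<longlonglongrightarrow> qp (-\<epsilon>) a (a + b) * qp (-\<epsilon>) b (a + b)"
proof -
  have "(\<lambda>n. (\<Prod>j<n. 1 - (-\<epsilon>) * fps_X ^ (a + (a + b) * j)) * (\<Prod>j<n. 1 - (-\<epsilon>) * fps_X ^ (b + (a + b) * j)))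
     \<longlonglongrightarrow> qp (-\<epsilon>) a (a + b) * qp (-\<epsilon>) b (a + b)"
    by (intro tendsto_mult_fps LIMSEQ_qp) (use pos in auto)
  thus ?thesis by (simp add: fin_prod_def[abs_def] prod.distrib)
qed

lemma square_gt: "k \<notin> {- int D..int D} \<Longrightarrow> int D < k\<^sup>2"
proof -
  assume "k \<notin> {- int D..int D}"
  hence "int D + 1 \<le> \<bar>k\<bar>" by auto
  moreover have "\<bar>k\<bar> * 1 \<le> \<bar>k\<bar> * \<bar>k\<bar>" using calculation by (intro mult_left_mono) auto
  ultimately show ?thesis by (simp add: power2_eq_square)
qed

lemma trm_mult_nth_0:
  assumes "k \<notin> {- int D..int D}" "d \<le> D"
  shows   "(trm k * f) $ d = 0"
proof -
  have "d < theta_exp a b k"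
    using square_gt[OF assms(1)] theta_exp_ge_square[OF pos, of k] assms(2) by linarith
  moreover have "trm k * f = fps_X ^ theta_exp a b k * (alt_sign \<epsilon> k * f)"
    by (simp add: trm_def mult_ac)
  ultimately show ?thesis by (simp only: fps_X_power_mult_nth if_True)
qed

text \<open>Termwise limit of the finite form: in degree D only |k| \<le> D contributes, because the
  exponent is at least k^2, and there the coefficients of \<open>C n k\<close> are eventually
  constant in n.\<close>

theorem triple_product: "(trm has_sum (qp (-\<epsilon>) a (a + b) * qp (-\<epsilon>) b (a + b) * qp 1 (a + b) (a + b))) UNIV"
proof -
  define Q where "Q = qp (-\<epsilon>) a (a + b) * qp (-\<epsilon>) b (a + b)"
  have Q: "Q $ D = ((\<Sum>k\<in>{- int D..int D}. trm k) * inverse Pinf) $ D" for D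
  proof -
    have "\<forall>k\<in>{- int D..int D}. eventually (\<lambda>n. \<forall>d\<in>{..D}. C n k $ d = inverse Pinf $ d) sequentially"
      using LIMSEQ_C by (auto simp: eventually_ball_finite_distrib tendsto_fps_iff)
    hence "eventually (\<lambda>n. \<forall>k\<in>{- int D..int D}. \<forall>d\<in>{..D}. C n k $ d = inverse Pinf $ d) sequentially"
      by (subst eventually_ball_finite_distrib) auto
    moreover have "eventually (\<lambda>n. fin_prod n $ D = Q $ D) sequentially"
      using LIMSEQ_fin_prod unfolding tendsto_fps_iff Q_def by blast
    ultimately have "eventually (\<lambda>n. Q $ D = ((\<Sum>k\<in>{- int D..int D}. trm k) * inverse Pinf) $ D) sequentially"
      using eventually_ge_at_top[of D]
    proof eventually_elim
      case (elim n)
      have "Q $ D = (\<Sum>k\<in>{- int n..int n}. (trm k * C n k) $ D)"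
        using elim(2) by (simp add: fin_prod_eq fps_sum_nth)
      also have "\<dots> = (\<Sum>k\<in>{- int D..int D}. (trm k * C n k) $ D)"
        using elim(3) by (intro sum.mono_neutral_right ballI trm_mult_nth_0[of _ D D]) auto
      also have "\<dots> = (\<Sum>k\<in>{- int D..int D}. (trm k * inverse Pinf) $ D)"
        by (intro sum.cong refl fps_nth_mult_cong) (use elim(1) in auto)
      finally show ?case by (simp add: sum_distrib_right fps_sum_nth)
    qed
    thus ?thesis by (auto simp: eventually_sequentially)
  qed
  define T where "T = Abs_fps (\<lambda>D. (\<Sum>k\<in>{- int D..int D}. trm k) $ D)"
  have T: "T $ d = (\<Sum>k\<in>{- int D..int D}. trm k $ d)" if "d \<le> D" for d D
  proof -
    have "(\<Sum>k\<in>{- int D..int D}. trm k $ d) = (\<Sum>k\<in>{- int d..int d}. trm k $ d)"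
      by (intro sum.mono_neutral_right ballI) (use that trm_mult_nth_0[of _ d d 1] in auto)
    thus ?thesis by (simp add: T_def fps_sum_nth)
  qed
  have "Q = T * inverse Pinf"
  proof (rule fps_ext)
    fix D
    have "(T * inverse Pinf) $ D = ((\<Sum>k\<in>{- int D..int D}. trm k) * inverse Pinf) $ D"
      by (rule fps_nth_mult_cong) (auto simp: T fps_sum_nth)
    thus "Q $ D = (T * inverse Pinf) $ D" by (simp add: Q)
  qed
  hence "Q * Pinf = T * (inverse Pinf * Pinf)" by (simp only: mult.assoc)
  hence "Q * Pinf = T" using inverse_mult_eq_1[of Pinf] by simp
  moreover have "(trm has_sum T) UNIV"
  proof (rule has_sum_fpsI)
    fix D
    have sub: "{k \<in> UNIV. trm k $ D \<noteq> 0} \<subseteq> {- int D..int D}"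
    proof (rule subsetI, rule ccontr)
      fix k assume "k \<in> {k \<in> UNIV. trm k $ D \<noteq> 0}" "k \<notin> {- int D..int D}"
      thus False using trm_mult_nth_0[of k D D 1] by simp
    qed
    thus "finite {k \<in> UNIV. trm k $ D \<noteq> 0}" by (rule finite_subset) auto
    show "T $ D = (\<Sum>k | k \<in> UNIV \<and> trm k $ D \<noteq> 0. trm k $ D)"
      unfolding T[OF order.refl] by (rule sum.mono_neutral_right) (use sub in auto)
  qed
  ultimately show ?thesis by (simp add: Q_def Pinf_def)
qed

end

section \<open>Theta identities\<close>

lemma has_sum_unique_fps:
  fixes f :: "'a \<Rightarrow> complex fps"
  assumes "(f has_sum F) A" "(f has_sum G) A"
  shows   "F = G"
  by (rule fps_ext) (simp only: has_sum_fpsD(2)[OF assms(1)] has_sum_fpsD(2)[OF assms(2)])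

text \<open>The product side of Ramanujan's f(\<epsilon> q^a, \<epsilon> q^b).\<close>

definition Th :: "complex fps \<Rightarrow> nat \<Rightarrow> nat \<Rightarrow> complex fps" where
  "Th \<epsilon> a b = qp (-\<epsilon>) a (a + b) * qp (-\<epsilon>) b (a + b) * qp 1 (a + b) (a + b)"

lemma has_sum_Th:
  assumes "a > 0" "b > 0" "\<epsilon> * \<epsilon> = 1"
  shows   "((\<lambda>n. alt_sign \<epsilon> n * fps_X ^ theta_exp a b n) has_sum Th \<epsilon> a b) UNIV"
proof -
  interpret theta_poly a b \<epsilon> by unfold_locales (use assms in auto)
  show ?thesis using triple_product unfolding Th_def trm_def .
qed

lemma alt_sign_1 [simp]: "alt_sign 1 n = 1"
  by (simp add: alt_sign_def)

lemma alt_sign_add: "alt_sign (-1) (m + n) = alt_sign (-1) m * alt_sign (-1) n"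
  by (auto simp: alt_sign_def)

lemma alt_sign_compose [simp]: "d > 0 \<Longrightarrow> alt_sign (-1) m oo fps_X ^ d = alt_sign (-1) m"
  by (simp add: alt_sign_def fps_compose_uminus)

lemma has_sum_Th_mult:
  assumes "a > 0" "b > 0" "c > 0" "d > 0" "\<epsilon> * \<epsilon> = 1" "\<delta> * \<delta> = 1"
  shows   "((\<lambda>(m, n). alt_sign \<epsilon> m * alt_sign \<delta> n * fps_X ^ (theta_exp a b m + theta_exp c d n))
              has_sum (Th \<epsilon> a b * Th \<delta> c d)) UNIV"
  using has_sum_mult_fps[OF has_sum_Th[OF assms(1,2,5)] has_sum_Th[OF assms(3,4,6)]]
  by (simp add: power_add mult_ac case_prod_unfold)

lemma has_sum_Th_compose:
  assumes "a > 0" "b > 0" "e > 0"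
  shows   "((\<lambda>n. alt_sign (-1) n * fps_X ^ (e * theta_exp a b n)) has_sum (Th (-1) a b oo fps_X ^ e)) UNIV"
proof -
  have c0: "(fps_X ^ e :: complex fps) $ 0 = 0" using assms by simp
  have "(alt_sign (-1) n * fps_X ^ k) oo fps_X ^ e = alt_sign (-1) n * fps_X ^ (e * k)" for n k
    using assms by (simp only: fps_compose_mult_distrib[OF c0] fps_compose_power[OF c0, symmetric]
        fps_X_fps_compose_startby0[OF c0] alt_sign_compose power_mult)
  thus ?thesis
    using has_sum_compose_X_power_fps[OF has_sum_Th[OF assms(1,2), of "-1"], of e] by simp
qed

lemma has_sum_Th_compose_mult:
  assumes "a > 0" "b > 0" "c > 0" "d > 0" "e > 0"
  shows   "((\<lambda>(m, n). alt_sign (-1) (m + n) * fps_X ^ (e * (theta_exp a b m + theta_exp c d n)))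
              has_sum ((Th (-1) a b oo fps_X ^ e) * (Th (-1) c d oo fps_X ^ e))) UNIV"
  using has_sum_mult_fps[OF has_sum_Th_compose[OF assms(1,2,5)] has_sum_Th_compose[OF assms(3,4,5)]]
  by (simp add: power_add alt_sign_add distrib_left mult_ac case_prod_unfold)

section \<open>Splitting sums over pairs of integers into classes modulo 5 and modulo 2\<close>

definition cls :: "int \<Rightarrow> (int \<times> int) set" where
  "cls c = {(m, n). (2 * m - n) mod 5 = c}"

lemma has_sum_cls_union:
  fixes f :: "int \<times> int \<Rightarrow> complex fps"
  assumes "\<And>c. c \<in> {0..4} \<Longrightarrow> (f has_sum F c) (cls c)"
  shows   "(f has_sum (\<Sum>c\<in>{0..4}. F c)) UNIV"
proof -
  have "(f has_sum (\<Sum>c\<in>{0..4}. F c)) (\<Union>c\<in>{0..4}. cls c)"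
    by (rule has_sum_UN_disjoint_fps) (use assms in \<open>auto simp: disjoint_family_on_def cls_def\<close>)
  also have "(\<Union>c\<in>{0..4}. cls c) = UNIV"
  proof (intro equalityI subsetI UNIV_I)
    fix p :: "int \<times> int"
    have "(2 * fst p - snd p) mod 5 \<in> {0..4}" by auto
    thus "p \<in> (\<Union>c\<in>{0..4}. cls c)" by (intro UN_I[of "(2 * fst p - snd p) mod 5"]) (auto simp: cls_def)
  qed
  finally show ?thesis .
qed

text \<open>The form m^2 + n^2 becomes 5 (u^2 + v^2) plus linear terms, so each class again carries
  a product of two theta series; the signs and shifts allowed in \<open>has_sum_cls\<close> bring
  the linear terms into standard form.\<close>

definition cls_map :: "int \<Rightarrow> int \<times> int \<Rightarrow> int \<times> int" where
  "cls_map c = (\<lambda>(u, v). (v + 2 * u, 2 * v - u - c))"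

lemma bij_betw_cls_map:
  assumes "c \<in> {0..4}"
  shows   "bij_betw (cls_map c) UNIV (cls c)"
proof (rule bij_betw_byWitness[where f' = "\<lambda>(m, n). ((2 * m - n - c) div 5, m - 2 * ((2 * m - n - c) div 5))"])
  let ?h = "\<lambda>(m, n). ((2 * m - n - c) div 5, m - 2 * ((2 * m - n - c) div 5))"
  show "\<forall>p\<in>UNIV. ?h (cls_map c p) = p"
    by (auto simp: cls_map_def)
  show "\<forall>p\<in>cls c. cls_map c (?h p) = p"
  proof (rule ballI)
    fix p assume "p \<in> cls c"
    then obtain m n where p: "p = (m, n)" and "(m, n) \<in> cls c" by (cases p) auto
    hence "5 * ((2 * m - n - c) div 5) = 2 * m - n - c"
      by (intro dvd_mult_div_cancel) (auto simp: cls_def mod_eq_dvd_iff)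
    thus "cls_map c (?h p) = p" by (simp add: p cls_map_def)
  qed
  show "cls_map c ` UNIV \<subseteq> cls c"
  proof (rule image_subsetI)
    fix p :: "int \<times> int"
    obtain u v where p: "p = (u, v)" by (cases p)
    have "2 * (v + 2 * u) - (2 * v - u - c) = c + 5 * u" by simp
    thus "cls_map c p \<in> cls c" using assms by (simp add: p cls_map_def cls_def)
  qed
qed auto

lemma bij_affine:
  fixes \<alpha> \<beta> k l :: int
  assumes "\<alpha> \<in> {1, -1}" "\<beta> \<in> {1, -1}"
  shows   "bij (\<lambda>(u, v). (\<alpha> * u + k, \<beta> * v + l))"
  by (rule bij_betw_byWitness[of _ "\<lambda>(u, v). (\<alpha> * (u - k), \<beta> * (v - l))"])
     (use assms in auto)

lemma has_sum_cls:
  fixes f g :: "int \<times> int \<Rightarrow> complex fps"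
  assumes "c \<in> {0..4}" "\<alpha> \<in> {1, -1}" "\<beta> \<in> {1, -1}" "(g has_sum S) UNIV"
  assumes "\<And>u v. f (cls_map c (\<alpha> * u + k, \<beta> * v + l)) = g (u, v)"
  shows   "(f has_sum S) (cls c)"
proof -
  have "((\<lambda>p. f (cls_map c p)) has_sum S) UNIV"
    unfolding has_sum_reindex_bij_betw[OF bij_affine[OF assms(2,3)], where f = "\<lambda>p. f (cls_map c p)", of k l, symmetric]
    using assms(4,5) by (simp add: case_prod_unfold)
  thus ?thesis using has_sum_reindex_bij_betw[OF bij_betw_cls_map[OF assms(1)], of f] by simp
qed

text \<open>A sign-reversing involution of the index set makes every coefficient of the sum equal to
  its negative.\<close>

lemma has_sum_cls_zero:
  fixes f :: "int \<times> int \<Rightarrow> complex fps"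
  assumes "c \<in> {0..4}" "(f has_sum F) UNIV"
  assumes "\<And>p. j (j p) = p" "\<And>p. f (cls_map c (j p)) = - f (cls_map c p)"
  shows   "(f has_sum 0) (cls c)"
proof -
  have "((\<lambda>p. f (cls_map c p)) has_sum 0) UNIV"
  proof (rule has_sum_fpsI)
    fix n
    have inj: "inj (cls_map c)" using bij_betw_cls_map[OF assms(1)] by (rule bij_betw_imp_inj_on)
    have "finite (cls_map c -` {p \<in> UNIV. f p $ n \<noteq> 0})"
      by (rule finite_vimageI[OF has_sum_fpsD(1)[OF assms(2)] inj])
    thus "finite {p \<in> UNIV. f (cls_map c p) $ n \<noteq> 0}" by (simp add: vimage_def)
    define A where "A = {p \<in> UNIV. f (cls_map c p) $ n \<noteq> 0}"
    have "(\<Sum>p\<in>A. f (cls_map c p) $ n) = (\<Sum>p\<in>A. f (cls_map c (j p)) $ n)"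
      by (rule sum.reindex_bij_witness[of _ j j]) (auto simp: A_def assms(3,4))
    also have "\<dots> = - (\<Sum>p\<in>A. f (cls_map c p) $ n)" by (simp add: assms(4) sum_negf)
    finally show "0 $ n = (\<Sum>p | p \<in> UNIV \<and> f (cls_map c p) $ n \<noteq> 0. f (cls_map c p) $ n)"
      by (simp add: A_def)
  qed
  thus ?thesis using has_sum_reindex_bij_betw[OF bij_betw_cls_map[OF assms(1)], of f] by simp
qed

text \<open>Up to conjugation and a shift this is multiplication by 1 + i, which doubles m^2 + n^2;
  one substitution reaches the pairs with m + n even, the other those with m + n odd.\<close>

lemma has_sum_parity:
  fixes f g h :: "int \<times> int \<Rightarrow> complex fps"
  assumes "(g has_sum S) UNIV" "\<And>u v. f (u + v, u - v) = g (u, v)"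
  assumes "(h has_sum T) UNIV" "\<And>u v. f (-u - v - 1, v - u) = h (u, v)"
  shows   "(f has_sum (S + T)) UNIV"
proof -
  have "bij_betw (\<lambda>(u, v). (u + v, u - v)) UNIV {(m, n). even (m + n :: int)}"
    by (rule bij_betw_byWitness[of _ "\<lambda>(m, n). ((m + n) div 2, (m - n) div 2)"]) (auto; presburger)+
  from has_sum_reindex_bij_betw[OF this, of f S] have 1: "(f has_sum S) {(m, n). even (m + n :: int)}"
    using assms(1,2) by (simp add: case_prod_unfold)
  have "bij_betw (\<lambda>(u, v). (-u - v - 1, v - u)) UNIV {(m, n). odd (m + n :: int)}"
    by (rule bij_betw_byWitness[of _ "\<lambda>(m, n). ((-m - n - 1) div 2, (n - m - 1) div 2)"]) (auto; presburger)+
  from has_sum_reindex_bij_betw[OF this, of f T] have 2: "(f has_sum T) {(m, n). odd (m + n :: int)}"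
    using assms(3,4) by (simp add: case_prod_unfold)
  have "(f has_sum (S + T)) ({(m, n). even (m + n :: int)} \<union> {(m, n). odd (m + n :: int)})"
    by (rule has_sum_Un_disjoint_fps[OF 1 2]) auto
  also have "{(m, n). even (m + n :: int)} \<union> {(m, n). odd (m + n :: int)} = UNIV" by auto
  finally show ?thesis .
qed

text \<open>Doubled exponents are polynomials in the summation indices, by
  \<open>two_theta_exp\<close>, and can be compared without halves.\<close>

lemma signed_power_eqI:
  assumes "even m \<longleftrightarrow> even n" "2 * int e = 2 * int e'"
  shows   "alt_sign (-1) m * fps_X ^ e = alt_sign (-1) n * fps_X ^ e'"
  using assms by (simp add: alt_sign_def)

lemma two_times_numeral: "2 * (5 * int n) = 5 * (2 * int n)"
  by simp

lemmas exponent_simps = of_nat_add of_nat_Suc of_nat_1 of_nat_mult of_nat_numeral distrib_left two_times_numeral two_theta_exp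

theorem theta_identity_1:
  "Th 1 4 1 * Th (-1) 3 2 = Th (-1) 7 3 * Th (-1) 6 4 + fps_X * (Th (-1) 8 2 * Th (-1) 9 1)"
proof (rule has_sum_unique_fps)
  let ?f = "\<lambda>(m, n). alt_sign 1 m * alt_sign (-1) n * fps_X ^ (theta_exp 4 1 m + theta_exp 3 2 n)"
  show "(?f has_sum (Th 1 4 1 * Th (-1) 3 2)) UNIV" by (rule has_sum_Th_mult) auto
  show "(?f has_sum (Th (-1) 7 3 * Th (-1) 6 4 + fps_X * (Th (-1) 8 2 * Th (-1) 9 1))) UNIV"
  proof (rule has_sum_parity[OF has_sum_Th_mult _ has_sum_cmult_fps[OF has_sum_Th_mult]])
    fix u v :: int
    have "alt_sign (-1) (u - v) * fps_X ^ (theta_exp 4 1 (u + v) + theta_exp 3 2 (u - v)) =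
          alt_sign (-1) (u + v) * fps_X ^ (theta_exp 7 3 u + theta_exp 6 4 v)"
      by (rule signed_power_eqI, presburger, simp only: exponent_simps, simp add: algebra_simps)
    thus "?f (u + v, u - v) = (\<lambda>(m, n). alt_sign (-1) m * alt_sign (-1) n * fps_X ^ (theta_exp 7 3 m + theta_exp 6 4 n)) (u, v)"
      by (simp add: alt_sign_add)
    have "alt_sign (-1) (v - u) * fps_X ^ (theta_exp 4 1 (-u - v - 1) + theta_exp 3 2 (v - u)) =
          alt_sign (-1) (u + v) * fps_X ^ (1 + (theta_exp 8 2 u + theta_exp 9 1 v))"
      by (rule signed_power_eqI, presburger, simp only: exponent_simps, simp add: algebra_simps)
    thus "?f (-u - v - 1, v - u) = fps_X * (\<lambda>(m, n). alt_sign (-1) m * alt_sign (-1) n * fps_X ^ (theta_exp 8 2 m + theta_exp 9 1 n)) (u, v)"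
      by (simp add: alt_sign_add mult_ac)
  qed auto
qed

text \<open>Moving the sign from n to m affects only the class with m + n odd, where m and n have
  opposite parity; hence the one change of sign against the preceding identity.\<close>

theorem theta_identity_1':
  "Th (-1) 4 1 * Th 1 3 2 = Th (-1) 7 3 * Th (-1) 6 4 - fps_X * (Th (-1) 8 2 * Th (-1) 9 1)"
proof -
  let ?f = "\<lambda>(m, n). alt_sign (-1) m * alt_sign 1 n * fps_X ^ (theta_exp 4 1 m + theta_exp 3 2 n)"
  have "(?f has_sum (Th (-1) 7 3 * Th (-1) 6 4 + (- fps_X) * (Th (-1) 8 2 * Th (-1) 9 1))) UNIV"
  proof (rule has_sum_parity[OF has_sum_Th_mult _ has_sum_cmult_fps[OF has_sum_Th_mult]])
    fix u v :: int
    have "alt_sign (-1) (u + v) * fps_X ^ (theta_exp 4 1 (u + v) + theta_exp 3 2 (u - v)) =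
          alt_sign (-1) (u + v) * fps_X ^ (theta_exp 7 3 u + theta_exp 6 4 v)"
      by (rule signed_power_eqI, presburger, simp only: exponent_simps, simp add: algebra_simps)
    thus "?f (u + v, u - v) = (\<lambda>(m, n). alt_sign (-1) m * alt_sign (-1) n * fps_X ^ (theta_exp 7 3 m + theta_exp 6 4 n)) (u, v)"
      by (simp add: alt_sign_add)
    have "alt_sign (-1) (-u - v - 1) * fps_X ^ (theta_exp 4 1 (-u - v - 1) + theta_exp 3 2 (v - u)) =
          alt_sign (-1) (u + v + 1) * fps_X ^ (1 + (theta_exp 8 2 u + theta_exp 9 1 v))"
      by (rule signed_power_eqI, presburger, simp only: exponent_simps, simp add: algebra_simps)
    moreover have "alt_sign (-1) (u + v + 1) = - (alt_sign (-1) u * alt_sign (-1) v)"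
      by (simp add: alt_sign_def)
    ultimately show "?f (-u - v - 1, v - u) = (- fps_X) * (\<lambda>(m, n). alt_sign (-1) m * alt_sign (-1) n * fps_X ^ (theta_exp 8 2 m + theta_exp 9 1 n)) (u, v)"
      by (simp add: mult_ac)
  qed auto
  moreover have "(?f has_sum (Th (-1) 4 1 * Th 1 3 2)) UNIV" by (rule has_sum_Th_mult) auto
  ultimately show ?thesis using has_sum_unique_fps by fastforce
qed

text \<open>
  In the next three identities the five residue classes are the cosets of the ideal \<open>(2 + i)\<close> of
  \<open>\<int>[i]\<close>, and \<open>cls_map c\<close> is, up to a translation, the multiplication by a generator of this ideal.
\<close>

theorem theta_identity_2:
  defines "A \<equiv> Th (-1) 4 1 oo fps_X ^ 5" and "B \<equiv> Th (-1) 3 2 oo fps_X ^ 5"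
  shows "Th (-1) 4 1 * Th (-1) 3 2 = B * B - fps_X * (A * B) - fps_X ^ 2 * (A * A)"
proof -
  let ?f = "\<lambda>(m, n). alt_sign (-1) m * alt_sign (-1) n * fps_X ^ (theta_exp 4 1 m + theta_exp 3 2 n)"
  let ?g = "\<lambda>a b c d (m, n). alt_sign (-1) (m + n) * fps_X ^ (5 * (theta_exp a b m + theta_exp c d n))"
  have f: "(?f has_sum (Th (-1) 4 1 * Th (-1) 3 2)) UNIV" by (rule has_sum_Th_mult) auto
  have f': "?f (m, n) = alt_sign (-1) (m + n) * fps_X ^ (theta_exp 4 1 m + theta_exp 3 2 n)" for m n
    by (simp add: alt_sign_add)
  have neg: "- (alt_sign (-1) m * F) = alt_sign (-1) (m + 1) * F" for m F by (simp add: alt_sign_def)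
  \<comment> \<open>With r = q A / B, the Rogers-Ramanujan continued fraction at 5 \<tau>, the three
    surviving classes 0, 1, 3 are proportional to 1/r, -r and -1. In the classes 2 and 4 reflections
    in u and in v cancel the terms in pairs.\<close>
  define F where "F = (\<lambda>c::int. if c = 0 then B * B else if c = 1 then (-(fps_X ^ 2)) * (A * A)
     else if c = 3 then (- fps_X) * (A * B) else 0)"
  have "(?f has_sum F c) (cls c)" if "c \<in> {0..4}" for c
  proof -
    have "c = 0 \<or> c = 1 \<or> c = 2 \<or> c = 3 \<or> c = 4" using that by (simp, presburger)
    then consider "c = 0" | "c = 1" | "c = 2" | "c = 3" | "c = 4" by blast
    thus ?thesis
    proof cases
      case 1
      have "(?f has_sum (B * B)) (cls 0)"
        unfolding B_def
      proof (rule has_sum_cls[of _ 1 1 _ _ _ 0 0, OF _ _ _ has_sum_Th_compose_mult])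
        show "?f (cls_map 0 (1 * u + 0, 1 * v + 0)) = ?g 3 2 3 2 (u, v)" for u v
          unfolding f' cls_map_def prod.case
          by (rule signed_power_eqI, presburger, simp only: exponent_simps, simp add: algebra_simps)
      qed auto
      thus ?thesis by (simp add: 1 F_def)
    next
      case 2
      have "(?f has_sum ((-(fps_X ^ 2)) * (A * A))) (cls 1)"
        unfolding A_def
      proof (rule has_sum_cls[of _ 1 "-1" _ _ _ 0 0, OF _ _ _ has_sum_cmult_fps[OF has_sum_Th_compose_mult]])
        show "?f (cls_map 1 (1 * u + 0, -1 * v + 0)) = (-(fps_X ^ 2)) * ?g 4 1 4 1 (u, v)" for u v
          unfolding f' cls_map_def prod.case mult_minus_left mult.left_commute[of "fps_X ^ 2"] power_add [symmetric] neg
          by (rule signed_power_eqI, presburger, simp only: exponent_simps, simp add: algebra_simps)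
      qed auto
      thus ?thesis by (simp add: 2 F_def)
    next
      case 3
      have "(?f has_sum 0) (cls 2)"
      proof (rule has_sum_cls_zero[OF _ f, where j = "\<lambda>(u, v). (-u - 1, v)"])
        fix p :: "int \<times> int"
        obtain u v where p: "p = (u, v)" by (cases p)
        show "?f (cls_map 2 (case p of (u, v) \<Rightarrow> (-u - 1, v))) = - ?f (cls_map 2 p)"
          unfolding p cls_map_def prod.case alt_sign_add [symmetric] neg
          by (rule signed_power_eqI, presburger, simp only: exponent_simps, simp add: algebra_simps)
      qed auto
      thus ?thesis by (simp add: 3 F_def)
    next
      case 4
      have "(?f has_sum ((- fps_X) * (A * B))) (cls 3)"
        unfolding A_def B_def
      proof (rule has_sum_cls[of _ "-1" "-1" _ _ _ "-1" 1, OF _ _ _ has_sum_cmult_fps[OF has_sum_Th_compose_mult]])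
        show "?f (cls_map 3 (-1 * u + -1, -1 * v + 1)) = (- fps_X) * ?g 4 1 3 2 (u, v)" for u v
          unfolding f' cls_map_def prod.case mult_minus_left mult.left_commute[of "fps_X"] power_Suc [symmetric] neg
          by (rule signed_power_eqI, presburger, simp only: exponent_simps, simp add: algebra_simps)
      qed auto
      thus ?thesis by (simp add: 4 F_def)
    next
      case 5
      have "(?f has_sum 0) (cls 4)"
      proof (rule has_sum_cls_zero[OF _ f, where j = "\<lambda>(u, v). (u, 3 - v)"])
        fix p :: "int \<times> int"
        obtain u v where p: "p = (u, v)" by (cases p)
        show "?f (cls_map 4 (case p of (u, v) \<Rightarrow> (u, 3 - v))) = - ?f (cls_map 4 p)"
          unfolding p cls_map_def prod.case alt_sign_add [symmetric] neg
          by (rule signed_power_eqI, presburger, simp only: exponent_simps, simp add: algebra_simps)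
      qed auto
      thus ?thesis by (simp add: 5 F_def)
    qed
  qed
  from has_sum_unique_fps[OF f has_sum_cls_union[OF this]]
  have "Th (-1) 4 1 * Th (-1) 3 2 = (\<Sum>c\<in>{0..4}. F c)" by simp
  also have "{0..4} = {0, 1, 2, 3, 4 :: int}" by auto
  finally show ?thesis by (simp add: F_def)
qed

text \<open>\<open>A\<close> is the sum of (-1)^n q^(n^2). A quarter turn of (m, n) preserves the
  terms and maps class c to class 2c, so the four nonzero classes contribute equally, whence the
  factor 4; class 0 gives the same series at q^5.\<close>

theorem theta_identity_3:
  defines "A \<equiv> Th (-1) 1 1"
  shows "A * A - (A oo fps_X ^ 5) * (A oo fps_X ^ 5) = - 4 * fps_X * (Th (-1) 9 1 * Th (-1) 7 3)"
proof -
  let ?f = "\<lambda>(m, n). alt_sign (-1) m * alt_sign (-1) n * fps_X ^ (theta_exp 1 1 m + theta_exp 1 1 n)"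
  let ?g = "\<lambda>a b c d (m, n). alt_sign (-1) m * alt_sign (-1) n * fps_X ^ (theta_exp a b m + theta_exp c d n)"
  have f: "(?f has_sum (A * A)) UNIV" unfolding A_def by (rule has_sum_Th_mult) auto
  have f': "?g a b c d (m, n) = alt_sign (-1) (m + n) * fps_X ^ (theta_exp a b m + theta_exp c d n)" for a b c d m n
    by (simp add: alt_sign_add)
  have neg: "- (alt_sign (-1) m * F) = alt_sign (-1) (m + 1) * F" for m F by (simp add: alt_sign_def)
  define F where "F = (\<lambda>c::int. if c = 0 then (A oo fps_X ^ 5) * (A oo fps_X ^ 5)
      else (- fps_X) * (Th (-1) 9 1 * Th (-1) 7 3))"
  have zero: "(?f has_sum ((A oo fps_X ^ 5) * (A oo fps_X ^ 5))) (cls 0)"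
    unfolding A_def
  proof (rule has_sum_cls[of _ 1 1 _ _ _ 0 0, OF _ _ _ has_sum_Th_compose_mult])
    show "?f (cls_map 0 (1 * u + 0, 1 * v + 0)) =
        (\<lambda>(m, n). alt_sign (-1) (m + n) * fps_X ^ (5 * (theta_exp 1 1 m + theta_exp 1 1 n))) (u, v)" for u v
      unfolding f' cls_map_def prod.case
      by (rule signed_power_eqI, presburger, simp only: exponent_simps, simp add: algebra_simps)
  qed auto
  have one: "(?f has_sum ((- fps_X) * (Th (-1) 7 3 * Th (-1) 9 1))) (cls 1)"
  proof (rule has_sum_cls[of _ 1 "-1" _ _ _ 0 0, OF _ _ _ has_sum_cmult_fps[OF has_sum_Th_mult]])
    show "?f (cls_map 1 (1 * u + 0, -1 * v + 0)) = (- fps_X) * ?g 7 3 9 1 (u, v)" for u v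
      unfolding f' cls_map_def prod.case mult_minus_left mult.left_commute[of "fps_X"] power_Suc [symmetric] neg
      by (rule signed_power_eqI, presburger, simp only: exponent_simps, simp add: algebra_simps)
  qed auto
  have two: "(?f has_sum ((- fps_X) * (Th (-1) 9 1 * Th (-1) 7 3))) (cls 2)"
  proof (rule has_sum_cls[of _ 1 1 _ _ _ 0 1, OF _ _ _ has_sum_cmult_fps[OF has_sum_Th_mult]])
    show "?f (cls_map 2 (1 * u + 0, 1 * v + 1)) = (- fps_X) * ?g 9 1 7 3 (u, v)" for u v
      unfolding f' cls_map_def prod.case mult_minus_left mult.left_commute[of "fps_X"] power_Suc [symmetric] neg
      by (rule signed_power_eqI, presburger, simp only: exponent_simps, simp add: algebra_simps)
  qed auto
  have three: "(?f has_sum ((- fps_X) * (Th (-1) 9 1 * Th (-1) 7 3))) (cls 3)"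
  proof (rule has_sum_cls[of _ "-1" "-1" _ _ _ "-1" 1, OF _ _ _ has_sum_cmult_fps[OF has_sum_Th_mult]])
    show "?f (cls_map 3 (-1 * u + -1, -1 * v + 1)) = (- fps_X) * ?g 9 1 7 3 (u, v)" for u v
      unfolding f' cls_map_def prod.case mult_minus_left mult.left_commute[of "fps_X"] power_Suc [symmetric] neg
      by (rule signed_power_eqI, presburger, simp only: exponent_simps, simp add: algebra_simps)
  qed auto
  have four: "(?f has_sum ((- fps_X) * (Th (-1) 7 3 * Th (-1) 9 1))) (cls 4)"
  proof (rule has_sum_cls[of _ "-1" 1 _ _ _ "-1" 2, OF _ _ _ has_sum_cmult_fps[OF has_sum_Th_mult]])
    show "?f (cls_map 4 (-1 * u + -1, 1 * v + 2)) = (- fps_X) * ?g 7 3 9 1 (u, v)" for u v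
      unfolding f' cls_map_def prod.case mult_minus_left mult.left_commute[of "fps_X"] power_Suc [symmetric] neg
      by (rule signed_power_eqI, presburger, simp only: exponent_simps, simp add: algebra_simps)
  qed auto
  have "(?f has_sum F c) (cls c)" if "c \<in> {0..4}" for c
  proof -
    have "c = 0 \<or> c = 1 \<or> c = 2 \<or> c = 3 \<or> c = 4" using that by (simp, presburger)
    then consider "c = 0" | "c = 1" | "c = 2" | "c = 3" | "c = 4" by blast
    thus ?thesis
      by cases (use zero one two three four in \<open>simp_all add: F_def mult_ac\<close>)
  qed
  from has_sum_unique_fps[OF f has_sum_cls_union[OF this]]
  have "A * A = (\<Sum>c\<in>{0..4}. F c)" by simp
  also have "{0..4} = {0, 1, 2, 3, 4 :: int}" by auto
  finally show ?thesis by (simp add: F_def)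
qed

definition tri :: "int \<Rightarrow> nat" where "tri n = nat (n * (n + 1) div 2)"

lemma two_int_tri: "2 * int (tri n) = n * (n + 1)"
  using two_tri(1)[of n] tri_nonneg(1)[of n] by (simp add: tri_def)

text \<open>Over all integers each triangular number occurs twice; n = -2k and n = 2k - 1 both yield
  the exponents of f(q, q^3).\<close>

lemma has_sum_tri: "((\<lambda>n. fps_X ^ tri n) has_sum (2 * Th 1 1 3)) UNIV"
proof -
  let ?S = "{n :: int. even n}" and ?T = "{n :: int. odd n}"
  have Th: "((\<lambda>n. fps_X ^ theta_exp 1 3 n) has_sum Th 1 1 3) UNIV" using has_sum_Th[of 1 3 1] by simp
  have bij: "bij_betw (\<lambda>n::int. -2 * n) UNIV ?S" "bij_betw (\<lambda>n::int. 2 * n - 1) UNIV ?T"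
    by (rule bij_betw_byWitness[of _ "\<lambda>n. -n div 2"], auto)
       (rule bij_betw_byWitness[of _ "\<lambda>n. (n + 1) div 2"], auto, presburger)
  have eq: "tri (-2 * n) = theta_exp 1 3 n" "tri (2 * n - 1) = theta_exp 1 3 n" for n
    by (rule two_int_cancel, simp only: two_int_tri two_theta_exp, simp add: algebra_simps)+
  have "((\<lambda>n. fps_X ^ tri n) has_sum Th 1 1 3) ?S" "((\<lambda>n. fps_X ^ tri n) has_sum Th 1 1 3) ?T"
    using has_sum_reindex_bij_betw[OF bij(1), of "\<lambda>n. fps_X ^ tri n" "Th 1 1 3"]
      has_sum_reindex_bij_betw[OF bij(2), of "\<lambda>n. fps_X ^ tri n" "Th 1 1 3"] Th
    unfolding eq by simp_all
  hence "((\<lambda>n. fps_X ^ tri n) has_sum (Th 1 1 3 + Th 1 1 3)) (?S \<union> ?T)"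
    by (rule has_sum_Un_disjoint_fps) auto
  also have "?S \<union> ?T = UNIV" by auto
  finally show ?thesis by (simp only: mult_2)
qed

text \<open>The exponents are symmetric about (-1/2, -1/2), a point of class 2 modulo 5; hence class
  2 reproduces the series at q^5 and the other four classes agree. Summing over all integers doubles
  each theta factor, and the resulting 4 cancels.\<close>

theorem theta_identity_4:
  defines "A \<equiv> Th 1 1 3"
  shows "A * A - fps_X * ((A oo fps_X ^ 5) * (A oo fps_X ^ 5)) = Th 1 4 1 * Th 1 3 2"
proof -
  let ?f = "\<lambda>(m, n). fps_X ^ (tri m + tri n) :: complex fps"
  let ?g = "\<lambda>a b c d (m, n). alt_sign 1 m * alt_sign 1 n * fps_X ^ (theta_exp a b m + theta_exp c d n)"
  have f: "(?f has_sum ((2 * A) * (2 * A))) UNIV"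
    using has_sum_mult_fps[OF has_sum_tri has_sum_tri] by (simp add: A_def power_add case_prod_unfold)
  have c0: "(fps_X ^ 5 :: complex fps) $ 0 = 0" by simp
  have "((\<lambda>n. fps_X ^ (5 * tri n)) has_sum ((2 * A) oo fps_X ^ 5)) UNIV"
    using has_sum_compose_X_power_fps[OF has_sum_tri, of 5]
    by (simp add: A_def power_mult fps_compose_power[OF c0, symmetric] fps_X_fps_compose_startby0[OF c0])
  moreover have "(2 * A) oo fps_X ^ 5 = 2 * (A oo fps_X ^ 5)"
    by (simp only: mult_2 fps_compose_add_distrib)
  ultimately have "((\<lambda>n. fps_X ^ (5 * tri n)) has_sum (2 * (A oo fps_X ^ 5))) UNIV" by simp
  from has_sum_mult_fps[OF this this]
  have f5: "((\<lambda>(m, n). fps_X ^ (5 * tri m + 5 * tri n)) has_sum ((2 * (A oo fps_X ^ 5)) * (2 * (A oo fps_X ^ 5)))) UNIV"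
    by (simp add: power_add case_prod_unfold)
  have powI: "fps_X ^ e = fps_X ^ e'" if "2 * int e = 2 * int e'" for e e' using that by simp
  note simps = of_nat_add of_nat_Suc of_nat_1 of_nat_mult of_nat_numeral distrib_left two_times_numeral two_theta_exp two_int_tri
  define F where "F = (\<lambda>c::int. if c = 2 then fps_X * ((2 * (A oo fps_X ^ 5)) * (2 * (A oo fps_X ^ 5)))
      else Th 1 4 1 * Th 1 3 2)"
  have two: "(?f has_sum (fps_X * ((2 * (A oo fps_X ^ 5)) * (2 * (A oo fps_X ^ 5))))) (cls 2)"
  proof (rule has_sum_cls[of _ 1 "-1" _ _ _ 0 0, OF _ _ _ has_sum_cmult_fps[OF f5]])
    show "?f (cls_map 2 (1 * u + 0, -1 * v + 0)) = fps_X * (\<lambda>(m, n). fps_X ^ (5 * tri m + 5 * tri n)) (u, v)" for u v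
      unfolding cls_map_def prod.case power_Suc [symmetric]
      by (rule powI, simp only: simps, simp add: algebra_simps)
  qed auto
  have zero: "(?f has_sum (Th 1 3 2 * Th 1 4 1)) (cls 0)"
  proof (rule has_sum_cls[of _ 1 1 _ _ _ 0 0, OF _ _ _ has_sum_Th_mult])
    show "?f (cls_map 0 (1 * u + 0, 1 * v + 0)) = ?g 3 2 4 1 (u, v)" for u v
      unfolding cls_map_def prod.case alt_sign_1 mult_1_left
      by (rule powI, simp only: simps, simp add: algebra_simps)
  qed auto
  have one: "(?f has_sum (Th 1 4 1 * Th 1 3 2)) (cls 1)"
  proof (rule has_sum_cls[of _ 1 "-1" _ _ _ 0 0, OF _ _ _ has_sum_Th_mult])
    show "?f (cls_map 1 (1 * u + 0, -1 * v + 0)) = ?g 4 1 3 2 (u, v)" for u v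
      unfolding cls_map_def prod.case alt_sign_1 mult_1_left
      by (rule powI, simp only: simps, simp add: algebra_simps)
  qed auto
  have three: "(?f has_sum (Th 1 4 1 * Th 1 3 2)) (cls 3)"
  proof (rule has_sum_cls[of _ "-1" 1 _ _ _ "-1" 1, OF _ _ _ has_sum_Th_mult])
    show "?f (cls_map 3 (-1 * u + -1, 1 * v + 1)) = ?g 4 1 3 2 (u, v)" for u v
      unfolding cls_map_def prod.case alt_sign_1 mult_1_left
      by (rule powI, simp only: simps, simp add: algebra_simps)
  qed auto
  have four: "(?f has_sum (Th 1 3 2 * Th 1 4 1)) (cls 4)"
  proof (rule has_sum_cls[of _ "-1" "-1" _ _ _ "-1" 1, OF _ _ _ has_sum_Th_mult])
    show "?f (cls_map 4 (-1 * u + -1, -1 * v + 1)) = ?g 3 2 4 1 (u, v)" for u v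
      unfolding cls_map_def prod.case alt_sign_1 mult_1_left
      by (rule powI, simp only: simps, simp add: algebra_simps)
  qed auto
  have "(?f has_sum F c) (cls c)" if "c \<in> {0..4}" for c
  proof -
    have "c = 0 \<or> c = 1 \<or> c = 2 \<or> c = 3 \<or> c = 4" using that by (simp, presburger)
    then consider "c = 0" | "c = 1" | "c = 2" | "c = 3" | "c = 4" by blast
    thus ?thesis
      by cases (use zero one two three four in \<open>simp_all add: F_def mult_ac\<close>)
  qed
  from has_sum_unique_fps[OF f has_sum_cls_union[OF this]]
  have "(2 * A) * (2 * A) = (\<Sum>c\<in>{0..4}. F c)" by simp
  also have "{0..4} = {0, 1, 2, 3, 4 :: int}" by auto
  finally have "4 * (A * A) = 4 * (fps_X * ((A oo fps_X ^ 5) * (A oo fps_X ^ 5)) + Th 1 4 1 * Th 1 3 2)"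
    by (simp add: F_def algebra_simps)
  hence "A * A = fps_X * ((A oo fps_X ^ 5) * (A oo fps_X ^ 5)) + Th 1 4 1 * Th 1 3 2"
    by (simp only: mult_cancel_left) simp
  thus ?thesis by simp
qed

section \<open>Relations between the products modulo 10\<close>

context
  fixes K a b c d e :: "'a :: field"
  assumes nz: "K \<noteq> 0" "a \<noteq> 0" "b \<noteq> 0" "c \<noteq> 0" "d \<noteq> 0" "e \<noteq> 0"
  assumes R1: "e\<^sup>2 * b * c\<^sup>2 = a * d * (b * d + K * a * c)"
  assumes R2: "a * d\<^sup>2 * e\<^sup>2 = b * c * (b * d - K * a * c)"
  assumes R3: "a ^ 4 * b ^ 4 * c\<^sup>2 * d\<^sup>2 * e ^ 4 - e ^ 4 = - 4 * K * a * b"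
  assumes R4: "c\<^sup>2 * d\<^sup>2 - K * a\<^sup>2 * b\<^sup>2 = e ^ 4 * a * b"
begin

text \<open>With K = q and a, ..., e the products over residue classes modulo 10, k is Ramanujan's
  level 10 parameter r(q) r(q^2)^2 and t is y; the quotients become rational in k. A general K
  allows the use at q and at q^5.\<close>

lemma level_10_relations:
  defines "k \<equiv> K * a * c / (b * d)" and "t \<equiv> K / (a ^ 3 * b ^ 3 * c\<^sup>2 * d\<^sup>2 * e ^ 4)"
  shows "k \<noteq> 0" "1 + k \<noteq> 0" "1 - k \<noteq> 0"
        "t * (1 - 4 * k - k\<^sup>2) = k"
        "(1 + k) / (1 - k) = b\<^sup>2 * c ^ 3 / (a\<^sup>2 * d ^ 3)"
        "c\<^sup>2 * d\<^sup>2 / (a * b * e ^ 4) = (1 + k - k\<^sup>2) / (1 - k\<^sup>2)"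
        "t * (e ^ 4 - 4 * K * a * b) = K * a * b"
proof -
  show "k \<noteq> 0" using nz by (simp add: k_def)
  have "(1 + k) * (b * d) = b * d + K * a * c" using nz by (simp add: k_def field_simps)
  hence "(1 + k) * (b * d) * (a * d) = e\<^sup>2 * b * c\<^sup>2" using R1 by (simp add: mult_ac)
  hence "b * ((1 + k) * (a * d\<^sup>2)) = b * (e\<^sup>2 * c\<^sup>2)" by (simp add: power2_eq_square mult_ac)
  hence p: "1 + k = e\<^sup>2 * c\<^sup>2 / (a * d\<^sup>2)" using nz by (simp add: eq_divide_eq)
  have "(1 - k) * (b * d) = b * d - K * a * c" using nz by (simp add: k_def field_simps)
  hence "(1 - k) * (b * d) * (b * c) = a * d\<^sup>2 * e\<^sup>2" using R2 by (simp add: mult_ac)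
  hence "d * ((1 - k) * (b\<^sup>2 * c)) = d * (e\<^sup>2 * a * d)" by (simp add: power2_eq_square mult_ac)
  hence m: "1 - k = e\<^sup>2 * a * d / (b\<^sup>2 * c)" using nz by (simp add: eq_divide_eq)
  show nz': "1 + k \<noteq> 0" "1 - k \<noteq> 0" unfolding p m using nz by simp_all
  show "(1 + k) / (1 - k) = b\<^sup>2 * c ^ 3 / (a\<^sup>2 * d ^ 3)"
    unfolding p m using nz by (simp add: field_simps power2_eq_square power3_eq_cube)
  have "1 - k\<^sup>2 = (1 + k) * (1 - k)" by (simp add: algebra_simps power2_eq_square)
  also have "\<dots> = e ^ 4 * c / (b\<^sup>2 * d)"
    unfolding p m using nz by (simp add: field_simps power2_eq_square power4_eq_xxxx)
  finally have k2: "1 - k\<^sup>2 = e ^ 4 * c / (b\<^sup>2 * d)" .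
  \<comment> \<open>\<open>w\<close> links the two parameters: w (1 - k^2) = k and t (1 - 4 w) =
    w.\<close>
  define w where "w = K * a * b / e ^ 4"
  have w: "w * (1 - k\<^sup>2) = k" unfolding k2 using nz by (simp add: w_def k_def field_simps power2_eq_square)
  have "c\<^sup>2 * d\<^sup>2 = (e ^ 4 + K * a * b) * a * b" using R4 by (simp add: algebra_simps power2_eq_square)
  hence "c\<^sup>2 * d\<^sup>2 / (a * b * e ^ 4) = 1 + w" using nz by (simp add: w_def field_simps)
  also have "\<dots> = (1 + k - k\<^sup>2) / (1 - k\<^sup>2)"
  proof -
    have "1 - k\<^sup>2 \<noteq> 0" using k2 nz by simp
    thus ?thesis using w by (simp add: field_simps)
  qed
  finally show "c\<^sup>2 * d\<^sup>2 / (a * b * e ^ 4) = (1 + k - k\<^sup>2) / (1 - k\<^sup>2)" .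
  have "a ^ 4 * b ^ 4 * c\<^sup>2 * d\<^sup>2 * e ^ 4 = e ^ 4 - 4 * K * a * b" using R3 by (simp add: algebra_simps)
  hence "t * (e ^ 4 - 4 * K * a * b) = t * (a ^ 3 * b ^ 3 * c\<^sup>2 * d\<^sup>2 * e ^ 4) * (a * b)"
    by (simp add: power3_eq_cube power4_eq_xxxx mult_ac)
  also have "t * (a ^ 3 * b ^ 3 * c\<^sup>2 * d\<^sup>2 * e ^ 4) = K" using nz by (simp add: t_def)
  finally show tw: "t * (e ^ 4 - 4 * K * a * b) = K * a * b" by (simp add: mult_ac)
  hence "t * (1 - 4 * w) = w" using nz by (simp add: w_def field_simps)
  hence "t * (1 - 4 * w) * (1 - k\<^sup>2) = w * (1 - k\<^sup>2)" by simp
  hence "t * ((1 - k\<^sup>2) - 4 * (w * (1 - k\<^sup>2))) = w * (1 - k\<^sup>2)" by (simp add: algebra_simps)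
  thus "t * (1 - 4 * k - k\<^sup>2) = k" unfolding w by (simp add: algebra_simps)
qed

end

text \<open>Everything is rational in k and r, with 1 + 4t = (1 - k^2)/P and 1 + 5t = Q/P, and r^5
  is rational in k. So each claim is a polynomial identity modulo the relation for r^5. In the
  application \<open>s\<close> is the continued fraction at doubled argument.\<close>

lemma rho_equations:
  fixes k r t :: "'a :: field"
  assumes nz: "k \<noteq> 0" "1 + k \<noteq> 0" "1 - k \<noteq> 0" "r \<noteq> 0" "1 - r - r\<^sup>2 \<noteq> 0"
  assumes t: "t * (1 - 4 * k - k\<^sup>2) = k" and r: "r ^ 5 * (1 + k)\<^sup>2 = k * (1 - k)\<^sup>2"
  defines "s \<equiv> r\<^sup>2 * (1 + k) / (1 - k)"
  defines "\<rho> \<equiv> r / (1 - r - r\<^sup>2)"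
  defines "y \<equiv> (1 + k - k\<^sup>2) / (1 - k\<^sup>2) * (1 / s - 1 - s) * \<rho> ^ 3"
  shows "(1 + 5 * t) * \<rho> ^ 5 = t * (1 + 4 * t)\<^sup>2 * (1 + 5 * \<rho> + 15 * \<rho>\<^sup>2 + 25 * \<rho> ^ 3 + 25 * \<rho> ^ 4)" (is ?A)
    and "(1 + 12 * t + 40 * t\<^sup>2) * (1 + 4 * t) * y =
           (1 + 5 * t) * ((1 + 4 * t) * (- 2 * t + \<rho> + 2 * \<rho>\<^sup>2) + 2 * (1 + 5 * t) * \<rho> ^ 3)" (is ?B)
    and "(1 + 4 * t) * ((1 + k - k\<^sup>2) / (1 - k\<^sup>2)) = 1 + 5 * t" (is ?C)
proof -
  define P Q S where "P = 1 - 4 * k - k\<^sup>2" and "Q = 1 + k - k\<^sup>2" and "S = 1 - r - r\<^sup>2"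
  have P0: "P \<noteq> 0" using t nz(1) by (auto simp: P_def)
  have k20: "1 - k\<^sup>2 \<noteq> 0"
  proof -
    have "1 - k\<^sup>2 = (1 + k) * (1 - k)" by (simp add: algebra_simps power2_eq_square)
    thus ?thesis using nz by simp
  qed
  have tP: "t * P = k" using t by (simp add: P_def)
  have t4: "(1 + 4 * t) * P = 1 - k\<^sup>2" using tP by (simp add: distrib_right mult.assoc P_def)
  have t5: "(1 + 5 * t) * P = Q" using tP by (simp add: distrib_right mult.assoc P_def Q_def)
  show ?C
  proof -
    have "(1 + 4 * t) * P * Q = (1 + 5 * t) * P * (1 - k\<^sup>2)" unfolding t4 t5 by simp
    hence "(1 + 4 * t) * Q = (1 + 5 * t) * (1 - k\<^sup>2)" using P0 by simp
    thus ?thesis using k20 by (simp add: Q_def field_simps)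
  qed
  have S0: "S \<noteq> 0" using nz by (simp add: S_def)
  have rS: "\<rho> * S = r" using S0 by (simp add: \<rho>_def S_def)
  \<comment> \<open>Homogeneous form of the classical r^(-5) - 11 - r^5 = u^5 + 5u^4 + 15u^3 + 25u^2
    + 25u for u = 1/r - 1 - r = S/r.\<close>
  have poly: "S ^ 5 + 5 * r * S ^ 4 + 15 * r\<^sup>2 * S ^ 3 + 25 * r ^ 3 * S\<^sup>2 + 25 * r ^ 4 * S = 1 - 11 * r ^ 5 - r ^ 10"
    unfolding S_def by algebra
  show ?A
  proof -
    \<comment> \<open>The factor (1 + k)^4 is what the replacement of r^5 and r^10 by expressions in
      k requires.\<close>
    have "Q * P\<^sup>2 * r ^ 5 * (1 + k) ^ 4 = k * (1 - k\<^sup>2)\<^sup>2 * (1 - 11 * r ^ 5 - r ^ 10) * (1 + k) ^ 4"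
      using r unfolding P_def Q_def by algebra
    hence "Q * P\<^sup>2 * r ^ 5 = k * (1 - k\<^sup>2)\<^sup>2 * (1 - 11 * r ^ 5 - r ^ 10)" using nz(2) by simp
    hence "(1 + 5 * t) * r ^ 5 * P ^ 3 = t * (1 + 4 * t)\<^sup>2 * (1 - 11 * r ^ 5 - r ^ 10) * P ^ 3"
      using t4 t5 tP by algebra
    hence "(1 + 5 * t) * r ^ 5 = t * (1 + 4 * t)\<^sup>2 * (1 - 11 * r ^ 5 - r ^ 10)" using P0 by simp
    hence "(1 + 5 * t) * r ^ 5 = t * (1 + 4 * t)\<^sup>2 *
        (S ^ 5 + 5 * r * S ^ 4 + 15 * r\<^sup>2 * S ^ 3 + 25 * r ^ 3 * S\<^sup>2 + 25 * r ^ 4 * S)"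
      by (simp only: poly)
    hence "((1 + 5 * t) * \<rho> ^ 5) * S ^ 5 =
        (t * (1 + 4 * t)\<^sup>2 * (1 + 5 * \<rho> + 15 * \<rho>\<^sup>2 + 25 * \<rho> ^ 3 + 25 * \<rho> ^ 4)) * S ^ 5"
      unfolding rS [symmetric] by algebra
    thus ?thesis using S0 by simp
  qed
  show ?B
  proof -
    \<comment> \<open>\<open>X\<close> is 1 - s - s^2 multiplied by (1 - k)^2 and written in r and
      k.\<close>
    define X where "X = (1 - k)\<^sup>2 - r\<^sup>2 * (1 - k\<^sup>2) - r ^ 4 * (1 + k)\<^sup>2"
    have s0: "s \<noteq> 0" using nz by (simp add: s_def)
    have s: "s * (1 - k) = r\<^sup>2 * (1 + k)" using nz by (simp add: s_def)
    have "(1 / s - 1 - s) * s = 1 - s - s\<^sup>2" using s0 by (simp add: field_simps power2_eq_square)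
    hence "(1 / s - 1 - s) * (s * (1 - k)) * (1 - k) = (1 - s - s\<^sup>2) * (1 - k)\<^sup>2"
      by (simp add: power2_eq_square mult_ac)
    also have "\<dots> = X" using s unfolding X_def by algebra
    finally have sX: "(1 / s - 1 - s) * (r\<^sup>2 * (1 + k) * (1 - k)) = X" unfolding s by (simp add: mult_ac)
    have "y * (1 - k\<^sup>2) = Q * (1 / s - 1 - s) * \<rho> ^ 3" using k20 by (simp add: y_def Q_def)
    hence "y * (1 - k\<^sup>2) * S ^ 3 * (r\<^sup>2 * (1 + k) * (1 - k)) = Q * r ^ 3 * ((1 / s - 1 - s) * (r\<^sup>2 * (1 + k) * (1 - k)))"
      using rS by algebra
    hence "r\<^sup>2 * (y * (1 - k\<^sup>2)\<^sup>2 * S ^ 3) = r\<^sup>2 * (Q * r * X)"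
      unfolding sX by algebra
    hence y: "y * (1 - k\<^sup>2)\<^sup>2 * S ^ 3 = Q * r * X" using nz by simp
    have "((1 - k\<^sup>2)\<^sup>2 + 4 * k * (1 - k\<^sup>2) + 8 * k\<^sup>2) * r * X =
        (1 - k\<^sup>2) * ((1 - k\<^sup>2) * (-2 * k * S ^ 3 + P * (r * S\<^sup>2 + 2 * r\<^sup>2 * S)) + 2 * Q * P * r ^ 3)"
      using r unfolding X_def S_def P_def Q_def by algebra
    hence "((1 - k\<^sup>2)\<^sup>2 + 4 * k * (1 - k\<^sup>2) + 8 * k\<^sup>2) * (y * (1 - k\<^sup>2)\<^sup>2 * S ^ 3) =
        Q * (1 - k\<^sup>2) * ((1 - k\<^sup>2) * (-2 * k * S ^ 3 + P * (r * S\<^sup>2 + 2 * r\<^sup>2 * S)) + 2 * Q * P * r ^ 3)"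
      unfolding y by algebra
    hence "(1 - k\<^sup>2) * (((1 - k\<^sup>2)\<^sup>2 + 4 * k * (1 - k\<^sup>2) + 8 * k\<^sup>2) * (1 - k\<^sup>2) * y * S ^ 3) =
        (1 - k\<^sup>2) * (Q * ((1 - k\<^sup>2) * (-2 * k * S ^ 3 + P * (r * S\<^sup>2 + 2 * r\<^sup>2 * S)) + 2 * Q * P * r ^ 3))"
      by algebra
    hence *: "((1 - k\<^sup>2)\<^sup>2 + 4 * k * (1 - k\<^sup>2) + 8 * k\<^sup>2) * (1 - k\<^sup>2) * y * S ^ 3 =
        Q * ((1 - k\<^sup>2) * (-2 * k * S ^ 3 + P * (r * S\<^sup>2 + 2 * r\<^sup>2 * S)) + 2 * Q * P * r ^ 3)"
      using k20 by simp
    have d: "(1 + 12 * t + 40 * t\<^sup>2) * P\<^sup>2 = (1 - k\<^sup>2)\<^sup>2 + 4 * k * (1 - k\<^sup>2) + 8 * k\<^sup>2"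
    proof -
      have "(1 + 12 * t + 40 * t\<^sup>2) * P\<^sup>2 = P\<^sup>2 + 12 * (t * P) * P + 40 * (t * P)\<^sup>2" by algebra
      also have "\<dots> = (1 - k\<^sup>2)\<^sup>2 + 4 * k * (1 - k\<^sup>2) + 8 * k\<^sup>2" unfolding tP unfolding P_def by algebra
      finally show ?thesis .
    qed
    have "((1 + 12 * t + 40 * t\<^sup>2) * (1 + 4 * t) * y) * (P ^ 3 * S ^ 3) =
        ((1 + 12 * t + 40 * t\<^sup>2) * P\<^sup>2) * ((1 + 4 * t) * P) * y * S ^ 3" by algebra
    also have "\<dots> = Q * ((1 - k\<^sup>2) * (-2 * k * S ^ 3 + P * (r * S\<^sup>2 + 2 * r\<^sup>2 * S)) + 2 * Q * P * r ^ 3)"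
      unfolding d t4 * ..
    also have "\<dots> = ((1 + 5 * t) * P) * (((1 + 4 * t) * P) * (-2 * (t * P) * S ^ 3 +
        P * ((\<rho> * S) * S\<^sup>2 + 2 * (\<rho> * S)\<^sup>2 * S)) + 2 * ((1 + 5 * t) * P) * P * (\<rho> * S) ^ 3)"
      unfolding t4 t5 tP rS ..
    also have "\<dots> = ((1 + 5 * t) * ((1 + 4 * t) * (- 2 * t + \<rho> + 2 * \<rho>\<^sup>2) + 2 * (1 + 5 * t) * \<rho> ^ 3)) * (P ^ 3 * S ^ 3)"
      by algebra
    finally have "((1 + 12 * t + 40 * t\<^sup>2) * (1 + 4 * t) * y) * (P ^ 3 * S ^ 3) =
        ((1 + 5 * t) * ((1 + 4 * t) * (- 2 * t + \<rho> + 2 * \<rho>\<^sup>2) + 2 * (1 + 5 * t) * \<rho> ^ 3)) * (P ^ 3 * S ^ 3)" .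
    thus ?thesis using P0 S0 by simp
  qed
qed

text \<open>
  For \<open>j \<le> 4\<close> these are the factors of the products over the residue classes \<open>\<plusminus>1\<close>, \<open>\<plusminus>3\<close>, \<open>\<plusminus>2\<close>, \<open>\<plusminus>4\<close>
  and \<open>5\<close> modulo 10.
\<close>

definition pA :: "complex fps" where "pA = qp 1 1 10 * qp 1 9 10"
definition pB :: "complex fps" where "pB = qp 1 3 10 * qp 1 7 10"
definition pC :: "complex fps" where "pC = qp 1 2 10 * qp 1 8 10"
definition pD :: "complex fps" where "pD = qp 1 4 10 * qp 1 6 10"
definition pE :: "complex fps" where "pE = qp 1 5 10"
definition pH :: "complex fps" where "pH = qp 1 10 10"

lemmas p_defs = pA_def pB_def pC_def pD_def pE_def pH_def

lemma p_nonzero [simp]: "pA \<noteq> 0" "pB \<noteq> 0" "pC \<noteq> 0" "pD \<noteq> 0" "pE \<noteq> 0" "pH \<noteq> 0"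
  by (simp_all add: p_defs)

lemma prod_lessThan_10: "(\<Prod>i<10. f i) = f 0 * f 1 * f 2 * f 3 * f 4 * f 5 * f 6 * f 7 * f 8 * (f (9::nat) :: 'a :: comm_monoid_mult)"
  by (simp add: lessThan_nat_numeral lessThan_Suc mult_ac)

lemma prod_lessThan_5: "(\<Prod>i<5. f i) = f 0 * f 1 * f 2 * f 3 * (f (4::nat) :: 'a :: comm_monoid_mult)"
  by (simp add: lessThan_nat_numeral lessThan_Suc mult_ac)

lemma prod_lessThan_2: "(\<Prod>i<2. f i) = f 0 * (f (1::nat) :: 'a :: comm_monoid_mult)"
  by (simp add: lessThan_nat_numeral lessThan_Suc mult_ac)

declare One_nat_def [simp del]
declare One_nat_def [symmetric, simp] numeral_2_eq_2 [symmetric, simp]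

section \<open>Product formulas for the theta series\<close>

lemma qp_1_1: "qp 1 1 1 = pA * pB * pC * pD * pE * pH"
  using qp_split[of 1 1 10 1] by (simp add: prod_lessThan_10 p_defs mult_ac)

lemma qp_2_2: "qp 1 2 2 = pC * pD * pH"
  using qp_split[of 2 2 5 1] by (simp add: prod_lessThan_5 p_defs mult_ac)

lemma qp_1_2: "qp 1 1 2 = pA * pB * pE"
  using qp_split[of 1 2 5 1] by (simp add: prod_lessThan_5 p_defs mult_ac)

lemma qp_mod_5: "qp \<delta> a 5 = qp \<delta> a 10 * qp \<delta> (a + 5) 10" if "a > 0"
  using qp_split[of a 5 2 \<delta>] that by (simp add: prod_lessThan_2)

lemma qp_5_5: "qp 1 5 5 = pE * pH"
  using qp_mod_5[of 5 1] by (simp add: p_defs)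

lemma qp_compose_1: "a > 0 \<Longrightarrow> N > 0 \<Longrightarrow> d > 0 \<Longrightarrow> qp 1 a N oo fps_X ^ d = qp 1 (d * a) (d * N)"
  by (rule qp_compose) auto

lemma Th_neg: "Th (-1) a b = qp 1 a (a + b) * qp 1 b (a + b) * qp 1 (a + b) (a + b)"
  by (simp add: Th_def)

lemma Th_values:
  "Th (-1) 4 1 = pA * pD * pE * pH" "Th (-1) 3 2 = pB * pC * pE * pH"
  "Th (-1) 7 3 = pB * pH" "Th (-1) 6 4 = pD * pH" "Th (-1) 9 1 = pA * pH" "Th (-1) 8 2 = pC * pH"
  "Th (-1) 1 1 = (pA * pB * pE)\<^sup>2 * (pC * pD * pH)"
  by (simp_all add: Th_neg qp_mod_5 qp_5_5 qp_1_2 qp_2_2)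
     (simp_all add: p_defs mult_ac power2_eq_square)

text \<open>Multiplying by the matching products pairs each 1 + q^m with 1 - q^m; the exponents
  double and fall into the even residue classes modulo 10.\<close>

lemma Th_pos_values:
  "Th 1 4 1 * (pA * pD) = pC * pE * pH" "Th 1 3 2 * (pB * pC) = pD * pE * pH"
proof -
  have 1: "pA * pD = qp 1 1 5 * qp 1 4 5" "pB * pC = qp 1 2 5 * qp 1 3 5"
    by (simp_all add: qp_mod_5) (simp_all add: p_defs mult_ac)
  have "Th 1 4 1 * (pA * pD) = (qp 1 4 5 * qp (-1) 4 5) * (qp 1 1 5 * qp (-1) 1 5) * qp 1 5 5"
    by (simp add: 1 Th_def mult_ac)
  also have "\<dots> = pC * pE * pH"
    using qp_neg_mult[of 4 5] qp_neg_mult[of 1 5] by (simp add: qp_5_5) (simp add: p_defs mult_ac)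
  finally show "Th 1 4 1 * (pA * pD) = pC * pE * pH" .
  have "Th 1 3 2 * (pB * pC) = (qp 1 3 5 * qp (-1) 3 5) * (qp 1 2 5 * qp (-1) 2 5) * qp 1 5 5"
    by (simp add: 1 Th_def mult_ac)
  also have "\<dots> = pD * pE * pH"
    using qp_neg_mult[of 3 5] qp_neg_mult[of 2 5] by (simp add: qp_5_5) (simp add: p_defs mult_ac)
  finally show "Th 1 3 2 * (pB * pC) = pD * pE * pH" .
qed

lemma Th_psi: "Th 1 1 3 * (pA * pB * pE) = pC * pD * pH"
proof -
  have "Th 1 1 3 * (pA * pB * pE) = qp (-1) 1 4 * qp (-1) 3 4 * qp 1 4 4 * qp 1 1 2"
    by (simp add: Th_def qp_1_2)
  also have "qp 1 1 2 = qp 1 1 4 * qp 1 3 4"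
    using qp_split[of 1 2 2 1] by (simp add: prod_lessThan_2)
  also have "qp (-1) 1 4 * qp (-1) 3 4 * qp 1 4 4 * (qp 1 1 4 * qp 1 3 4) =
      (qp 1 1 4 * qp (-1) 1 4) * (qp 1 3 4 * qp (-1) 3 4) * qp 1 4 4" by (simp add: mult_ac)
  also have "\<dots> = qp 1 2 4 * qp 1 4 4"
    using qp_neg_mult[of 1 4] qp_neg_mult[of 3 4] qp_split[of 4 4 2 1] qp_split[of 2 4 2 1]
    by (simp add: prod_lessThan_2 mult_ac)
  also have "\<dots> = pC * pD * pH"
    using qp_split[of 2 2 2 1] qp_2_2 by (simp add: prod_lessThan_2)
  finally show ?thesis .
qed

lemma compose_values:
  "pE * pH = (pA oo fps_X ^ 5) * (pB oo fps_X ^ 5) * (pC oo fps_X ^ 5) * (pD oo fps_X ^ 5) * (pE oo fps_X ^ 5) * (pH oo fps_X ^ 5)"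
  "pH = (pC oo fps_X ^ 5) * (pD oo fps_X ^ 5) * (pH oo fps_X ^ 5)"
  "(pA * pB * pE) oo fps_X ^ 5 = pE" "(pC * pD * pH) oo fps_X ^ 5 = pH"
  "(pA * pD * pE * pH) oo fps_X ^ 2 = pC * pH" "(pB * pC * pE * pH) oo fps_X ^ 2 = pD * pH"
proof -
  note [simp] = fps_compose_mult_distrib
  show "pE * pH = (pA oo fps_X ^ 5) * (pB oo fps_X ^ 5) * (pC oo fps_X ^ 5) * (pD oo fps_X ^ 5) * (pE oo fps_X ^ 5) * (pH oo fps_X ^ 5)"
    using qp_5_5 qp_compose_1[of 1 1 5] by (simp add: qp_1_1)
  show 2: "pH = (pC oo fps_X ^ 5) * (pD oo fps_X ^ 5) * (pH oo fps_X ^ 5)"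
    using qp_compose_1[of 2 2 5] by (simp add: qp_2_2) (simp add: p_defs)
  show "(pA * pB * pE) oo fps_X ^ 5 = pE"
    using qp_compose_1[of 1 2 5] by (simp only: qp_1_2) (simp add: p_defs)
  show "(pC * pD * pH) oo fps_X ^ 5 = pH" using 2 by simp
  have "pA * pD * pE * pH = qp 1 1 5 * qp 1 4 5 * qp 1 5 5"
    by (simp add: qp_mod_5) (simp add: p_defs mult_ac)
  thus "(pA * pD * pE * pH) oo fps_X ^ 2 = pC * pH"
    by (simp add: qp_compose_1) (simp add: p_defs)
  have "pB * pC * pE * pH = qp 1 2 5 * qp 1 3 5 * qp 1 5 5"
    by (simp add: qp_mod_5) (simp add: p_defs mult_ac)
  thus "(pB * pC * pE * pH) oo fps_X ^ 2 = pD * pH"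
    by (simp add: qp_compose_1) (simp add: p_defs mult_ac)
qed

text \<open>These are the hypotheses of \<open>level_10_relations\<close> with K = q. Each is one
  theta identity in product form, after cancelling powers of \<open>pH\<close> and further common
  products.\<close>

lemma level_10_theta_relations:
  "pE\<^sup>2 * pB * pC\<^sup>2 = pA * pD * (pB * pD + fps_X * pA * pC)"
  "pA * pD\<^sup>2 * pE\<^sup>2 = pB * pC * (pB * pD - fps_X * pA * pC)"
  "pA ^ 4 * pB ^ 4 * pC\<^sup>2 * pD\<^sup>2 * pE ^ 4 - pE ^ 4 = - 4 * fps_X * pA * pB"
  "pC\<^sup>2 * pD\<^sup>2 - fps_X * pA\<^sup>2 * pB\<^sup>2 = pE ^ 4 * pA * pB"
proof -
  have "pH\<^sup>2 * (pE\<^sup>2 * pB * pC\<^sup>2) = Th 1 4 1 * (pA * pD) * Th (-1) 3 2"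
    unfolding Th_pos_values Th_values by (simp add: power2_eq_square mult_ac)
  also have "\<dots> = (Th 1 4 1 * Th (-1) 3 2) * (pA * pD)" by (simp add: mult_ac)
  also have "\<dots> = pH\<^sup>2 * (pA * pD * (pB * pD + fps_X * pA * pC))"
    unfolding theta_identity_1 unfolding Th_values by (simp add: power2_eq_square algebra_simps)
  finally show "pE\<^sup>2 * pB * pC\<^sup>2 = pA * pD * (pB * pD + fps_X * pA * pC)" by simp
  have "pH\<^sup>2 * (pA * pD\<^sup>2 * pE\<^sup>2) = Th (-1) 4 1 * (Th 1 3 2 * (pB * pC))"
    unfolding Th_pos_values Th_values by (simp add: power2_eq_square mult_ac)
  also have "\<dots> = (Th (-1) 4 1 * Th 1 3 2) * (pB * pC)" by (simp add: mult_ac)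
  also have "\<dots> = pH\<^sup>2 * (pB * pC * (pB * pD - fps_X * pA * pC))"
    unfolding theta_identity_1' unfolding Th_values by (simp add: power2_eq_square algebra_simps)
  finally show "pA * pD\<^sup>2 * pE\<^sup>2 = pB * pC * (pB * pD - fps_X * pA * pC)" by simp
  have c0: "(fps_X ^ 5 :: complex fps) $ 0 = 0" by simp
  have phi5: "Th (-1) 1 1 oo fps_X ^ 5 = pE\<^sup>2 * pH"
    unfolding Th_values fps_compose_mult_distrib[OF c0] fps_compose_power[OF c0, symmetric]
    using compose_values(3,4) by (simp add: fps_compose_mult_distrib[OF c0])
  have "pH\<^sup>2 * (pA ^ 4 * pB ^ 4 * pC\<^sup>2 * pD\<^sup>2 * pE ^ 4 - pE ^ 4) =
      Th (-1) 1 1 * Th (-1) 1 1 - (Th (-1) 1 1 oo fps_X ^ 5) * (Th (-1) 1 1 oo fps_X ^ 5)"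
    unfolding phi5 unfolding Th_values by algebra
  also have "\<dots> = pH\<^sup>2 * (- 4 * fps_X * pA * pB)"
    unfolding theta_identity_3 unfolding Th_values by algebra
  finally have "pH\<^sup>2 * (pA ^ 4 * pB ^ 4 * pC\<^sup>2 * pD\<^sup>2 * pE ^ 4 - pE ^ 4) = pH\<^sup>2 * (- 4 * fps_X * pA * pB)" .
  thus "pA ^ 4 * pB ^ 4 * pC\<^sup>2 * pD\<^sup>2 * pE ^ 4 - pE ^ 4 = - 4 * fps_X * pA * pB"
    unfolding mult_cancel_left using p_nonzero(6) by (simp only: power_eq_0_iff simp_thms)
  have psi5: "(Th 1 1 3 oo fps_X ^ 5) * pE = pH"
  proof -
    have "(Th 1 1 3 * (pA * pB * pE)) oo fps_X ^ 5 = pH"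
      unfolding Th_psi by (rule compose_values(4))
    thus ?thesis unfolding fps_compose_mult_distrib[OF c0, of "Th 1 1 3"] compose_values(3) .
  qed
  have "pH\<^sup>2 * (pC\<^sup>2 * pD\<^sup>2 - fps_X * pA\<^sup>2 * pB\<^sup>2) =
     (Th 1 1 3 * Th 1 1 3 - fps_X * ((Th 1 1 3 oo fps_X ^ 5) * (Th 1 1 3 oo fps_X ^ 5))) * (pA * pB * pE)\<^sup>2"
    using Th_psi psi5 by algebra
  hence *: "pH\<^sup>2 * (pC\<^sup>2 * pD\<^sup>2 - fps_X * pA\<^sup>2 * pB\<^sup>2) = (Th 1 4 1 * Th 1 3 2) * (pA * pB * pE)\<^sup>2"
    unfolding theta_identity_4 .
  have "(pH\<^sup>2 * pC * pD) * (pC\<^sup>2 * pD\<^sup>2 - fps_X * pA\<^sup>2 * pB\<^sup>2) =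
      (Th 1 4 1 * (pA * pD)) * (Th 1 3 2 * (pB * pC)) * (pA * pB * pE\<^sup>2)"
    using * by algebra
  also have "\<dots> = (pH\<^sup>2 * pC * pD) * (pE ^ 4 * pA * pB)"
    unfolding Th_pos_values by algebra
  finally show "pC\<^sup>2 * pD\<^sup>2 - fps_X * pA\<^sup>2 * pB\<^sup>2 = pE ^ 4 * pA * pB" by simp
qed

text \<open>The second relation is the image of the first under q -> q^2, which turns residues
  modulo 5 into even residues modulo 10; it concerns the continued fraction at doubled
  argument.\<close>

lemma dissection_relation:
  defines "a \<equiv> pA oo fps_X ^ 5" and "b \<equiv> pB oo fps_X ^ 5" and "c \<equiv> pC oo fps_X ^ 5" and "d \<equiv> pD oo fps_X ^ 5"
    and "e \<equiv> pE oo fps_X ^ 5" and "h \<equiv> pH oo fps_X ^ 5"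
  shows "pA * pB * pC * pD * pE\<^sup>2 * pH\<^sup>2 = (b * c * e * h)\<^sup>2 - fps_X * (a * b * c * d * e\<^sup>2 * h\<^sup>2) - fps_X\<^sup>2 * (a * d * e * h)\<^sup>2" (is ?A)
    and "pC * pD * pH\<^sup>2 = (d * h)\<^sup>2 - fps_X\<^sup>2 * (c * d * h\<^sup>2) - fps_X ^ 4 * (c * h)\<^sup>2" (is ?B)
proof -
  have c0: "(fps_X ^ 5 :: complex fps) $ 0 = 0" by simp
  have c2: "(fps_X ^ 2 :: complex fps) $ 0 = 0" by simp
  have swap: "(f oo fps_X ^ 5) oo fps_X ^ 2 = (f oo fps_X ^ 2) oo fps_X ^ 5" for f :: "complex fps"
  proof -
    have "(fps_X ^ m :: complex fps) oo fps_X ^ n = fps_X ^ (n * m)" if "n > 0" for m n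
    proof -
      have cn: "(fps_X ^ n :: complex fps) $ 0 = 0" using that by simp
      show ?thesis
        by (simp only: fps_compose_power[OF cn, symmetric] fps_X_fps_compose_startby0[OF cn] power_mult)
    qed
    thus ?thesis
      by (simp add: fps_compose_assoc[OF c2 c0, symmetric] fps_compose_assoc[OF c0 c2, symmetric])
  qed
  have T: "Th (-1) 4 1 oo fps_X ^ 5 = a * d * e * h" "Th (-1) 3 2 oo fps_X ^ 5 = b * c * e * h"
    by (simp_all add: Th_values a_def b_def c_def d_def e_def h_def fps_compose_mult_distrib[OF c0])
  have T2: "(Th (-1) 4 1 oo fps_X ^ 5) oo fps_X ^ 2 = c * h" "(Th (-1) 3 2 oo fps_X ^ 5) oo fps_X ^ 2 = d * h"
    unfolding swap Th_values compose_values(5,6)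
    by (simp_all add: c_def d_def h_def fps_compose_mult_distrib[OF c0])
  show ?A using theta_identity_2 unfolding T unfolding Th_values by algebra
  have "(Th (-1) 4 1 * Th (-1) 3 2) oo fps_X ^ 2 =
     (d * h) * (d * h) - fps_X ^ 2 * ((c * h) * (d * h)) - (fps_X ^ 2) ^ 2 * ((c * h) * (c * h))"
    unfolding theta_identity_2 fps_compose_sub_distrib fps_compose_mult_distrib[OF c2] T2
      fps_compose_power[OF c2, symmetric] fps_X_fps_compose_startby0[OF c2] ..
  also have "(Th (-1) 4 1 * Th (-1) 3 2) oo fps_X ^ 2 = (pC * pH) * (pD * pH)"
    unfolding fps_compose_mult_distrib[OF c2, of "Th (-1) 4 1"] unfolding Th_values compose_values(5,6) ..
  finally show ?B by algebra
qed

section \<open>Dissection modulo 5\<close>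

lemma LIMSEQ_euler_product: "k > 0 \<Longrightarrow> (\<lambda>n. \<Prod>m<n. 1 - fps_X ^ (k * Suc m)) \<longlonglongrightarrow> qp 1 k k"
  using LIMSEQ_qp[of k k 1] by simp

lemma fps_divide_mult_cancel: "(g :: complex fps) $ 0 \<noteq> 0 \<Longrightarrow> f / g * g = f"
  by (simp add: fps_divide_unit mult.assoc inverse_mult_eq_1)

lemma prodinf_divide_mult:
  fixes f g :: "nat \<Rightarrow> complex fps"
  assumes "convergent_prod (\<lambda>m. f m / g m)" "(\<lambda>n. \<Prod>m<n. f m) \<longlonglongrightarrow> F" "(\<lambda>n. \<Prod>m<n. g m) \<longlonglongrightarrow> G"
  assumes "\<And>m. f m $ 0 \<noteq> 0" "\<And>m. g m $ 0 \<noteq> 0"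
  shows   "(\<Prod>m. f m / g m) * G = F"
proof (rule LIMSEQ_unique)
  have *: "f m / g m * g m = f m" for m by (rule fps_divide_mult_cancel) (rule assms(5))
  have "f m / g m \<noteq> 0" for m
  proof
    assume "f m / g m = 0"
    hence "f m = 0" using *[of m] by simp
    thus False using assms(4)[of m] by simp
  qed
  hence "(\<lambda>n. (\<Prod>m<n. f m / g m) * (\<Prod>m<n. g m)) \<longlonglongrightarrow> (\<Prod>m. f m / g m) * G"
    by (intro tendsto_mult_fps LIMSEQ_prodinf_fps assms(1,3))
  thus "(\<lambda>n. \<Prod>m<n. f m) \<longlonglongrightarrow> (\<Prod>m. f m / g m) * G"
    by (simp only: prod.distrib [symmetric] *)
qed fact

text \<open>Identifies y with the quotient t of \<open>level_10_relations\<close> for K = q: the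
  Euler products split into residue classes and most factors cancel.\<close>

lemma qy_product: "qy * fps_to_fls (pA ^ 3 * pB ^ 3 * pC\<^sup>2 * pD\<^sup>2 * pE ^ 4) = fls_X"
proof -
  let ?f = "\<lambda>m. (1 - fps_X ^ (2 * Suc m)) * (1 - fps_X ^ (10 * Suc m)) ^ 3 :: complex fps"
  let ?g = "\<lambda>m. (1 - fps_X ^ Suc m) ^ 3 * (1 - fps_X ^ (5 * Suc m)) :: complex fps"
  have "(\<Prod>m. ?f m / ?g m) * (qp 1 1 1 ^ 3 * qp 1 5 5) = qp 1 2 2 * qp 1 10 10 ^ 3"
  proof (rule prodinf_divide_mult[OF convergent_prod_qy])
    show "(\<lambda>n. \<Prod>m<n. ?f m) \<longlonglongrightarrow> qp 1 2 2 * qp 1 10 10 ^ 3"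
      unfolding prod.distrib prod_power_distrib [symmetric]
      by (intro tendsto_mult_fps tendsto_power_fps LIMSEQ_euler_product; simp)
    have "(\<lambda>n. \<Prod>m<n. 1 - fps_X ^ Suc m) \<longlonglongrightarrow> qp 1 1 1"
      using LIMSEQ_euler_product[OF zero_less_one] unfolding mult_1_left .
    thus "(\<lambda>n. \<Prod>m<n. ?g m) \<longlonglongrightarrow> qp 1 1 1 ^ 3 * qp 1 5 5"
      unfolding prod.distrib prod_power_distrib [symmetric]
      by (intro tendsto_mult_fps tendsto_power_fps) (auto intro!: LIMSEQ_euler_product simp del: mult_Suc_right power_Suc)
  qed (simp_all add: fps_mult_nth_0 fps_power_zeroth power_0_left)
  hence "(\<Prod>m. ?f m / ?g m) * ((pA * pB * pC * pD * pE * pH) ^ 3 * (pE * pH)) = pC * pD * pH * pH ^ 3"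
    unfolding qp_1_1 qp_2_2 qp_5_5 pH_def [symmetric] .
  hence "(pC * pD * pH ^ 4) * ((\<Prod>m. ?f m / ?g m) * (pA ^ 3 * pB ^ 3 * pC\<^sup>2 * pD\<^sup>2 * pE ^ 4)) = (pC * pD * pH ^ 4) * 1"
    by algebra
  hence *: "(\<Prod>m. ?f m / ?g m) * (pA ^ 3 * pB ^ 3 * pC\<^sup>2 * pD\<^sup>2 * pE ^ 4) = 1"
    by (subst (asm) mult_left_cancel) auto
  have "qy * fps_to_fls (pA ^ 3 * pB ^ 3 * pC\<^sup>2 * pD\<^sup>2 * pE ^ 4) =
      fls_X * fps_to_fls ((\<Prod>m. ?f m / ?g m) * (pA ^ 3 * pB ^ 3 * pC\<^sup>2 * pD\<^sup>2 * pE ^ 4))"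
    unfolding qy_def by (simp add: fls_times_fps_to_fls mult_ac)
  thus ?thesis unfolding * by simp
qed

lemma qZ_product: "qZ * fps_to_fls (pC * pD * pH) = fls_X\<^sup>2 * fps_to_fls (pH oo fps_X ^ 5)"
proof -
  let ?f = "\<lambda>m. 1 - fps_X ^ (50 * Suc m) :: complex fps"
  let ?g = "\<lambda>m. 1 - fps_X ^ (2 * Suc m) :: complex fps"
  have "(\<Prod>m. ?f m / ?g m) * qp 1 2 2 = qp 1 50 50"
    by (rule prodinf_divide_mult[OF convergent_prod_qZ LIMSEQ_euler_product LIMSEQ_euler_product]) auto
  also have "qp 1 50 50 = pH oo fps_X ^ 5" using qp_compose_1[of 10 10 5] by (simp add: pH_def)
  finally have *: "(\<Prod>m. ?f m / ?g m) * (pC * pD * pH) = pH oo fps_X ^ 5" by (simp only: qp_2_2)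
  have "qZ * fps_to_fls (pC * pD * pH) = fls_X\<^sup>2 * fps_to_fls ((\<Prod>m. ?f m / ?g m) * (pC * pD * pH))"
    unfolding qZ_def by (simp add: fls_times_fps_to_fls fps_to_fls_power mult_ac)
  thus ?thesis unfolding * .
qed

section \<open>Laurent series and the substitution q -> q^5\<close>

lemma fls_compose_power_numeral [simp]: "d > 0 \<Longrightarrow> fls_compose_power (numeral n :: complex fls) d = numeral n"
  by (metis fls_compose_power_const_left fls_const_numeral)

abbreviation sub5 :: "complex fls \<Rightarrow> complex fls" where "sub5 f \<equiv> fls_compose_power f 5"

definition fA where "fA = fps_to_fls pA"
definition fB where "fB = fps_to_fls pB"
definition fC where "fC = fps_to_fls pC"
definition fD where "fD = fps_to_fls pD"
definition fE where "fE = fps_to_fls pE"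
definition fH where "fH = fps_to_fls pH"

lemmas f_defs = fA_def fB_def fC_def fD_def fE_def fH_def

lemma f_nonzero [simp]: "fA \<noteq> 0" "fB \<noteq> 0" "fC \<noteq> 0" "fD \<noteq> 0" "fE \<noteq> 0" "fH \<noteq> 0"
  by (simp_all add: f_defs)

lemma sub5_eq_0_iff [simp]: "sub5 f = 0 \<longleftrightarrow> f = 0"
proof
  assume *: "sub5 f = 0"
  show "f = 0"
  proof (rule fls_eqI)
    fix n
    have "fls_nth (sub5 f) (5 * n) = fls_nth f n" by (simp add: fls_nth_compose_power)
    thus "fls_nth f n = fls_nth 0 n" using * by simp
  qed
qed simp

lemma sub5_f: "sub5 fA = fps_to_fls (pA oo fps_X ^ 5)" "sub5 fB = fps_to_fls (pB oo fps_X ^ 5)"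
  "sub5 fC = fps_to_fls (pC oo fps_X ^ 5)" "sub5 fD = fps_to_fls (pD oo fps_X ^ 5)"
  "sub5 fE = fps_to_fls (pE oo fps_X ^ 5)" "sub5 fH = fps_to_fls (pH oo fps_X ^ 5)"
  by (simp_all add: f_defs fls_compose_power_fps_to_fls)

lemma fls_relations:
  "fE\<^sup>2 * fB * fC\<^sup>2 = fA * fD * (fB * fD + fls_X * fA * fC)"
  "fA * fD\<^sup>2 * fE\<^sup>2 = fB * fC * (fB * fD - fls_X * fA * fC)"
  "fA ^ 4 * fB ^ 4 * fC\<^sup>2 * fD\<^sup>2 * fE ^ 4 - fE ^ 4 = - 4 * fls_X * fA * fB"
  "fC\<^sup>2 * fD\<^sup>2 - fls_X * fA\<^sup>2 * fB\<^sup>2 = fE ^ 4 * fA * fB"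
  using level_10_theta_relations[THEN arg_cong[where f = fps_to_fls]]
  by (simp_all add: f_defs fls_times_fps_to_fls fps_to_fls_power)

lemma sub5_X: "sub5 fls_X = fls_X ^ 5"
  by (simp add: fls_X_power_conv_shift_1)

lemma fls_relations_5:
  defines "a \<equiv> sub5 fA" and "b \<equiv> sub5 fB" and "c \<equiv> sub5 fC" and "d \<equiv> sub5 fD" and "e \<equiv> sub5 fE"
  shows "e\<^sup>2 * b * c\<^sup>2 = a * d * (b * d + fls_X ^ 5 * a * c)"
        "a * d\<^sup>2 * e\<^sup>2 = b * c * (b * d - fls_X ^ 5 * a * c)"
        "a ^ 4 * b ^ 4 * c\<^sup>2 * d\<^sup>2 * e ^ 4 - e ^ 4 = - 4 * fls_X ^ 5 * a * b"
        "c\<^sup>2 * d\<^sup>2 - fls_X ^ 5 * a\<^sup>2 * b\<^sup>2 = e ^ 4 * a * b"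
  using fls_relations[THEN arg_cong[where f = sub5]]
  by (simp_all add: a_def b_def c_def d_def e_def sub5_X del: fls_compose_power_X)

lemma fls_dissection:
  defines "a \<equiv> sub5 fA" and "b \<equiv> sub5 fB" and "c \<equiv> sub5 fC" and "d \<equiv> sub5 fD" and "e \<equiv> sub5 fE" and "h \<equiv> sub5 fH"
  shows "fA * fB * fC * fD * fE\<^sup>2 * fH\<^sup>2 = (b * c * e * h)\<^sup>2 - fls_X * (a * b * c * d * e\<^sup>2 * h\<^sup>2) - fls_X\<^sup>2 * (a * d * e * h)\<^sup>2"
    and "fC * fD * fH\<^sup>2 = (d * h)\<^sup>2 - fls_X\<^sup>2 * (c * d * h\<^sup>2) - fls_X ^ 4 * (c * h)\<^sup>2"
    and "fE * fH = a * b * c * d * e * h" and "fH = c * d * h"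
  unfolding a_def b_def c_def d_def e_def h_def sub5_f
  using dissection_relation[THEN arg_cong[where f = fps_to_fls]] compose_values(1,2)[THEN arg_cong[where f = fps_to_fls]]
  by (simp_all add: f_defs fls_times_fps_to_fls fps_to_fls_power)

text \<open>The products over the residues 1, 4 and 2, 3 modulo 5 are taken at q^5, so only the
  factor q in front is not a series in q^5.\<close>

definition rr :: "complex fls" where
  "rr = fls_X * (sub5 fA * sub5 fD) / (sub5 fB * sub5 fC)"

definition rho :: "complex fls" where
  "rho = rr / (1 - rr - rr\<^sup>2)"

abbreviation tt :: "complex fls" where "tt \<equiv> sub5 qy"

lemma rho_relations:
  shows "1 - rr - rr\<^sup>2 \<noteq> 0" "rr \<noteq> 0"
    and "(1 + 5 * tt) * rho ^ 5 = tt * (1 + 4 * tt)\<^sup>2 * (1 + 5 * rho + 15 * rho\<^sup>2 + 25 * rho ^ 3 + 25 * rho ^ 4)"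
    and "(1 + 12 * tt + 40 * tt\<^sup>2) * (1 + 4 * tt) * qy =
           (1 + 5 * tt) * ((1 + 4 * tt) * (- 2 * tt + rho + 2 * rho\<^sup>2) + 2 * (1 + 5 * tt) * rho ^ 3)"
    and "(1 + 4 * tt) * qZ * qy = (1 + 5 * tt) * rho ^ 3"
proof -
  define a b c d e h where "a = sub5 fA" and "b = sub5 fB" and "c = sub5 fC" and "d = sub5 fD"
    and "e = sub5 fE" and "h = sub5 fH"
  have nz: "a \<noteq> 0" "b \<noteq> 0" "c \<noteq> 0" "d \<noteq> 0" "e \<noteq> 0" "h \<noteq> 0" "fls_X \<noteq> (0 :: complex fls)"
    by (simp_all add: a_def b_def c_def d_def e_def h_def)
  define k where "k = fls_X ^ 5 * a * c / (b * d)"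
  define t where "t = fls_X ^ 5 / (a ^ 3 * b ^ 3 * c\<^sup>2 * d\<^sup>2 * e ^ 4)"
  note dis = fls_dissection[folded a_def b_def c_def d_def e_def h_def]
  have r: "rr = fls_X * a * d / (b * c)" by (simp add: rr_def a_def b_def c_def d_def)
  show r0: "rr \<noteq> 0" using nz by (simp add: r)
  have rbc: "rr * (b * c) = fls_X * a * d" using nz by (simp add: r)
  have y: "qy * (fA ^ 3 * fB ^ 3 * fC\<^sup>2 * fD\<^sup>2 * fE ^ 4) = fls_X"
    using qy_product by (simp add: f_defs fls_times_fps_to_fls fps_to_fls_power)
  have "sub5 (qy * (fA ^ 3 * fB ^ 3 * fC\<^sup>2 * fD\<^sup>2 * fE ^ 4)) = fls_X ^ 5" unfolding y by (rule sub5_X)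
  hence "tt * (a ^ 3 * b ^ 3 * c\<^sup>2 * d\<^sup>2 * e ^ 4) = fls_X ^ 5"
    by (simp add: a_def b_def c_def d_def e_def)
  hence t: "tt = t" using nz by (simp add: t_def field_simps)
  note level10 = level_10_relations[of "fls_X ^ 5" a b c d e, folded k_def t_def]
  have rels: "k \<noteq> 0" "1 + k \<noteq> 0" "1 - k \<noteq> 0" "t * (1 - 4 * k - k\<^sup>2) = k"
        "(1 + k) / (1 - k) = b\<^sup>2 * c ^ 3 / (a\<^sup>2 * d ^ 3)"
        "c\<^sup>2 * d\<^sup>2 / (a * b * e ^ 4) = (1 + k - k\<^sup>2) / (1 - k\<^sup>2)"
    using level10 fls_relations_5[folded a_def b_def c_def d_def e_def] nz by auto
  \<comment> \<open>\<open>u\<close> is q^(-1) times the product of (1 - q^n)/(1 - q^(25n)); the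
    first dissection identifies it with 1/r - 1 - r, the inverse of \<rho>.\<close>
  define u where "u = fA * fB * fC * fD * fE * fH / (fls_X * e * h)"
  have u: "u * rr = 1 - rr - rr\<^sup>2"
  proof -
    have "u * (fls_X * e * h) = fA * fB * fC * fD * fE * fH" using nz by (simp add: u_def)
    hence "u * (fls_X * e * h) * (fE * fH) = fA * fB * fC * fD * fE\<^sup>2 * fH\<^sup>2"
      by (simp add: power2_eq_square mult_ac)
    hence "u * (fls_X * e * h) * (a * b * c * d * e * h) =
        (b * c * e * h)\<^sup>2 - fls_X * (a * b * c * d * e\<^sup>2 * h\<^sup>2) - fls_X\<^sup>2 * (a * d * e * h)\<^sup>2"
      unfolding dis(1,3) .
    hence "(e\<^sup>2 * h\<^sup>2 * b\<^sup>2 * c\<^sup>2) * (u * rr) = (e\<^sup>2 * h\<^sup>2 * b\<^sup>2 * c\<^sup>2) * (1 - rr - rr\<^sup>2)"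
      using rbc by algebra
    thus ?thesis using nz by (subst (asm) mult_left_cancel) auto
  qed
  have u0: "u \<noteq> 0" using nz by (simp add: u_def)
  show S0: "1 - rr - rr\<^sup>2 \<noteq> 0" using u u0 r0 by (metis mult_eq_0_iff)
  have rho: "rho * u = 1" using u u0 r0 S0 by (simp add: rho_def field_simps)
  define s where "s = rr\<^sup>2 * (1 + k) / (1 - k)"
  have s: "s = fls_X\<^sup>2 * c / d"
  proof -
    have "s = rr\<^sup>2 * ((1 + k) / (1 - k))" by (simp add: s_def)
    also have "\<dots> = fls_X\<^sup>2 * c / d"
      unfolding rels(5) r using nz by (simp add: field_simps power2_eq_square power3_eq_cube)
    finally show ?thesis .
  qed
  \<comment> \<open>The same at doubled argument, where the continued fraction is s: v is q^(-2)
    times the product of (1 - q^(2n))/(1 - q^(50n)), hence 1/Z.\<close>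
  define v where "v = 1 / s - 1 - s"
  have v: "fC * fD * fH = fls_X\<^sup>2 * v * h"
  proof -
    have "(fC * fD * fH) * (c * d * h) = fC * fD * fH\<^sup>2" using dis(4) by (simp add: power2_eq_square)
    also have "\<dots> = (d * h)\<^sup>2 - fls_X\<^sup>2 * (c * d * h\<^sup>2) - fls_X ^ 4 * (c * h)\<^sup>2" by (rule dis(2))
    also have "\<dots> = (fls_X\<^sup>2 * v * h) * (c * d * h)"
      unfolding v_def s using nz by (simp add: field_simps power2_eq_square power4_eq_xxxx)
    finally show ?thesis using nz by simp
  qed
  have v0: "v \<noteq> 0" using v by auto
  have Z: "qZ * v = 1"
  proof -
    have "qZ * (fC * fD * fH) = fls_X\<^sup>2 * h"
      unfolding h_def sub5_f using qZ_product by (simp add: f_defs fls_times_fps_to_fls)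
    hence "(fls_X\<^sup>2 * h) * (qZ * v) = (fls_X\<^sup>2 * h) * 1" unfolding v by (simp add: mult_ac)
    thus ?thesis using nz by (subst (asm) mult_left_cancel) auto
  qed
  define g where "g = c\<^sup>2 * d\<^sup>2 / (a * b * e ^ 4)"
  \<comment> \<open>y, v, g and \<rho> = 1/u are all infinite products, so this is a comparison of
    factors.\<close>
  have y': "qy = g * v * rho ^ 3"
  proof -
    have E1: "fA * fB * fC * fD * fE * fH = u * (fls_X * e * h)" using nz by (simp add: u_def)
    have "qy * (fA * fB * fC * fD * fE * fH) ^ 3 * (fE * fH) = qy * (fA ^ 3 * fB ^ 3 * fC\<^sup>2 * fD\<^sup>2 * fE ^ 4) * (fC * fD * fH) * fH ^ 3"
      by algebra
    also have "\<dots> = fls_X * (fls_X\<^sup>2 * v * h) * (c * d * h) ^ 3"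
      unfolding y v using dis(4) by simp
    also have "qy * (fA * fB * fC * fD * fE * fH) ^ 3 * (fE * fH) = qy * (u * (fls_X * e * h)) ^ 3 * (a * b * c * d * e * h)"
      unfolding E1 dis(3) ..
    also have "qy * (u * (fls_X * e * h)) ^ 3 * (a * b * c * d * e * h) = (fls_X ^ 3 * h ^ 4 * c * d) * (qy * u ^ 3 * (a * b * e ^ 4))"
      by algebra
    also have "fls_X * (fls_X\<^sup>2 * v * h) * (c * d * h) ^ 3 = (fls_X ^ 3 * h ^ 4 * c * d) * (v * (c\<^sup>2 * d\<^sup>2))"
      by algebra
    finally have "qy * u ^ 3 * (a * b * e ^ 4) = v * (c\<^sup>2 * d\<^sup>2)"
      using nz by (subst (asm) mult_left_cancel) auto
    hence "qy * u ^ 3 = g * v" using nz by (simp add: g_def field_simps)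
    hence "qy * (rho * u) ^ 3 = g * v * rho ^ 3" by algebra
    thus ?thesis using rho by simp
  qed
  have r5: "rr ^ 5 * (1 + k)\<^sup>2 = k * (1 - k)\<^sup>2"
  proof -
    have 1: "rr ^ 5 * (b ^ 5 * c ^ 5) = fls_X ^ 5 * a ^ 5 * d ^ 5"
      using arg_cong[OF rbc, of "\<lambda>x. x ^ 5"] by (simp only: power_mult_distrib)
    have "(1 + k) * (a\<^sup>2 * d ^ 3) = (1 - k) * (b\<^sup>2 * c ^ 3)"
      using rels(3,5) nz by (simp add: frac_eq_eq)
    hence 2: "(1 + k)\<^sup>2 * (a\<^sup>2 * d ^ 3)\<^sup>2 = (1 - k)\<^sup>2 * (b\<^sup>2 * c ^ 3)\<^sup>2"
      by (simp only: power_mult_distrib [symmetric])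
    have 3: "k * (b * d) = fls_X ^ 5 * a * c" using nz by (simp add: k_def)
    have "(rr ^ 5 * (1 + k)\<^sup>2) * (b ^ 5 * c ^ 5 * (a\<^sup>2 * d ^ 3)\<^sup>2) =
        (rr ^ 5 * (b ^ 5 * c ^ 5)) * ((1 + k)\<^sup>2 * (a\<^sup>2 * d ^ 3)\<^sup>2)" by (simp only: mult_ac)
    also have "\<dots> = (fls_X ^ 5 * a * c) * ((1 - k)\<^sup>2 * (b ^ 4 * c ^ 5 * a ^ 4 * d ^ 5))"
      unfolding 1 2 by algebra
    also have "\<dots> = (k * (1 - k)\<^sup>2) * (b ^ 5 * c ^ 5 * (a\<^sup>2 * d ^ 3)\<^sup>2)"
      unfolding 3 [symmetric] by algebra
    finally show ?thesis using nz by simp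
  qed
  note eqs = rho_equations[OF rels(1-3) r0 S0 rels(4) r5, folded rho_def s_def, folded v_def rels(6), folded g_def, folded y']
  show "(1 + 5 * tt) * rho ^ 5 = tt * (1 + 4 * tt)\<^sup>2 * (1 + 5 * rho + 15 * rho\<^sup>2 + 25 * rho ^ 3 + 25 * rho ^ 4)"
    unfolding t by (rule eqs(1))
  show "(1 + 12 * tt + 40 * tt\<^sup>2) * (1 + 4 * tt) * qy =
           (1 + 5 * tt) * ((1 + 4 * tt) * (- 2 * tt + rho + 2 * rho\<^sup>2) + 2 * (1 + 5 * tt) * rho ^ 3)"
    unfolding t by (rule eqs(2))
  have "(1 + 4 * t) * qZ * qy = ((1 + 4 * t) * g) * (qZ * v) * rho ^ 3"
    unfolding y' by (simp add: mult_ac)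
  thus "(1 + 4 * tt) * qZ * qy = (1 + 5 * tt) * rho ^ 3"
    unfolding t eqs(3) Z by simp
qed

section \<open>The modular equation\<close>

definition peval :: "'a :: comm_ring_1 \<Rightarrow> int poly \<Rightarrow> 'a" where
  "peval x p = poly (map_poly of_int p) x"

lemma peval_0: "peval x 0 = 0"
  by (simp add: peval_def)

lemma peval_pCons: "peval x (pCons c p) = of_int c + x * peval x p"
  by (simp add: peval_def map_poly_pCons)

lemmas peval_simps = peval_pCons peval_0 of_int_numeral of_int_1 of_int_0 of_int_minus
  of_int_neg_numeral mult_zero_right add_0_right add_0_left

context
  fixes t \<rho> y :: "'a :: field"
  assumes rho: "(1 + 5 * t) * \<rho> ^ 5 = t * (1 + 4 * t)\<^sup>2 * (1 + 5 * \<rho> + 15 * \<rho>\<^sup>2 + 25 * \<rho> ^ 3 + 25 * \<rho> ^ 4)"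
  assumes y: "(1 + 12 * t + 40 * t\<^sup>2) * (1 + 4 * t) * y =
           (1 + 5 * t) * ((1 + 4 * t) * (- 2 * t + \<rho> + 2 * \<rho>\<^sup>2) + 2 * (1 + 5 * t) * \<rho> ^ 3)"
  assumes nz: "(1 + 12 * t + 40 * t\<^sup>2) * (1 + 4 * t) \<noteq> 0"
begin

private abbreviation "\<Delta> \<equiv> (1 + 12 * t + 40 * t\<^sup>2) * (1 + 4 * t)"
private abbreviation "E \<equiv> peval t"
private abbreviation "\<Phi> \<equiv> (1 + 5 * t) * \<rho> ^ 5 - t * (1 + 4 * t)\<^sup>2 * (1 + 5 * \<rho> + 15 * \<rho>\<^sup>2 + 25 * \<rho> ^ 3 + 25 * \<rho> ^ 4)"

lemma rho_relation_0: "\<Phi> = 0"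
  using rho by simp

lemma y_power_1: "\<Delta> * y =
    E [:0, -2, -18, -40:] +
    E [:1, 9, 20:] * \<rho> +
    E [:2, 18, 40:] * \<rho> ^ 2 +
    E [:2, 20, 50:] * \<rho> ^ 3"
  unfolding y peval_simps by algebra

text \<open>Multiplication by \<Delta> y followed by division by \<Phi> as a polynomial in \<rho>,
  the second bracket being the quotient. The remainder is divisible by \<Delta>, so that one factor
  \<Delta> suffices as denominator; the higher powers arise in the same way.\<close>

lemma y_power_2: "\<Delta> * y ^ 2 =
    E [:0, 8, 152, 1080, 3400, 4000:] +
    E [:0, 40, 760, 5400, 17000, 20000:] * \<rho> +
    E [:1, 134, 2345, 16300, 51000, 60000:] * \<rho> ^ 2 +
    E [:4, 260, 4100, 27500, 85000, 100000:] * \<rho> ^ 3 +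
    E [:8, 320, 4400, 28000, 85000, 100000:] * \<rho> ^ 4"
  (is "_ = ?r")
proof -
  have "\<Delta> * (\<Delta> * y ^ 2) = (\<Delta> * y) * (\<Delta> * y)" by algebra
  also have "\<dots> = \<Delta> * ?r + (
    E [:8, 212, 2320, 12900, 36000, 40000:] +
    E [:4, 60, 300, 500:] * \<rho>) * \<Phi>"
    unfolding y_power_1 peval_simps by algebra
  finally show ?thesis unfolding rho_relation_0 using nz by simp
qed

lemma y_power_3: "\<Delta> * y ^ 3 =
    E [:0, 18, 2022, 67950, 1141650, 11326200, 70928000, 284960000, 715200000, 1024000000, 640000000:] +
    E [:0, 122, 11678, 369510, 6004250, 58331000, 360340000, 1435200000, 3584000000, 5120000000, 3200000000:] * \<rho> +
    E [:0, 460, 38940, 1175900, 18644500, 178493000, 1092520000, 4326400000, 10768000000, 15360000000, 9600000000:] * \<rho> ^ 2 +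
    E [:1, 1105, 78145, 2185275, 33181250, 309155000, 1859200000, 7280000000, 18000000000, 25600000000,
        16000000000:] * \<rho> ^ 3 +
    E [:6, 1840, 102500, 2565000, 36543750, 327155000, 1917200000, 7384000000, 18080000000, 25600000000,
        16000000000:] * \<rho> ^ 4"
  (is "_ = ?r")
proof -
  have "\<Delta> * (\<Delta> * y ^ 3) = (\<Delta> * y) * (\<Delta> * y ^ 2)" by algebra
  also have "\<dots> = \<Delta> * ?r + (
    E [:18, 2182, 84590, 1703250, 20948600, 168756000, 914160000, 3315200000, 7744000000, 10560000000, 6400000000:] +
    E [:24, 1664, 41360, 541600, 4255000, 20900000, 63200000, 108000000, 80000000:] * \<rho> +
    E [:16, 720, 12000, 100000, 450000, 1050000, 1000000:] * \<rho> ^ 2) * \<Phi>"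
    unfolding y_power_1 y_power_2 peval_simps by algebra
  finally show ?thesis unfolding rho_relation_0 using nz by simp
qed

lemma y_power_4: "\<Delta> * y ^ 4 =
    E [:0, 8, 5552, 560560, 24414720, 608848200, 9859850000, 110828120000, 897094400000, 5326336000000,
        23298112000000, 74394880000000, 168985600000000, 259072000000000, 240640000000000, 102400000000000:] +
    E [:0, 72, 35728, 3286960, 136244800, 3291381000, 52130070000, 576513080000, 4610201600000, 27123200000000,
        117834560000000, 374406400000000, 847552000000000, 1296640000000000, 1203200000000000,
        512000000000000:] * \<rho> +
    E [:0, 360, 131840, 11151600, 443292000, 10441393000, 162611020000, 1777157200000, 14089924000000,
        82374400000000, 356219680000000, 1128099200000000, 2547904000000000, 3892480000000000, 3609600000000000,
        1536000000000000:] * \<rho> ^ 2 +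
    E [:0, 1208, 308960, 23045200, 855916000, 19307155000, 291818800000, 3120837200000, 24347894000000,
        140640200000000, 602752800000000, 1896432000000000, 4264000000000000, 6496000000000000, 6016000000000000,
        2560000000000000:] * \<rho> ^ 3 +
    E [:1, 2980, 507950, 31788500, 1067746625, 22565630000, 325979175000, 3374022500000, 25694950000000,
        145773800000000, 616472800000000, 1920912000000000, 4290240000000000, 6508800000000000, 6016000000000000,
        2560000000000000:] * \<rho> ^ 4"
  (is "_ = ?r")
proof -
  have "\<Delta> * (\<Delta> * y ^ 4) = (\<Delta> * y) * (\<Delta> * y ^ 3)" by algebra
  also have "\<dots> = \<Delta> * ?r + (
    E [:8, 5652, 609120, 29083160, 810877400, 14933176500, 194022660000, 1846614400000, 13142416000000,
        70537456000000, 284887360000000, 854105600000000, 1846272000000000, 2723840000000000, 2457600000000000,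
        1024000000000000:] +
    E [:14, 6248, 481460, 16967800, 352544750, 4831970000, 46288840000, 319214600000, 1601836000000, 5818400000000,
        14944000000000, 25792000000000, 26880000000000, 12800000000000:] * \<rho> +
    E [:12, 3740, 223400, 6155000, 98737500, 1019747500, 7105950000, 33940000000, 110000000000, 232000000000,
        288000000000, 160000000000:] * \<rho> ^ 2) * \<Phi>"
    unfolding y_power_1 y_power_3 peval_simps by algebra
  finally show ?thesis unfolding rho_relation_0 using nz by simp
qed

text \<open>In the coordinates 1, \<rho>, ..., \<rho>^4 expressing y^5 through 1, y, ..., y^4 is a
  linear system over the rational functions of t. Its solution consists of integer polynomials; the
  constant term is t (1 + 5 t)^4.\<close>

lemma modular_equation: "y ^ 5 =
    E [:0, 1, 20, 150, 500, 625:] +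
    E [:0, 15, 305, 2325, 7875, 10000:] * y +
    E [:0, 85, 1750, 13525, 46500, 60000:] * y ^ 2 +
    E [:0, 215, 4475, 35000, 122000, 160000:] * y ^ 3 +
    E [:0, 205, 4300, 34000, 120000, 160000:] * y ^ 4"
  (is "_ = ?a0 + ?a1 * y + ?a2 * y ^ 2 + ?a3 * y ^ 3 + ?a4 * y ^ 4")
proof -
  have "\<Delta> * (\<Delta> * y ^ 5) = (\<Delta> * y) * (\<Delta> * y ^ 4)" by algebra
  also have "\<dots> = \<Delta> * (
    E [:0, 1, 6196, 1714438, 163808180, 8232212625, 259723836000, 5652189910000, 89762930600000, 1078144601600000,
        10022018520000000, 73133383360000000, 422083635200000000, 1929633024000000000, 6957402880000000000,
        19564037120000000000, 42045644800000000000, 66748416000000000000, 73809920000000000000,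
        50790400000000000000, 16384000000000000000:] +
    E [:0, 15, 44830, 10830530, 968243800, 46678750375, 1430571007250, 30468241130000, 475882425600000,
        5641168832000000, 51888463800000000, 375436868800000000, 2151957404800000000, 9783797056000000000,
        35121171200000000000, 98421785600000000000, 210975744000000000000, 334315520000000000000,
        369254400000000000000, 253952000000000000000, 81920000000000000000:] * \<rho> +
    E [:0, 115, 186720, 39463890, 3315822900, 154113361875, 4609897262500, 96502052900000, 1488064662000000,
        17467558016000000, 159445478400000000, 1146719301600000000, 6541457072000000000, 29627864640000000000,
        106039212800000000000, 296474956800000000000, 634424832000000000000, 1004093440000000000000,
        1108172800000000000000, 761856000000000000000, 245760000000000000000:] * \<rho> ^ 2 +
    E [:0, 585, 519700, 91181350, 6965488500, 305113285625, 8761096420000, 177986119100000, 2682543144500000,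
        30931118250000000, 278360198000000000, 1979270684000000000, 11187782032000000000, 50301423040000000000,
        178984384000000000000, 498156928000000000000, 1062366720000000000000, 1677312000000000000000,
        1848320000000000000000, 1269760000000000000000, 409600000000000000000:] * \<rho> ^ 3 +
    E [:0, 2175, 1078850, 148501450, 9892342000, 396485984375, 10696710193750, 207544685625000, 3020325417500000,
        33887570770000000, 298447782000000000, 2085830332000000000, 11628521600000000000, 51710120000000000000,
        182399936000000000000, 504236928000000000000, 1069867520000000000000, 1683046400000000000000,
        1850368000000000000000, 1269760000000000000000, 409600000000000000000:] * \<rho> ^ 4) + (
    E [:1, 6220, 1775134, 178705380, 9606101825, 328100151000, 7811572025000, 137052129600000, 1836081316800000,
        19225569312000000, 159720972000000000, 1062062859200000000, 5672802464000000000, 24307342720000000000,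
        83011893760000000000, 223065241600000000000, 461597696000000000000, 710225920000000000000,
        765542400000000000000, 516096000000000000000, 163840000000000000000:] +
    E [:2, 8434, 1819140, 143410900, 6127074250, 167355794250, 3190003490000, 44695148850000, 475431539000000,
        3917006380000000, 25276931600000000, 128283118400000000, 510693856000000000, 1579026560000000000,
        3719360000000000000, 6455040000000000000, 7787520000000000000, 5836800000000000000,
        2048000000000000000:] * \<rho> +
    E [:2, 5970, 1045700, 68656500, 2453378250, 55808726250, 877614650000, 10007836750000, 85130125000000,
        548497100000000, 2690683600000000, 10006552000000000, 27789600000000000, 55920000000000000,
        77120000000000000, 65280000000000000, 25600000000000000:] * \<rho> ^ 2) * \<Phi>"
    (is "_ = \<Delta> * ?b + _")
    unfolding y_power_1 y_power_4 peval_simps by algebra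
  finally have "\<Delta> * y ^ 5 = ?b"
    unfolding rho_relation_0 using nz by simp
  also have "\<dots> = ?a0 * \<Delta> + ?a1 * (\<Delta> * y) + ?a2 * (\<Delta> * y ^ 2) + ?a3 * (\<Delta> * y ^ 3) + ?a4 * (\<Delta> * y ^ 4)"
    unfolding y_power_1 y_power_2 y_power_3 y_power_4 peval_simps by algebra
  also have "\<dots> = \<Delta> * (?a0 + ?a1 * y + ?a2 * y ^ 2 + ?a3 * y ^ 3 + ?a4 * y ^ 4)"
    by algebra
  finally show ?thesis using nz by simp
qed

end

section \<open>The operator of index 5\<close>

lemma U5_nth: "fls_nth (U5 f) n = fls_nth f (5 * n)"
  by (simp add: U5.rep_eq)

lemma U5_add: "U5 (f + g) = U5 f + U5 g"
  and U5_diff: "U5 (f - g) = U5 f - U5 g"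
  and U5_0 [simp]: "U5 0 = 0"
  by (simp_all add: fls_eq_iff U5_nth)

lemma U5_sub5: "U5 (sub5 f) = f"
  by (simp add: fls_eq_iff U5_nth fls_nth_compose_power)

text \<open>\<open>fls_shift\<close> moves the exponents congruent to i modulo 5 to the multiples of
  5, where \<open>U5\<close> extracts them.\<close>

lemma fls_dissection_5: "f = (\<Sum>i<5. fls_X_intpow (int i) * sub5 (U5 (fls_shift (int i) f)))" for f :: "complex fls"
proof (rule fls_eqI)
  fix n
  have "fls_nth (\<Sum>i<5. fls_X_intpow (int i) * sub5 (U5 (fls_shift (int i) f))) n =
        (\<Sum>i<5. if 5 dvd n - int i then fls_nth f n else 0)"
    by (simp add: fls_nth_sum fls_X_intpow_times_conv_shift fls_nth_compose_power U5_nth cong: if_cong sum.cong)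
  also have "\<dots> = (\<Sum>i\<in>{nat (n mod 5)}. fls_nth f n)"
  proof (rule sum.mono_neutral_cong_right)
    show "\<forall>i\<in>{..<5} - {nat (n mod 5)}. (if 5 dvd n - int i then fls_nth f n else 0) = 0"
    proof (rule ballI)
      fix i assume "i \<in> {..<5} - {nat (n mod 5)}"
      hence i: "i < 5" and ne: "i \<noteq> nat (n mod 5)" by auto
      have "\<not> 5 dvd n - int i"
      proof
        assume "5 dvd n - int i"
        hence "n mod 5 = int i mod 5" by (simp add: mod_eq_dvd_iff)
        thus False using i ne by simp
      qed
      thus "(if 5 dvd n - int i then fls_nth f n else 0) = 0" by simp
    qed
  qed (auto simp: nat_less_iff)
  finally show "fls_nth f n = fls_nth (\<Sum>i<5. fls_X_intpow (int i) * sub5 (U5 (fls_shift (int i) f))) n" by simp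
qed

lemma U5_X_intpow_sub5: "U5 (fls_X_intpow m * sub5 f) = 0" if "\<not> 5 dvd m"
proof (rule fls_eqI)
  fix n :: int
  have "\<not> 5 dvd 5 * n - m" using that by presburger
  thus "fls_nth (U5 (fls_X_intpow m * sub5 f)) n = fls_nth 0 n"
    by (simp add: U5_nth fls_X_intpow_times_conv_shift fls_nth_compose_power)
qed

lemma U5_sum: "U5 (\<Sum>i\<in>A. f i) = (\<Sum>i\<in>A. U5 (f i))"
  by (induction A rule: infinite_finite_induct) (simp_all add: U5_add)

text \<open>Series in q^5 do not mix the residue classes of exponents, so \<open>U5\<close> is
  linear over them; this turns relations with coefficients in t into relations with coefficients in
  y.\<close>

lemma U5_sub5_mult: "U5 (sub5 f * g) = f * U5 g"
proof -
  define h where "h = (\<lambda>i. U5 (fls_shift (int i) g))"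
  have g: "g = (\<Sum>i<5. fls_X_intpow (int i) * sub5 (h i))"
    unfolding h_def by (rule fls_dissection_5)
  have "sub5 f * g = (\<Sum>i<5. fls_X_intpow (int i) * sub5 (f * h i))"
    by (subst g) (simp add: sum_distrib_left mult_ac)
  hence "U5 (sub5 f * g) = (\<Sum>i<5. U5 (fls_X_intpow (int i) * sub5 (f * h i)))"
    by (simp add: U5_sum)
  also have "\<dots> = (\<Sum>i\<in>{0}. U5 (fls_X_intpow (int i) * sub5 (f * h i)))"
  proof (rule sum.mono_neutral_right)
    show "\<forall>i\<in>{..<5} - {0::nat}. U5 (fls_X_intpow (int i) * sub5 (f * h i)) = 0"
    proof (intro ballI U5_X_intpow_sub5)
      fix i :: nat assume "i \<in> {..<5} - {0}"
      thus "\<not> 5 dvd int i" by (auto dest: zdvd_imp_le)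
    qed
  qed auto
  also have "\<dots> = f * h 0" by (simp del: fls_compose_power_mult add: U5_sub5)
  finally show ?thesis by (simp add: h_def)
qed

section \<open>The derivation q d/dq\<close>

definition theta_D :: "complex fls \<Rightarrow> complex fls" where "theta_D f = fls_X * fls_deriv f"

lemma theta_D_nth: "fls_nth (theta_D f) n = of_int n * fls_nth f n"
  by (simp add: theta_D_def fls_X_times_conv_shift)

lemma theta_D_mult: "theta_D (f * g) = theta_D f * g + f * theta_D g"
  by (simp add: theta_D_def algebra_simps)

lemma theta_D_add: "theta_D (f + g) = theta_D f + theta_D g"
  by (simp add: theta_D_def algebra_simps)

lemma theta_D_numeral [simp]: "theta_D (numeral n) = 0" "theta_D (of_int i) = 0" "theta_D 0 = 0" "theta_D 1 = 0"
  by (simp_all add: theta_D_def)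

lemma theta_D_X [simp]: "theta_D fls_X = fls_X"
  by (simp add: theta_D_def)

lemma theta_D_power: "theta_D (f ^ n) * f = of_nat n * f ^ n * theta_D f"
  by (induction n) (simp_all add: theta_D_mult algebra_simps)

lemma U5_theta_D: "U5 (theta_D f) = 5 * theta_D (U5 f)"
proof (rule fls_eqI)
  fix n
  show "fls_nth (U5 (theta_D f)) n = fls_nth (5 * theta_D (U5 f)) n"
    by (simp add: U5_nth theta_D_nth)
qed

lemma theta_D_compose_power:
  assumes "k > 0"
  shows   "theta_D (fls_compose_power f k) = of_nat k * fls_compose_power (theta_D f) k"
proof (rule fls_eqI)
  fix n
  show "fls_nth (theta_D (fls_compose_power f k)) n = fls_nth (of_nat k * fls_compose_power (theta_D f) k) n"
    using assms by (auto simp: theta_D_nth fls_nth_compose_power)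
qed

lemma sub5_divide: "sub5 (f / g) = sub5 f / sub5 g"
proof (cases "g = 0")
  case False
  hence "sub5 (f / g) * sub5 g = sub5 f" by (simp flip: fls_compose_power_mult)
  thus ?thesis using False by (simp add: field_simps)
qed simp

lemma U5_numeral_mult: "U5 (numeral k * f) = numeral k * U5 f"
  using U5_sub5_mult[of "numeral k" f] by simp

lemma U5_numeral [simp]: "U5 (numeral k) = numeral k" "U5 1 = 1"
  using U5_sub5[of "numeral k"] U5_sub5[of 1] by simp_all

text \<open>The jth powers of \<open>rr\<close> and of its inverse are q^j and q^(-j) times series
  in q^5.\<close>

lemma U5_rr_power: "j \<in> {1..4} \<Longrightarrow> U5 (rr ^ j) = 0" "j \<in> {1..4} \<Longrightarrow> U5 (inverse rr ^ j) = 0"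
proof -
  define g where "g = fA * fD / (fB * fC)"
  have r: "rr = fls_X_intpow 1 * sub5 g"
    by (simp add: rr_def g_def sub5_divide fls_X_conv_shift_1)
  have X: "inverse (fls_X_intpow 1 :: complex fls) = fls_X_intpow (-1)"
  proof (rule inverse_unique)
    have "(fls_X_intpow 1 :: complex fls) * fls_X_intpow (-1) = fls_X_intpow (1 + -1)"
      by (rule fls_X_intpow_times_fls_X_intpow)
    thus "(fls_X_intpow 1 :: complex fls) * fls_X_intpow (-1) = 1" by simp
  qed
  have ri: "inverse rr = fls_X_intpow (-1) * sub5 (1 / g)"
    unfolding r inverse_mult_distrib X by (simp add: sub5_divide inverse_eq_divide)
  assume j: "j \<in> {1..4}"
  hence nd: "\<not> 5 dvd int j * 1" "\<not> 5 dvd int j * (-1)" by (auto dest: zdvd_imp_le)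
  have "rr ^ j = fls_X_intpow (int j * 1) * sub5 (g ^ j)"
    unfolding r power_mult_distrib fls_X_intpow_power by simp
  thus "U5 (rr ^ j) = 0" using U5_X_intpow_sub5[OF nd(1), of "g ^ j"] by simp
  have "inverse rr ^ j = fls_X_intpow (int j * (-1)) * sub5 ((1 / g) ^ j)"
    unfolding ri power_mult_distrib fls_X_intpow_power by simp
  thus "U5 (inverse rr ^ j) = 0" using U5_X_intpow_sub5[OF nd(2), of "(1 / g) ^ j"] by simp
qed

definition uu :: "complex fls" where "uu = inverse rr - 1 - rr"

lemma uu_rho: "uu * rho = 1"
proof -
  have "uu * rr = 1 - rr - rr\<^sup>2"
    using rho_relations(2) by (simp add: uu_def field_simps power2_eq_square)
  thus ?thesis using rho_relations(1,2) by (simp add: rho_def field_simps)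
qed

text \<open>Up to the fourth power of 1/r - 1 - r only the constant term of the expansion in r
  survives.\<close>

lemma U5_uu: "U5 uu = -1" "U5 (uu\<^sup>2) = -1" "U5 (uu ^ 3) = 5" "U5 (uu ^ 4) = -5"
proof -
  define v where "v = inverse rr"
  have v: "v * rr = 1" using rho_relations(2) by (simp add: v_def)
  have u: "uu = v - 1 - rr" by (simp add: uu_def v_def)
  have z: "U5 rr = 0" "U5 (rr\<^sup>2) = 0" "U5 (rr ^ 3) = 0" "U5 (rr ^ 4) = 0"
    "U5 v = 0" "U5 (v\<^sup>2) = 0" "U5 (v ^ 3) = 0" "U5 (v ^ 4) = 0"
    using U5_rr_power[of 1] U5_rr_power[of 2] U5_rr_power[of 3] U5_rr_power[of 4] by (simp_all add: v_def)
  note lin = U5_add U5_diff U5_numeral_mult z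
  show "U5 uu = -1" unfolding u by (simp add: lin)
  have "uu\<^sup>2 = v\<^sup>2 - 2 * v - 1 + 2 * rr + rr\<^sup>2" unfolding u using v by algebra
  thus "U5 (uu\<^sup>2) = -1" by (simp add: lin)
  have "uu ^ 3 = v ^ 3 - 3 * v\<^sup>2 + 5 - 3 * rr\<^sup>2 - rr ^ 3" unfolding u using v by algebra
  thus "U5 (uu ^ 3) = 5" by (simp add: lin)
  have "uu ^ 4 = v ^ 4 - 4 * v ^ 3 + 2 * v\<^sup>2 + 8 * v - 5 - 8 * rr + 2 * rr\<^sup>2 + 4 * rr ^ 3 + rr ^ 4"
    unfolding u using v by algebra
  thus "U5 (uu ^ 4) = -5" by (simp add: lin)
qed

text \<open>The quintic for \<rho>, divided by \<rho>^4, \<rho>^3, \<rho>^2 and \<rho> in turn,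
  contains on the right only powers of 1/\<rho> with known image and lower powers of \<rho>, so the
  system is triangular.\<close>

lemma U5_rho_power:
  defines "c \<equiv> qy * (1 + 4 * qy)\<^sup>2"
  shows "(1 + 5 * qy) * U5 rho = 5 * c"
    and "(1 + 5 * qy) * U5 (rho\<^sup>2) = c * (10 + 25 * U5 rho)"
    and "(1 + 5 * qy) * U5 (rho ^ 3) = c * (9 + 25 * U5 rho + 25 * U5 (rho\<^sup>2))"
    and "(1 + 5 * qy) * U5 (rho ^ 4) = c * (4 + 15 * U5 rho + 25 * U5 (rho\<^sup>2) + 25 * U5 (rho ^ 3))"
proof -
  define s where "s = sub5 c"
  have s: "s = tt * (1 + 4 * tt)\<^sup>2" by (simp add: s_def c_def)
  have q: "1 + 5 * tt = sub5 (1 + 5 * qy)" by simp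
  note rel = rho_relations(3)[folded s]
  note lin = U5_add U5_diff U5_numeral_mult U5_uu U5_sub5_mult
  have "(1 + 5 * tt) * rho = s * (uu ^ 4 + 5 * uu ^ 3 + 15 * uu\<^sup>2 + 25 * uu + 25)"
    using rel uu_rho by algebra
  hence "U5 (sub5 (1 + 5 * qy) * rho) = U5 (s * (uu ^ 4 + 5 * uu ^ 3 + 15 * uu\<^sup>2 + 25 * uu + 25))"
    by (simp only: q)
  thus "(1 + 5 * qy) * U5 rho = 5 * c" unfolding s_def U5_sub5_mult by (simp add: lin)
  have "(1 + 5 * tt) * rho\<^sup>2 = s * (uu ^ 3 + 5 * uu\<^sup>2 + 15 * uu + 25 + 25 * rho)"
    using rel uu_rho by algebra
  hence "U5 (sub5 (1 + 5 * qy) * rho\<^sup>2) = U5 (s * (uu ^ 3 + 5 * uu\<^sup>2 + 15 * uu + 25 + 25 * rho))"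
    by (simp only: q)
  thus "(1 + 5 * qy) * U5 (rho\<^sup>2) = c * (10 + 25 * U5 rho)" unfolding s_def U5_sub5_mult by (simp add: lin)
  have "(1 + 5 * tt) * rho ^ 3 = s * (uu\<^sup>2 + 5 * uu + 15 + 25 * rho + 25 * rho\<^sup>2)"
    using rel uu_rho by algebra
  hence "U5 (sub5 (1 + 5 * qy) * rho ^ 3) = U5 (s * (uu\<^sup>2 + 5 * uu + 15 + 25 * rho + 25 * rho\<^sup>2))"
    by (simp only: q)
  thus "(1 + 5 * qy) * U5 (rho ^ 3) = c * (9 + 25 * U5 rho + 25 * U5 (rho\<^sup>2))" unfolding s_def U5_sub5_mult by (simp add: lin)
  have "(1 + 5 * tt) * rho ^ 4 = s * (uu + 5 + 15 * rho + 25 * rho\<^sup>2 + 25 * rho ^ 3)"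
    using rel uu_rho by algebra
  hence "U5 (sub5 (1 + 5 * qy) * rho ^ 4) = U5 (s * (uu + 5 + 15 * rho + 25 * rho\<^sup>2 + 25 * rho ^ 3))"
    by (simp only: q)
  thus "(1 + 5 * qy) * U5 (rho ^ 4) = c * (4 + 15 * U5 rho + 25 * U5 (rho\<^sup>2) + 25 * U5 (rho ^ 3))"
    unfolding s_def U5_sub5_mult by (simp add: lin)
qed

section \<open>Logarithmic derivatives\<close>

declare One_nat_def [symmetric, simp del] numeral_2_eq_2 [symmetric, simp del] One_nat_def [simp]

definition lambert :: "complex fps" where
  "lambert = (\<Sum>n. of_nat (Suc n) * fps_X ^ Suc n / (1 - fps_X ^ Suc n))"

definition sigma :: "nat \<Rightarrow> nat" where "sigma n = (\<Sum>d | d dvd n. d)"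

lemma geometric_power_nth:
  assumes "k > 0"
  shows   "(fps_X ^ k / (1 - fps_X ^ k) :: complex fps) $ n = (if k dvd n \<and> n > 0 then 1 else 0)"
proof -
  define f :: "complex fps" where "f = Abs_fps (\<lambda>n. if k dvd n \<and> n > 0 then 1 else 0)"
  have "f * (1 - fps_X ^ k) = fps_X ^ k"
  proof (rule fps_ext)
    fix n
    have "(f * (1 - fps_X ^ k)) $ n = f $ n - (if n < k then 0 else f $ (n - k))"
      by (simp add: right_diff_distrib fps_X_power_mult_right_nth)
    also have "\<dots> = (fps_X ^ k :: complex fps) $ n"
      using assms by (auto simp: f_def dvd_diff_nat not_less dest: dvd_imp_le dvd_diffD)
    finally show "(f * (1 - fps_X ^ k)) $ n = (fps_X ^ k :: complex fps) $ n" .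
  qed
  moreover have "(1 - fps_X ^ k :: complex fps) $ 0 \<noteq> 0" using assms by simp
  ultimately have "fps_X ^ k / (1 - fps_X ^ k) = f"
    by (metis fps_divide_mult_cancel fps_zero_nth mult_right_cancel)
  thus ?thesis by (simp add: f_def)
qed

lemma lambert_term_nth:
  "(of_nat (Suc m) * fps_X ^ Suc m / (1 - fps_X ^ Suc m) :: complex fps) $ n =
     (if Suc m dvd n \<and> n > 0 then of_nat (Suc m) else 0)"
proof -
  have "(of_nat (Suc m) * fps_X ^ Suc m / (1 - fps_X ^ Suc m) :: complex fps) =
        fps_const (of_nat (Suc m)) * (fps_X ^ Suc m / (1 - fps_X ^ Suc m))"
    by (simp add: fps_of_nat fps_divide_unit mult.assoc del: of_nat_Suc power_Suc)
  thus ?thesis by (simp only: fps_mult_left_const_nth geometric_power_nth[OF zero_less_Suc]) simp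
qed

lemma LIMSEQ_lambert: "(\<lambda>N. \<Sum>m<N. of_nat (Suc m) * fps_X ^ Suc m / (1 - fps_X ^ Suc m)) \<longlonglongrightarrow> lambert"
  using summable_sums[OF summable_qE2] unfolding sums_def lambert_def .

lemma lambert_nth: "lambert $ n = (if n = 0 then 0 else of_nat (sigma n))"
proof -
  have "eventually (\<lambda>N. (\<Sum>m<N. of_nat (Suc m) * fps_X ^ Suc m / (1 - fps_X ^ Suc m)) $ n = lambert $ n) sequentially"
    using LIMSEQ_lambert unfolding tendsto_fps_iff by blast
  hence "eventually (\<lambda>N. (if n = 0 then 0 else of_nat (sigma n)) = lambert $ n) sequentially"
    using eventually_ge_at_top[of n]
  proof eventually_elim
    case (elim N)
    have "(\<Sum>m<N. of_nat (Suc m) * fps_X ^ Suc m / (1 - fps_X ^ Suc m)) $ n =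
        (\<Sum>m<N. if Suc m dvd n \<and> n > 0 then of_nat (Suc m) else (0 :: complex))"
      by (simp only: fps_sum_nth lambert_term_nth)
    also have "\<dots> = (if n = 0 then 0 else of_nat (sigma n))"
    proof (cases "n = 0")
      case False
      have "(\<Sum>m<N. if Suc m dvd n \<and> n > 0 then of_nat (Suc m) else (0 :: complex)) =
          (\<Sum>m\<in>{m\<in>{..<N}. Suc m dvd n}. of_nat (Suc m))"
        using False by (subst sum.inter_filter) (simp_all del: of_nat_Suc)
      also have "\<dots> = (\<Sum>d | d dvd n. of_nat d)"
        using False elim(2)
        by (intro sum.reindex_bij_witness[of _ "\<lambda>d. d - 1" Suc])
           (auto simp: Suc_le_eq dest: dvd_imp_le intro: Nat.gr0I)
      finally show ?thesis using False by (simp add: sigma_def)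
    qed simp
    finally show ?case using elim(1) by simp
  qed
  thus ?thesis by (auto simp: eventually_sequentially)
qed

text \<open>The Hecke relation at 5. With T the divisors of n prime to 5, the divisors of 5n are T
  and 5 times the divisors of n, those of n are T and, if 5 divides n, 5 times the divisors of n/5;
  the sum over T is eliminated.\<close>

lemma sigma_times_5:
  assumes "n > 0"
  shows   "sigma (5 * n) + (if 5 dvd n then 5 * sigma (n div 5) else 0) = 6 * sigma n"
proof -
  define T where "T = {d. d dvd n \<and> \<not> 5 dvd d}"
  have fin: "finite {d. d dvd m}" if "m > 0" for m :: nat using that by simp
  have T: "finite T" using fin[OF assms] by (rule rev_finite_subset) (auto simp: T_def)
  have "{d. d dvd 5 * n} = (\<lambda>d. 5 * d) ` {d. d dvd n} \<union> T"
  proof (intro equalityI subsetI)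
    fix d assume d: "d \<in> {d. d dvd 5 * n}"
    show "d \<in> (\<lambda>d. 5 * d) ` {d. d dvd n} \<union> T"
    proof (cases "5 dvd d")
      case True
      then obtain e where "d = 5 * e" by (elim dvdE)
      thus ?thesis using d by auto
    next
      case False
      hence "coprime d 5" using prime_imp_coprime[of "5::nat" d] by (simp add: coprime_commute)
      thus ?thesis using d False by (simp add: T_def coprime_dvd_mult_right_iff)
    qed
  qed (auto simp: T_def)
  moreover have "(\<lambda>d. 5 * d) ` {d. d dvd n} \<inter> T = {}" by (auto simp: T_def)
  ultimately have 1: "sigma (5 * n) = 5 * sigma n + \<Sum>T"
    using T fin[OF assms] unfolding sigma_def
    by (simp add: sum.union_disjoint sum.reindex inj_on_def sum_distrib_left)
  have "{d. d dvd n} = T \<union> {d. d dvd n \<and> 5 dvd d}" by (auto simp: T_def)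
  hence 2: "sigma n = \<Sum>T + \<Sum>{d. d dvd n \<and> 5 dvd d}"
  proof -
    have "finite {d. d dvd n \<and> 5 dvd d}" using fin[OF assms] by (rule rev_finite_subset) auto
    moreover have "T \<inter> {d. d dvd n \<and> 5 dvd d} = {}" by (auto simp: T_def)
    ultimately show ?thesis
      unfolding sigma_def \<open>{d. d dvd n} = _\<close> using T by (simp only: sum.union_disjoint)
  qed
  have 3: "\<Sum>{d. d dvd n \<and> 5 dvd d} = (if 5 dvd n then 5 * sigma (n div 5) else 0)"
  proof (cases "5 dvd n")
    case True
    then obtain m where m: "n = 5 * m" by (elim dvdE)
    have "{d. d dvd n \<and> 5 dvd d} = (\<lambda>d. 5 * d) ` {d. d dvd m}" by (auto simp: m elim!: dvdE)
    thus ?thesis using m unfolding sigma_def by (simp add: sum.reindex inj_on_def sum_distrib_left)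
  next
    case False
    hence "{d. d dvd n \<and> 5 dvd d} = {}" using dvd_trans by blast
    thus ?thesis using False by (simp only: sum.empty if_False)
  qed
  show ?thesis using 1 2 3 by simp
qed

definition GG :: "complex fls" where "GG = fps_to_fls lambert"

lemma GG_nth: "fls_nth GG n = (if n \<le> 0 then 0 else of_nat (sigma (nat n)))"
  by (auto simp: GG_def lambert_nth)

lemma U5_GG: "U5 GG = 6 * GG - 5 * sub5 GG"
proof (rule fls_eqI)
  fix n
  show "fls_nth (U5 GG) n = fls_nth (6 * GG - 5 * sub5 GG) n"
  proof (cases "n > 0")
    case False
    have "n div 5 \<le> 0" using False by linarith
    thus ?thesis using False by (simp add: U5_nth GG_nth fls_nth_compose_power)
  next
    case True
    define m where "m = nat n"
    have n: "n = int m" and m: "m > 0" using True by (simp_all add: m_def)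
    have "of_nat (sigma (5 * m) + (if 5 dvd m then 5 * sigma (m div 5) else 0)) = (of_nat (6 * sigma m) :: complex)"
      by (simp only: sigma_times_5[OF m])
    moreover have "nat (5 * int m) = 5 * m" "nat (int m div 5) = m div 5" by simp_all
    moreover have "5 dvd m \<Longrightarrow> m div 5 > 0" using m by (auto elim!: dvdE)
    moreover have "int m div 5 = int (m div 5)" "5 dvd int m \<longleftrightarrow> 5 dvd m" by presburger+
    ultimately show ?thesis using m
      by (cases "5 dvd m") (simp_all add: n U5_nth GG_nth fls_nth_compose_power algebra_simps)
  qed
qed

lemma fps_X_deriv_LIMSEQ:
  assumes "f \<longlonglongrightarrow> (F :: complex fps)"
  shows   "(\<lambda>n. fps_X * fps_deriv (f n)) \<longlonglongrightarrow> fps_X * fps_deriv F"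
proof (rule tendsto_fpsI)
  fix k
  have *: "(fps_X * fps_deriv g) $ k = of_nat k * g $ k" for g :: "complex fps"
    by (cases k) (simp_all add: algebra_simps)
  have "eventually (\<lambda>n. f n $ k = F $ k) sequentially" using assms unfolding tendsto_fps_iff by blast
  thus "eventually (\<lambda>n. (fps_X * fps_deriv (f n)) $ k = (fps_X * fps_deriv F) $ k) sequentially"
    by eventually_elim (simp only: *)
qed

text \<open>The factor 1 - q^m contributes -m q^m / (1 - q^m) to the logarithmic derivative; this
  passes from finite products to the limit coefficientwise.\<close>

lemma euler_product_deriv: "fps_X * fps_deriv (qp 1 1 1) = - qp 1 1 1 * lambert"
proof (rule LIMSEQ_unique)
  let ?P = "\<lambda>n. \<Prod>m<n. 1 - fps_X ^ Suc m :: complex fps"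
  let ?S = "\<lambda>n. \<Sum>m<n. of_nat (Suc m) * fps_X ^ Suc m / (1 - fps_X ^ Suc m) :: complex fps"
  have P: "?P \<longlonglongrightarrow> qp 1 1 1" using LIMSEQ_euler_product[OF zero_less_one] unfolding mult_1_left .
  show "(\<lambda>n. fps_X * fps_deriv (?P n)) \<longlonglongrightarrow> fps_X * fps_deriv (qp 1 1 1)"
    by (rule fps_X_deriv_LIMSEQ[OF P])
  have *: "fps_X * fps_deriv (?P n) = - ?P n * ?S n" for n
  proof (induction n)
    case (Suc n)
    define f :: "complex fps" where "f = 1 - fps_X ^ Suc n"
    define s :: "complex fps" where "s = of_nat (Suc n) * fps_X ^ Suc n / f"
    have "f $ 0 \<noteq> 0" by (simp add: f_def)
    hence s: "s * f = of_nat (Suc n) * fps_X ^ Suc n" unfolding s_def by (rule fps_divide_mult_cancel)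
    have "fps_deriv f = - (of_nat (Suc n) * fps_X ^ n)"
      by (simp add: f_def fps_deriv_power fps_of_nat [symmetric] del: power_Suc of_nat_Suc)
    hence "fps_X * fps_deriv f = - of_nat (Suc n) * fps_X ^ Suc n"
      by (simp only: power_Suc mult_minus_left mult_minus_right mult.left_commute)
    hence f: "fps_X * fps_deriv f = - s * f" using s by (simp only: mult_minus_left)
    have "fps_X * fps_deriv (?P (Suc n)) = (fps_X * fps_deriv (?P n)) * f + ?P n * (fps_X * fps_deriv f)"
      by (simp add: f_def algebra_simps del: power_Suc)
    also have "\<dots> = - (?P n * f) * (?S n + s)" unfolding Suc.IH f by (simp add: algebra_simps)
    finally show ?case by (simp add: f_def s_def)
  qed simp
  show "(\<lambda>n. fps_X * fps_deriv (?P n)) \<longlonglongrightarrow> - qp 1 1 1 * lambert"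
    unfolding * using tendsto_mult_fps[OF tendsto_diff_fps[OF tendsto_const P, of 0] LIMSEQ_lambert] by simp
qed

section \<open>Logarithmic derivatives of the products and of y\<close>

definition EE :: "complex fls" where "EE = fps_to_fls (qp 1 1 1)"

lemma theta_D_EE: "theta_D EE = - EE * GG"
  using euler_product_deriv[THEN arg_cong[where f = fps_to_fls]]
  by (simp add: theta_D_def EE_def GG_def fls_deriv_fps_to_fls fls_times_fps_to_fls)

lemma theta_D_EE_compose:
  assumes "k > 0"
  shows   "theta_D (fls_compose_power EE k) = - of_nat k * fls_compose_power EE k * fls_compose_power GG k"
  using assms by (simp add: theta_D_compose_power theta_D_EE)

lemma qE2_GG: "qE2 = 1 - 24 * GG"
  by (simp add: qE2_def GG_def lambert_def fls_times_fps_to_fls)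

abbreviation cp :: "nat \<Rightarrow> complex fls \<Rightarrow> complex fls" where "cp k f \<equiv> fls_compose_power f k"

lemma qF_GG: "24 * qF = 24 - 24 * (50 * cp 10 GG - 25 * cp 5 GG - 2 * cp 2 GG + GG)"
  by (simp add: qF_def qE2_GG algebra_simps)

lemma EE_values: "EE = fA * fB * fC * fD * fE * fH" "cp 2 EE = fC * fD * fH" "cp 5 EE = fE * fH" "cp 10 EE = fH"
proof -
  have "cp k EE = fps_to_fls (qp 1 k k)" if "k > 0" for k
    using that qp_compose_1[of 1 1 k] by (simp add: EE_def fls_compose_power_fps_to_fls)
  hence *: "cp 2 EE = fps_to_fls (qp 1 2 2)" "cp 5 EE = fps_to_fls (qp 1 5 5)" "cp 10 EE = fps_to_fls (qp 1 10 10)"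
    by simp_all
  show "EE = fA * fB * fC * fD * fE * fH" "cp 2 EE = fC * fD * fH" "cp 5 EE = fE * fH" "cp 10 EE = fH"
    unfolding * unfolding EE_def qp_1_1 qp_2_2 qp_5_5 f_defs fls_times_fps_to_fls
    by (simp_all add: pH_def)
qed

definition dl :: "complex fls \<Rightarrow> complex fls" where "dl f = theta_D f / f"

lemma dl_mult: "f \<noteq> 0 \<Longrightarrow> g \<noteq> 0 \<Longrightarrow> dl (f * g) = dl f + dl g"
  by (simp add: dl_def theta_D_mult field_simps)

lemma dl_X [simp]: "dl fls_X = 1"
  by (simp add: dl_def)

lemma dl_power: "f \<noteq> 0 \<Longrightarrow> dl (f ^ n) = of_nat n * dl f"
  by (induction n) (simp_all add: dl_mult algebra_simps, simp add: dl_def)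

lemma dl_EE:
  "dl fA + dl fB + dl fC + dl fD + dl fE + dl fH = - GG" "dl fC + dl fD + dl fH = - 2 * cp 2 GG"
  "dl fE + dl fH = - 5 * cp 5 GG" "dl fH = - 10 * cp 10 GG"
proof -
  have nz: "EE \<noteq> 0" "cp 2 EE \<noteq> 0" "cp 5 EE \<noteq> 0" "cp 10 EE \<noteq> 0"
    unfolding EE_values(2-4) by (simp_all add: EE_values(1))
  have "dl (cp k EE) = - of_nat k * cp k GG" if "k > 0" "cp k EE \<noteq> 0" for k
    using that by (simp only: dl_def theta_D_EE_compose) simp
  from this[of 2] this[of 5] this[of 10]
  have 2: "dl (cp 2 EE) = - 2 * cp 2 GG" and 5: "dl (cp 5 EE) = - 5 * cp 5 GG" and 10: "dl (cp 10 EE) = - 10 * cp 10 GG"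
    using nz by simp_all
  have "dl EE = - GG" using nz by (simp add: dl_def theta_D_EE)
  thus "dl fA + dl fB + dl fC + dl fD + dl fE + dl fH = - GG"
    unfolding EE_values(1) by (simp add: dl_mult add.assoc)
  show "dl fC + dl fD + dl fH = - 2 * cp 2 GG"
    using 2 unfolding EE_values(2) by (simp add: dl_mult add.assoc)
  show "dl fE + dl fH = - 5 * cp 5 GG"
    using 5 unfolding EE_values(3) by (simp add: dl_mult add.assoc)
  show "dl fH = - 10 * cp 10 GG"
    using 10 unfolding EE_values(4) .
qed

lemma qy_nonzero [simp]: "qy \<noteq> 0" and qy_dl: "3 * dl fA + 3 * dl fB + 2 * dl fC + 2 * dl fD + 4 * dl fE + dl qy = 1"
proof -
  have y: "qy * (fA ^ 3 * fB ^ 3 * fC\<^sup>2 * fD\<^sup>2 * fE ^ 4) = fls_X"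
    using qy_product by (simp add: f_defs fls_times_fps_to_fls fps_to_fls_power)
  show nz: "qy \<noteq> 0" using y by force
  have "dl (qy * (fA ^ 3 * fB ^ 3 * fC\<^sup>2 * fD\<^sup>2 * fE ^ 4)) = 1" unfolding y by simp
  thus "3 * dl fA + 3 * dl fB + 2 * dl fC + 2 * dl fD + 4 * dl fE + dl qy = 1"
    using nz by (simp add: dl_mult dl_power algebra_simps)
qed

text \<open>Linear algebra on the relations \<open>dl_EE\<close>. The right-hand side is the
  logarithmic derivative of q fA fB / fE^4.\<close>

lemma qF_dl: "qF = 1 + dl fA + dl fB - 4 * dl fE"
proof -
  have "24 * qF = 24 * (1 + dl fA + dl fB - 4 * dl fE)"
    unfolding qF_GG using dl_EE by algebra
  thus ?thesis by (subst (asm) mult_left_cancel) auto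
qed

text \<open>Expresses 4 F y through Lambert series; the condition is the differential equation of y,
  established below as \<open>qF_qy'\<close>.\<close>

lemma qF_qy_GG: "4 * (qF * qy) = 4 * GG - 20 * cp 5 GG - 4 * cp 2 GG + 20 * cp 10 GG" if "4 * (qF * qy) = dl qy - qF"
  unfolding that unfolding qF_dl using qy_dl dl_EE by algebra

text \<open>F is the logarithmic derivative of w = y / (1 + 4 y), and dw/w = dy / (y (1 + 4
  y)).\<close>

lemma qF_qy: "qF * (qy * (1 + 4 * qy)) = theta_D qy"
proof -
  define w where "w = fls_X * fA * fB / fE ^ 4"
  have w0: "w \<noteq> 0" by (simp add: w_def)
  have wE: "w * fE ^ 4 = fls_X * fA * fB" by (simp add: w_def)
  have y: "qy = fls_X / (fA ^ 3 * fB ^ 3 * fC\<^sup>2 * fD\<^sup>2 * fE ^ 4)"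
    using qy_product by (simp add: f_defs fls_times_fps_to_fls fps_to_fls_power field_simps)
  have "qy * (fE ^ 4 - 4 * fls_X * fA * fB) = fls_X * fA * fB"
    unfolding y by (rule level_10_relations(7)[of fls_X fA fB fC fD fE]) (use fls_relations in auto)
  hence "fE ^ 4 * (qy * (1 - 4 * w)) = fE ^ 4 * w" using wE by algebra
  hence yw: "qy * (1 - 4 * w) = w" by simp
  have "dl (w * fE ^ 4) = dl (fls_X * fA * fB)" unfolding wE ..
  hence "dl w = qF" using w0 by (simp add: dl_mult dl_power qF_dl algebra_simps)
  hence Dw: "theta_D w = qF * w" using w0 by (simp add: dl_def nonzero_divide_eq_eq)
  have "w * (1 + 4 * qy) = qy" using yw by (simp add: algebra_simps)
  moreover have "theta_D (w * (1 + 4 * qy)) = theta_D w * (1 + 4 * qy) + w * (4 * theta_D qy)"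
    by (simp only: theta_D_mult theta_D_add theta_D_numeral mult_zero_left add_0)
  ultimately have "theta_D w * (1 + 4 * qy) + w * (4 * theta_D qy) = theta_D qy" by simp
  hence "qF * (w * (1 + 4 * qy)) = theta_D qy * (1 - 4 * w)" unfolding Dw by (simp add: algebra_simps)
  hence "qF * qy = theta_D qy * (1 - 4 * w)" using \<open>w * (1 + 4 * qy) = qy\<close> by simp
  moreover have "(1 - 4 * w) * (1 + 4 * qy) = 1 + 4 * qy - 4 * (w * (1 + 4 * qy))" by algebra
  hence "(1 - 4 * w) * (1 + 4 * qy) = 1" unfolding \<open>w * (1 + 4 * qy) = qy\<close> by simp
  ultimately show ?thesis by algebra
qed

lemma qF_qy': "4 * (qF * qy) = dl qy - qF"
  using qF_qy by (simp add: dl_def field_simps)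

section \<open>Invariance of F y under \<open>U5\<close>\<close>

lemma U5_cp_commute: "U5 (cp 2 f) = cp 2 (U5 f)"
proof (rule fls_eqI)
  fix n :: int
  have "5 * n div 2 = 5 * (n div 2)" if "even n" using that by auto
  thus "fls_nth (U5 (cp 2 f)) n = fls_nth (cp 2 (U5 f)) n"
    by (auto simp: U5_nth fls_nth_compose_power)
qed

lemma cp_cp: "cp 2 (cp 5 f) = cp 10 f" "cp 5 (cp 2 f) = cp 10 f"
proof -
  show "cp 2 (cp 5 f) = cp 10 f"
  proof (rule fls_eqI)
    fix n :: int
    show "fls_nth (cp 2 (cp 5 f)) n = fls_nth (cp 10 f) n"
    proof (cases "10 dvd n")
      case True
      then obtain m where "n = 10 * m" by (elim dvdE)
      thus ?thesis by (simp add: fls_nth_compose_power)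
    next
      case False
      moreover from this have "\<not> (2 dvd n \<and> 5 dvd n div 2)" by presburger
      ultimately show ?thesis by (simp add: fls_nth_compose_power)
    qed
  qed
  show "cp 5 (cp 2 f) = cp 10 f"
  proof (rule fls_eqI)
    fix n :: int
    show "fls_nth (cp 5 (cp 2 f)) n = fls_nth (cp 10 f) n"
    proof (cases "10 dvd n")
      case True
      then obtain m where "n = 10 * m" by (elim dvdE)
      thus ?thesis by (simp add: fls_nth_compose_power)
    next
      case False
      moreover from this have "\<not> (5 dvd n \<and> 2 dvd n div 5)" by presburger
      ultimately show ?thesis by (simp add: fls_nth_compose_power)
    qed
  qed
qed

text \<open>With G for \<open>GG\<close>, the series G(\<tau>) - 5 G(5 \<tau>) is fixed by
  \<open>U5\<close>, by the Hecke relation, and F y is this series minus its value at 2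
  \<tau>.\<close>

lemma U5_qF_qy: "U5 (qF * qy) = qF * qy"
proof -
  note G = qF_qy_GG[OF qF_qy']
  have "cp 10 GG = sub5 (cp 2 GG)" by (simp add: cp_cp)
  hence 10: "U5 (cp 10 GG) = cp 2 GG" by (simp only: U5_sub5)
  have 2: "U5 (cp 2 GG) = 6 * cp 2 GG - 5 * cp 10 GG"
    by (simp add: U5_cp_commute U5_GG cp_cp)
  have "4 * U5 (qF * qy) = U5 (4 * (qF * qy))" by (simp only: U5_numeral_mult)
  also have "\<dots> = 4 * (qF * qy)"
    unfolding G U5_add U5_diff U5_numeral_mult U5_GG U5_sub5 10 2 by (simp add: algebra_simps)
  finally show ?thesis by simp
qed

section \<open>The operators on powers of y\<close>

text \<open>Integer polynomials in y are kept as coefficient lists: since y satisfies no polynomial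
  equation over the integers, relations between series become computable identities of lists, and
  divisibility by 5 can be read off.\<close>

definition ev :: "int poly \<Rightarrow> complex fls" where
  "ev = peval qy"

lemma ev_0: "ev 0 = 0"
  by (simp add: ev_def peval_0)

lemma ev_pCons: "ev (pCons c p) = of_int c + qy * ev p"
  by (simp add: ev_def peval_pCons)

lemma ev_1 [simp]: "ev 1 = 1"
  by (simp add: one_pCons ev_pCons ev_0)

lemma ev_add: "ev (p + q) = ev p + ev q"
proof (induction p arbitrary: q)
  case (pCons c p)
  obtain a r where "q = pCons a r" by (cases q)
  thus ?case by (simp add: ev_pCons pCons.IH algebra_simps)
qed (simp add: ev_0)

lemma ev_smult: "ev (smult c p) = of_int c * ev p"
  by (induction p) (simp_all add: ev_0 ev_pCons algebra_simps)

lemma ev_uminus: "ev (- p) = - ev p"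
  using ev_smult[of "-1" p] by simp

lemma ev_diff: "ev (p - q) = ev p - ev q"
  using ev_add[of p "- q"] by (simp add: ev_uminus)

lemma ev_mult: "ev (p * q) = ev p * ev q"
  by (induction p) (simp_all add: ev_0 ev_pCons ev_add ev_smult algebra_simps)

lemma ev_power: "ev (p ^ n) = ev p ^ n"
  by (induction n) (simp_all add: ev_mult)

lemma theta_D_ev: "theta_D (ev p) = ev (pderiv p) * theta_D qy"
  by (induction p) (simp_all add: ev_0 ev_pCons pderiv_pCons ev_add theta_D_add theta_D_mult algebra_simps)

lemma ev_nth_0: "fls_nth (ev p) 0 = of_int (coeff p 0)"
proof -
  obtain y where y: "qy = fls_X * fps_to_fls y"
    by (auto simp: qy_def fls_times_fps_to_fls)
  have *: "\<exists>f. ev p = fps_to_fls f" for p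
  proof (induction p)
    case (pCons c p)
    then obtain f where "ev p = fps_to_fls f" by blast
    hence "ev (pCons c p) = fps_to_fls (of_int c + fps_X * y * f)"
      by (simp add: ev_pCons y fls_times_fps_to_fls)
    thus ?case by blast
  qed (auto intro: exI[of _ 0] simp: ev_0)
  show ?thesis
  proof (cases p)
    case (pCons c q)
    obtain f where "ev q = fps_to_fls f" using * by blast
    hence "ev p = fps_to_fls (of_int c + fps_X * (y * f))"
      by (simp add: pCons ev_pCons y fls_times_fps_to_fls mult_ac)
    thus ?thesis by (simp add: pCons fps_of_int [symmetric])
  qed
qed

text \<open>y vanishes at q = 0, so the constant coefficient of p is visible in q^0; once it is
  zero, a factor y splits off.\<close>

lemma ev_eq_0_iff: "ev p = 0 \<longleftrightarrow> p = 0"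
proof
  assume "ev p = 0"
  thus "p = 0"
  proof (induction p)
    case (pCons c p)
    have "c = 0" using ev_nth_0[of "pCons c p"] pCons.prems by simp
    thus ?case using pCons by (simp add: ev_pCons)
  qed simp
qed (simp add: ev_0)

lemma ev_eq_iff: "ev p = ev q \<longleftrightarrow> p = q"
  using ev_eq_0_iff[of "p - q"] by (simp add: ev_diff)

lemma sub5_ev: "sub5 (ev p) = peval tt p"
proof (induction p)
  case (pCons c p)
  have "sub5 (of_int c) = of_int c"
    by (metis fls_compose_power_const_left fls_of_int zero_less_numeral)
  thus ?case using pCons.IH by (simp add: ev_pCons peval_pCons)
qed (simp add: ev_0 peval_0)

lemmas ev_simps = ev_def peval_simps

lemma qF_nonzero [simp]: "qF \<noteq> 0"
proof
  assume "qF = 0"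
  hence "fls_nth (24 - 24 * (50 * cp 10 GG - 25 * cp 5 GG - 2 * cp 2 GG + GG)) 0 = 0"
    using qF_GG by simp
  thus False by (simp add: GG_nth fls_nth_compose_power)
qed

section \<open>Images of powers of \<rho> and y under \<open>U5\<close>\<close>

definition xx :: "complex fls" where "xx = 1 + 5 * qy"

abbreviation xp :: "int poly" where "xp \<equiv> [:1, 5:]"

lemma ev_xp [simp]: "ev xp = xx"
  by (simp add: ev_simps xx_def)

lemma xx_nonzero [simp]: "xx \<noteq> 0"
  unfolding ev_xp [symmetric] ev_eq_0_iff by simp

abbreviation \<delta> :: "int poly" where "\<delta> \<equiv> [:1, 16, 88, 160:]"

lemma sub5_ev_delta: "sub5 (ev \<delta>) = (1 + 12 * tt + 40 * tt\<^sup>2) * (1 + 4 * tt)"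
  unfolding sub5_ev peval_simps by algebra

lemma delta_nonzero: "(1 + 12 * tt + 40 * tt\<^sup>2) * (1 + 4 * tt) \<noteq> 0"
  unfolding sub5_ev_delta [symmetric] by (simp add: ev_eq_0_iff)

lemmas qy_powers =
  y_power_1 [OF rho_relations(3,4) delta_nonzero, folded sub5_ev sub5_ev_delta]
  y_power_2 [OF rho_relations(3,4) delta_nonzero, folded sub5_ev sub5_ev_delta]
  y_power_3 [OF rho_relations(3,4) delta_nonzero, folded sub5_ev sub5_ev_delta]
  y_power_4 [OF rho_relations(3,4) delta_nonzero, folded sub5_ev sub5_ev_delta]

lemma U5_rho_power_explicit:
  "xx * U5 (rho) = ev [:0, 5, 40, 80:]"
  "xx ^ 2 * U5 (rho ^ 2) = ev [:0, 10, 255, 2560, 12800, 32000, 32000:]"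
  "xx ^ 3 * U5 (rho ^ 3) = ev [:0, 9, 537, 12089, 144240, 1029600, 4576000, 12480000, 19200000, 12800000:]"
  "xx ^ 4 * U5 (rho ^ 4) = ev [:0, 4, 642, 27644, 599035, 7897600, 68876800, 412928000, 1720320000, 4915200000,
      9216000000, 10240000000, 5120000000:]"
proof -
  note t = U5_rho_power[folded xx_def]
  show 1: "xx * U5 rho = ev [:0, 5, 40, 80:]"
    using t(1) unfolding ev_simps by algebra
  have "xx ^ 2 * U5 (rho ^ 2) = qy * (1 + 4 * qy)\<^sup>2 * (10 * xx ^ 1 + 25 * (xx * U5 rho))"
    using t(2) by algebra
  also have "\<dots> = ev [:0, 10, 255, 2560, 12800, 32000, 32000:]"
    unfolding 1 unfolding xx_def ev_simps by algebra
  finally show 2: "xx ^ 2 * U5 (rho ^ 2) = ev [:0, 10, 255, 2560, 12800, 32000, 32000:]" .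
  have "xx ^ 3 * U5 (rho ^ 3) = qy * (1 + 4 * qy)\<^sup>2 * (9 * xx ^ 2 + 25 * xx ^ 1 * (xx * U5 rho) + 25 * (xx ^ 2 * U5 (rho ^ 2)))"
    using t(3) by algebra
  also have "\<dots> = ev [:0, 9, 537, 12089, 144240, 1029600, 4576000, 12480000, 19200000, 12800000:]"
    unfolding 1 2 unfolding xx_def ev_simps by algebra
  finally show 3: "xx ^ 3 * U5 (rho ^ 3) = ev [:0, 9, 537, 12089, 144240, 1029600, 4576000, 12480000, 19200000, 12800000:]" .
  have "xx ^ 4 * U5 (rho ^ 4) = qy * (1 + 4 * qy)\<^sup>2 * (4 * xx ^ 3 + 15 * xx ^ 2 * (xx * U5 rho) + 25 * xx ^ 1 * (xx ^ 2 * U5 (rho ^ 2)) + 25 * (xx ^ 3 * U5 (rho ^ 3)))"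
    using t(4) by algebra
  also have "\<dots> = ev [:0, 4, 642, 27644, 599035, 7897600, 68876800, 412928000, 1720320000, 4915200000,
      9216000000, 10240000000, 5120000000:]"
    unfolding 1 2 3 unfolding xx_def ev_simps by algebra
  finally show 4: "xx ^ 4 * U5 (rho ^ 4) = ev [:0, 4, 642, 27644, 599035, 7897600, 68876800, 412928000, 1720320000,
      4915200000, 9216000000, 10240000000, 5120000000:]" .
qed

text \<open>Linearity turns the first hypothesis into a formula for
  \<open>ev \<delta> * U5 f\<close> in the images of the powers of \<rho>. The second says that the
  denominators \<delta> and (1 + 5 y)^4 divide out, a computation with integer polynomials.\<close>

lemma U5_from_rho_relation:
  assumes "sub5 (ev \<delta>) * f = sub5 (ev c0) + sub5 (ev c1) * rho + sub5 (ev c2) * rho ^ 2 + sub5 (ev c3) * rho ^ 3 + sub5 (ev c4) * rho ^ 4"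
    and "c0 * xp ^ 4 + c1 * xp ^ 3 * [:0, 5, 40, 80:] + c2 * xp ^ 2 * [:0, 10, 255, 2560, 12800, 32000, 32000:] +
      c3 * xp * [:0, 9, 537, 12089, 144240, 1029600, 4576000, 12480000, 19200000, 12800000:] +
      c4 * [:0, 4, 642, 27644, 599035, 7897600, 68876800, 412928000, 1720320000, 4915200000, 9216000000,
          10240000000, 5120000000:] = \<delta> * xp ^ 4 * p"
  shows   "U5 f = ev p"
proof -
  have "ev \<delta> * U5 f = ev c0 + ev c1 * U5 rho + ev c2 * U5 (rho ^ 2) + ev c3 * U5 (rho ^ 3) + ev c4 * U5 (rho ^ 4)"
    using arg_cong[OF assms(1), of U5] by (simp only: U5_add U5_sub5_mult U5_sub5)
  hence "(ev \<delta> * xx ^ 4) * U5 f = ev c0 * xx ^ 4 + ev c1 * xx ^ 3 * (xx * U5 rho) + ev c2 * xx ^ 2 * (xx ^ 2 * U5 (rho ^ 2)) +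
      ev c3 * xx * (xx ^ 3 * U5 (rho ^ 3)) + ev c4 * (xx ^ 4 * U5 (rho ^ 4))"
    by algebra
  also have "\<dots> = ev (\<delta> * xp ^ 4 * p)"
    unfolding U5_rho_power_explicit assms(2) [symmetric] by (simp only: ev_add ev_mult ev_power ev_xp)
  also have "\<dots> = (ev \<delta> * xx ^ 4) * ev p"
    by (simp only: ev_mult ev_power ev_xp)
  finally show ?thesis by (simp add: ev_eq_0_iff)
qed

lemma U5_qy_1: "U5 (qy ^ 1) = ev [:0, 41, 860, 6800, 24000, 32000:]"
proof (rule U5_from_rho_relation)
  show "sub5 (ev \<delta>) * qy ^ 1 = sub5 (ev [:0, -2, -18, -40:]) + sub5 (ev [:1, 9, 20:]) * rho + sub5 (ev [:2,
      18, 40:]) * rho ^ 2 +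
      sub5 (ev [:2, 20, 50:]) * rho ^ 3 + sub5 (ev 0) * rho ^ 4"
    using qy_powers(1) by (simp only: ev_0 fls_compose_power_0_left mult_zero_left add_0_right power_one_right)
qed (simp add: power_numeral_reduce)

lemma U5_qy_2: "U5 (qy ^ 2) = ev [:0, 86, 10195, 366600, 6534800, 68384000, 450720000, 1907200000, 5056000000,
    7680000000, 5120000000:]"
  by (rule U5_from_rho_relation[OF qy_powers(2)]) (simp add: power_numeral_reduce)

lemma U5_qy_3: "U5 (qy ^ 3) = ev [:0, 51, 27495, 2836265, 128688900, 3343692000, 56283680000, 656205600000,
    5502096000000, 33821312000000, 153192960000000, 506956800000000, 1195008000000000, 1904640000000000,
    1843200000000000, 819200000000000:]"
  by (rule U5_from_rho_relation[OF qy_powers(3)]) (simp add: power_numeral_reduce)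

lemma U5_qy_4: "U5 (qy ^ 4) = ev [:0, 12, 32674, 8579260, 831492275, 42958434000, 1396773180000, 31314949600000,
    511802288800000, 6319880448000000, 60349364480000000, 452174745600000000, 2679038592000000000,
    12574269440000000000, 46561935360000000000, 134544588800000000000, 297365504000000000000,
    485949440000000000000, 553779200000000000000, 393216000000000000000, 131072000000000000000:]"
  by (rule U5_from_rho_relation[OF qy_powers(4)]) (simp add: power_numeral_reduce)

lemma fls_compose_power_of_nat: "d > 0 \<Longrightarrow> fls_compose_power (of_nat n :: complex fls) d = of_nat n"
  by (metis fls_compose_power_const_left fls_of_nat)

section \<open>The values of \<open>U_one\<close> on y, ..., y^5\<close>

lemma U_one_add: "U_one (f + g) = U_one f + U_one g"
  by (simp add: U_one_def U5_add distrib_left add_divide_distrib)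

lemma U_one_sub5_mult: "U_one (sub5 f * g) = f * U_one g"
  using U5_sub5_mult[of f "qF * g"] by (simp add: U_one_def mult_ac)

text \<open>Entry i is the image of y^(i+1). The first is y because F y is invariant under
  \<open>U5\<close>; the others solve the relation in \<open>U_one_qy_step\<close>
  successively.\<close>

definition init_one :: "int poly list" where
  "init_one = [[:0, 1:],
     [:0, 51, 2355, 34100, 222000, 680000, 800000:],
     [:0, 41, 12370, 729825, 19031000, 278878000, 2544800000, 15104800000, 58656000000, 144320000000, 204800000000,
         128000000000:],
     [:0, 11, 19905, 3454525, 223905075, 7754231500, 167937100000, 2472993600000, 25981388000000, 200155120000000,
         1145572480000000, 4876736000000000, 15269248000000000, 34216960000000000, 52019200000000000,
         48128000000000000, 20480000000000000:],
     [:0, 1, 15460, 7261110, 1015561300, 69341456625, 2845455650000, 78359002700000, 1547016184000000,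
         22842647868000000, 259404025920000000, 2307498560000000000, 16259980160000000000, 91259994240000000000,
         408027340800000000000, 1445499596800000000000, 4009533440000000000000, 8528916480000000000000,
         13441433600000000000000, 14794752000000000000000, 10158080000000000000000, 3276800000000000000000:]]"

lemma U_one_qy_1: "U_one (qy ^ 1) = ev (init_one ! 0)"
  by (simp add: U_one_def U5_qF_qy ev_simps init_one_def)

text \<open>\<open>qF * (1 + 4 * qy)\<close> is the logarithmic derivative of \<open>qy\<close>, and \<open>U5\<close> commutes with
  the derivation up to the factor 5.\<close>

lemma U_one_qy_step_aux:
  assumes "U5 (qy ^ Suc i) = ev p" "U_one (qy ^ Suc i) = ev q"
  shows   "of_nat (Suc i) * (ev q + 4 * U_one (qy ^ Suc (Suc i))) = 5 * ev (pderiv p) * (qy * (1 + 4 * qy))"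
proof -
  have "theta_D (qy ^ Suc i) * qy = of_nat (Suc i) * qy ^ Suc i * theta_D qy"
    by (rule theta_D_power)
  also have "\<dots> = of_nat (Suc i) * qF * (qy ^ Suc i + 4 * qy ^ Suc (Suc i)) * qy"
    unfolding qF_qy [symmetric] by (simp add: algebra_simps)
  finally have "theta_D (qy ^ Suc i) = of_nat (Suc i) * qF * (qy ^ Suc i + 4 * qy ^ Suc (Suc i))"
    by simp
  hence "U5 (theta_D (qy ^ Suc i)) = U5 (sub5 (of_nat (Suc i)) * (qF * qy ^ Suc i + 4 * (qF * qy ^ Suc (Suc i))))"
    by (simp add: fls_compose_power_of_nat algebra_simps)
  also have "\<dots> = of_nat (Suc i) * (qF * (ev q + 4 * U_one (qy ^ Suc (Suc i))))"
    unfolding U5_sub5_mult U5_add U5_numeral_mult assms(2)[symmetric] by (simp add: U_one_def field_simps)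
  finally have "qF * (of_nat (Suc i) * (ev q + 4 * U_one (qy ^ Suc (Suc i)))) = 5 * theta_D (U5 (qy ^ Suc i))"
    unfolding U5_theta_D by (simp only: mult_ac)
  also have "\<dots> = qF * (5 * ev (pderiv p) * (qy * (1 + 4 * qy)))"
    unfolding assms(1) theta_D_ev qF_qy [symmetric] by (simp only: mult_ac)
  finally show ?thesis by simp
qed

text \<open>The last hypothesis is the image under \<open>U5\<close> of the derivative of y^i, read
  as an equation of integer polynomials that determines r.\<close>

lemma U_one_qy_step:
  assumes "U5 (qy ^ i) = ev p" "U_one (qy ^ i) = ev q" "i > 0" "n = Suc i"
    and "smult (int i) (q + smult 4 r) = smult 5 (pderiv p * [:0, 1, 4:])"
  shows   "U_one (qy ^ n) = ev r"
proof -
  have "qy * (1 + 4 * qy) = ev [:0, 1, 4:]" unfolding ev_simps by algebra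
  moreover obtain k where i: "i = Suc k" using assms(3) by (cases i) auto
  ultimately have "of_nat i * (ev q + 4 * U_one (qy ^ Suc i)) = ev (smult 5 (pderiv p * [:0, 1, 4:]))"
    using U_one_qy_step_aux[of k, folded i, OF assms(1,2)] by (simp only: ev_smult ev_mult of_int_numeral mult.assoc)
  also have "\<dots> = of_nat i * (ev q + 4 * ev r)"
    unfolding assms(5) [symmetric] by (simp only: ev_smult ev_add of_int_numeral of_int_of_nat_eq)
  finally show ?thesis using assms(3,4) by simp
qed

lemma U_one_qy_2: "U_one (qy ^ 2) = ev (init_one ! 1)"
  by (rule U_one_qy_step[OF U5_qy_1 U_one_qy_1]) (simp_all add: init_one_def pderiv_pCons)

lemma U_one_qy_3: "U_one (qy ^ 3) = ev (init_one ! 2)"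
  by (rule U_one_qy_step[OF U5_qy_2 U_one_qy_2]) (simp_all add: init_one_def pderiv_pCons)

lemma U_one_qy_4: "U_one (qy ^ 4) = ev (init_one ! 3)"
  by (rule U_one_qy_step[OF U5_qy_3 U_one_qy_3]) (simp_all add: init_one_def pderiv_pCons)

lemma U_one_qy_5: "U_one (qy ^ 5) = ev (init_one ! 4)"
  by (rule U_one_qy_step[OF U5_qy_4 U_one_qy_4]) (simp_all add: init_one_def pderiv_pCons)

lemmas U_one_qy = U_one_qy_1 U_one_qy_2 U_one_qy_3 U_one_qy_4 U_one_qy_5

section \<open>The values of \<open>U_zero\<close> on y, ..., y^5\<close>

lemma qy_modular_equation: "qy ^ 5 =
    sub5 (ev [:0, 1, 20, 150, 500, 625:]) +
    sub5 (ev [:0, 15, 305, 2325, 7875, 10000:]) * qy +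
    sub5 (ev [:0, 85, 1750, 13525, 46500, 60000:]) * qy ^ 2 +
    sub5 (ev [:0, 215, 4475, 35000, 122000, 160000:]) * qy ^ 3 +
    sub5 (ev [:0, 205, 4300, 34000, 120000, 160000:]) * qy ^ 4"
  unfolding sub5_ev by (rule modular_equation[OF rho_relations(3,4) delta_nonzero])

lemma qy_combination_mult_qy:
  "(a + b * qy + c * qy ^ 2 + d * qy ^ 3 + e * qy ^ 4) * qy = a * qy + b * qy ^ 2 + c * qy ^ 3 + d * qy ^ 4 + e * qy ^ 5"
  by algebra

text \<open>Z y is a multiple of \<rho>^3 over the rational functions of t; solving the linear
  system \<open>qy_powers\<close> for \<rho>^3 gives the coefficients and the denominator on the
  left.\<close>

lemma qZ_qy_1: "sub5 (ev [:1, 40, 425, 1750, 2500:]) * (qZ * qy ^ 1) =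
    sub5 (ev [:0, 30, 1390, 20350, 134250, 417500, 500000:]) +
    sub5 (ev [:0, 310, 14500, 215750, 1449000, 4590000, 5600000:]) * qy +
    sub5 (ev [:0, 1080, 50800, 763000, 5192000, 16720000, 20800000:]) * qy ^ 2 +
    sub5 (ev [:1, 1260, 58600, 892000, 6160000, 20160000, 25600000:]) * qy ^ 3 +
    sub5 (ev [:-6, -160:]) * qy ^ 4"
  (is "?s * _ = ?c0 + ?c1 * qy + ?c2 * qy ^ 2 + ?c3 * qy ^ 3 + ?c4 * qy ^ 4")
proof -
  let ?d = "sub5 (ev \<delta>)"
  have "?d * (1 + 4 * tt) * (?c0 + ?c1 * qy + ?c2 * qy ^ 2 + ?c3 * qy ^ 3 + ?c4 * qy ^ 4) =
      (1 + 4 * tt) * (?c0 * ?d + ?c1 * (?d * qy) + ?c2 * (?d * qy ^ 2) + ?c3 * (?d * qy ^ 3) + ?c4 * (?d * qy ^ 4))"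
    by algebra
  also have "\<dots> = ?d * ?s * ((1 + 5 * tt) * rho ^ 3)"
    unfolding qy_powers unfolding sub5_ev peval_simps by algebra
  also have "\<dots> = ?d * (1 + 4 * tt) * (?s * (qZ * qy ^ 1))"
    unfolding rho_relations(5) [symmetric] by algebra
  finally have "?d * (1 + 4 * tt) * (?s * (qZ * qy ^ 1)) = ?d * (1 + 4 * tt) * (?c0 + ?c1 * qy + ?c2 * qy ^ 2 + ?c3 * qy ^ 3 + ?c4 * qy ^ 4)" ..
  thus ?thesis using delta_nonzero unfolding sub5_ev_delta by simp
qed

text \<open>Multiplication by y, with y^5 removed by the modular equation, leaves the denominator
  unchanged; the next powers follow likewise.\<close>

lemma qZ_qy_2: "sub5 (ev [:1, 40, 425, 1750, 2500:]) * (qZ * qy ^ 2) =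
    sub5 (ev [:0, -6, -280, -4100, -27000, -83750, -100000:]) +
    sub5 (ev [:0, -60, -2840, -42400, -285000, -902500, -1100000:]) * qy +
    sub5 (ev [:0, -200, -9600, -145400, -994000, -3210000, -4000000:]) * qy ^ 2 +
    sub5 (ev [:0, -210, -10450, -163000, -1140000, -3760000, -4800000:]) * qy ^ 3 +
    sub5 (ev [:1, 30:]) * qy ^ 4"
  (is "?s * _ = ?r")
proof -
  have "?s * (qZ * qy ^ 2) = ?s * (qZ * qy ^ 1) * qy" by algebra
  also have "\<dots> = ?r"
    unfolding qZ_qy_1 qy_combination_mult_qy qy_modular_equation
    unfolding sub5_ev peval_simps by algebra
  finally show ?thesis .
qed

lemma qZ_qy_3: "sub5 (ev [:1, 40, 425, 1750, 2500:]) * (qZ * qy ^ 3) =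
    sub5 (ev [:0, 1, 50, 750, 5000, 15625, 18750:]) +
    sub5 (ev [:0, 9, 475, 7375, 50625, 162500, 200000:]) * qy +
    sub5 (ev [:0, 25, 1460, 23625, 167250, 552500, 700000:]) * qy ^ 2 +
    sub5 (ev [:0, 15, 1325, 23850, 178000, 610000, 800000:]) * qy ^ 3 +
    sub5 (ev [:0, -5:]) * qy ^ 4"
  (is "?s * _ = ?r")
proof -
  have "?s * (qZ * qy ^ 3) = ?s * (qZ * qy ^ 2) * qy" by algebra
  also have "\<dots> = ?r"
    unfolding qZ_qy_2 qy_combination_mult_qy qy_modular_equation
    unfolding sub5_ev peval_simps by algebra
  finally show ?thesis .
qed

lemma qZ_qy_4: "sub5 (ev [:1, 40, 425, 1750, 2500:]) * (qZ * qy ^ 4) =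
    sub5 (ev [:0, 0, -5, -100, -750, -2500, -3125:]) +
    sub5 (ev [:0, 1, -25, -775, -6625, -23750, -31250:]) * qy +
    sub5 (ev [:0, 9, 50, -1375, -17000, -70000, -100000:]) * qy ^ 2 +
    sub5 (ev [:0, 25, 385, 1250, -7750, -57500, -100000:]) * qy ^ 3 +
    sub5 (ev [:0, 15, 300, 2350, 8000, 10000:]) * qy ^ 4"
  (is "?s * _ = ?r")
proof -
  have "?s * (qZ * qy ^ 4) = ?s * (qZ * qy ^ 3) * qy" by algebra
  also have "\<dots> = ?r"
    unfolding qZ_qy_3 qy_combination_mult_qy qy_modular_equation
    unfolding sub5_ev peval_simps by algebra
  finally show ?thesis .
qed

text \<open>Division by y instead of multiplication. It requires dividing the constant coefficient
  by t (1 + 5 t)^4; three factors 1 + 5 t cancel, and the fourth enlarges the denominator.\<close>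

lemma qZ_qy_0: "sub5 (ev [:1, 45, 625, 3875, 11250, 12500:]) * (qZ * qy ^ 0) =
    sub5 (ev [:0, -140, -7200, -128200, -1114000, -5167500, -12350000, -12000000:]) +
    sub5 (ev [:0, -1470, -76200, -1373750, -12101500, -56930000, -138000000, -136000000:]) * qy +
    sub5 (ev [:1, -5185, -271450, -4931500, -43840000, -208520000, -512000000, -512000000:]) * qy ^ 2 +
    sub5 (ev [:-6, -6340, -322500, -5882000, -52760000, -253600000, -630400000, -640000000:]) * qy ^ 3 +
    sub5 (ev [:30, 940, 4000:]) * qy ^ 4"
  (is "?s * _ = ?r")
proof -
  have "?r * qy = (1 + 5 * tt) * (sub5 (ev [:1, 40, 425, 1750, 2500:]) * (qZ * qy ^ 1))"
    unfolding qZ_qy_1 qy_combination_mult_qy qy_modular_equation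
    unfolding sub5_ev peval_simps by algebra
  also have "\<dots> = ?s * (qZ * qy ^ 0) * qy"
    unfolding sub5_ev peval_simps by algebra
  finally show ?thesis by simp
qed

lemma U_zero_eq: "U_zero f = U_one (qZ * f)"
  by (simp add: U_zero_def U_one_def mult.assoc)

text \<open>One factor y is set aside because \<open>U_one\<close> has been computed on y, ..., y^5,
  not on 1; hence Z y^k serves for y^(k+1). The last hypothesis says that the denominator s divides
  out.\<close>

lemma U_zero_from_relation:
  assumes "sub5 (ev s) * (qZ * qy ^ k) =
      sub5 (ev c0) + sub5 (ev c1) * qy + sub5 (ev c2) * qy ^ 2 + sub5 (ev c3) * qy ^ 3 + sub5 (ev c4) * qy ^ 4"
    and "n = Suc k" "s \<noteq> 0"
    and "c0 * init_one ! 0 + c1 * init_one ! 1 + c2 * init_one ! 2 + c3 * init_one ! 3 + c4 * init_one ! 4 = s * p"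
  shows   "U_zero (qy ^ n) = ev p"
proof -
  have "ev s * U_zero (qy ^ n) = U_one (sub5 (ev s) * (qZ * qy ^ k) * qy)"
    unfolding U_zero_eq U_one_sub5_mult [symmetric] assms(2) by (simp add: mult_ac)
  also have "\<dots> = ev (s * p)"
    unfolding assms(1) assms(4) [symmetric] qy_combination_mult_qy U_one_add U_one_sub5_mult ev_add ev_mult
      U_one_qy [symmetric] power_one_right ..
  finally show ?thesis using assms(3) by (simp add: ev_mult ev_eq_0_iff)
qed

definition init_zero :: "int poly list" where
  "init_zero = [[:0, 5, 20:],
     [:0, 5, 765, 19780, 213200, 1144000, 3040000, 3200000:],
     [:0, 1, 1874, 200505, 7746600, 156578000, 1919520000, 15290400000, 81372800000, 288512000000, 656640000000,
         870400000000, 512000000000:],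
     [:0, 0, 1645, 584630, 57141325, 2676276500, 74438740000, 1370303600000, 17757300000000, 168017040000000,
         1184982400000000, 6284736000000000, 25023104000000000, 73814528000000000, 156753920000000000,
         226918400000000000, 200704000000000000, 81920000000000000:],
     [:0, 0, 710, 820115, 181557100, 16975701375, 890769910000, 30196540100000, 717309570000000, 12567322500000000,
         167971883200000000, 1751942694400000000, 14472096793600000000, 95521921152000000000,
         505651991040000000000, 2144317235200000000000, 7238786048000000000000, 19208048640000000000000,
         39215841280000000000000, 59487027200000000000000, 63176704000000000000000, 41943040000000000000000,
         13107200000000000000000:]]"

lemma U_zero_qy_1: "U_zero (qy ^ 1) = ev (init_zero ! 0)"
  by (rule U_zero_from_relation[OF qZ_qy_0]) (simp_all add: init_one_def init_zero_def)

lemma U_zero_qy_2: "U_zero (qy ^ 2) = ev (init_zero ! 1)"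
  by (rule U_zero_from_relation[OF qZ_qy_1]) (simp_all add: init_one_def init_zero_def)

lemma U_zero_qy_3: "U_zero (qy ^ 3) = ev (init_zero ! 2)"
  by (rule U_zero_from_relation[OF qZ_qy_2]) (simp_all add: init_one_def init_zero_def)

lemma U_zero_qy_4: "U_zero (qy ^ 4) = ev (init_zero ! 3)"
  by (rule U_zero_from_relation[OF qZ_qy_3]) (simp_all add: init_one_def init_zero_def)

lemma U_zero_qy_5: "U_zero (qy ^ 5) = ev (init_zero ! 4)"
  by (rule U_zero_from_relation[OF qZ_qy_4]) (simp_all add: init_one_def init_zero_def)

lemmas U_zero_qy = U_zero_qy_1 U_zero_qy_2 U_zero_qy_3 U_zero_qy_4 U_zero_qy_5

section \<open>Divisibility by powers of 5\<close>

definition mod_coeff :: "nat \<Rightarrow> int poly" where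
  "mod_coeff j = [[:0, 1, 20, 150, 500, 625:],
     [:0, 15, 305, 2325, 7875, 10000:],
     [:0, 85, 1750, 13525, 46500, 60000:],
     [:0, 215, 4475, 35000, 122000, 160000:],
     [:0, 205, 4300, 34000, 120000, 160000:]] ! j"

lemma sum_lessThan_5: "(\<Sum>j<5. f j) = f 0 + f 1 + f 2 + f 3 + (f (4::nat) :: 'a :: comm_monoid_add)"
  by (simp add: lessThan_nat_numeral lessThan_Suc add_ac)

lemma qy_power_5: "qy ^ 5 = (\<Sum>j<5. sub5 (ev (mod_coeff j)) * qy ^ j)"
  unfolding qy_modular_equation sum_lessThan_5 by (simp add: mod_coeff_def)

text \<open>Entry n will belong to y^(n+1). The argument \<open>n - Suc (4 - j)\<close> is n - 5 +
  j, written so that it is visibly smaller than n.\<close>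

fun rec_poly :: "int poly list \<Rightarrow> nat \<Rightarrow> int poly" where
  "rec_poly I n = (if n < 5 then I ! n else (\<Sum>j<5. mod_coeff j * rec_poly I (n - Suc (4 - j))))"

declare rec_poly.simps [simp del]

lemma rec_poly_less_5: "n < 5 \<Longrightarrow> rec_poly I n = I ! n"
  by (subst rec_poly.simps) simp

lemma rec_poly_ge_5: "rec_poly I (n + 5) = (\<Sum>j<5. mod_coeff j * rec_poly I (n + j))"
proof -
  have "n + 5 - Suc (4 - j) = n + j" if "j < 5" for j using that by linarith
  thus ?thesis by (subst rec_poly.simps) (auto intro!: sum.cong)
qed

lemma rec_poly_induct [case_names init step]:
  assumes "\<And>n. n < 5 \<Longrightarrow> Q n" "\<And>n. (\<And>j. j < 5 \<Longrightarrow> Q (n + j)) \<Longrightarrow> Q (n + 5)"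
  shows   "Q (n :: nat)"
proof (induction n rule: less_induct)
  case (less n)
  show ?case
  proof (cases "n < 5")
    case False
    then obtain m where "n = m + 5" by (metis add.commute le_Suc_ex not_less)
    thus ?thesis using assms(2)[of m] less by simp
  qed (rule assms(1))
qed

lemma all_nat_Suc: "(\<forall>n. Q n) \<longleftrightarrow> Q 0 \<and> (\<forall>n. Q (Suc n))"
  by (metis not0_implies_Suc)

text \<open>A lower bound floor((5r + k)/6) for the 5-adic valuation of coefficient r, with the
  slope 5/6 of \<theta> and \<phi>; negative bounds count as 0.\<close>

definition div_bound :: "int \<Rightarrow> int poly \<Rightarrow> bool" where
  "div_bound k p \<longleftrightarrow> (\<forall>r. 5 ^ nat ((5 * int r + k) div 6) dvd coeff p r)"

lemma div_bound_0 [simp]: "div_bound k 0"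
  by (simp add: div_bound_def)

lemma div_bound_pCons [simp]: "div_bound k (pCons c p) \<longleftrightarrow> 5 ^ nat (k div 6) dvd c \<and> div_bound (k + 5) p"
proof -
  have "div_bound k (pCons c p) \<longleftrightarrow> 5 ^ nat (k div 6) dvd c \<and>
      (\<forall>r. 5 ^ nat ((5 * int (Suc r) + k) div 6) dvd coeff p r)"
    unfolding div_bound_def by (subst all_nat_Suc) simp
  also have "(\<lambda>r. 5 * int (Suc r) + k) = (\<lambda>r. 5 * int r + (k + 5))" by (simp add: fun_eq_iff)
  hence "(\<forall>r. 5 ^ nat ((5 * int (Suc r) + k) div 6) dvd coeff p r) \<longleftrightarrow> div_bound (k + 5) p"
    unfolding div_bound_def by metis
  finally show ?thesis .
qed

lemma div_bound_sum: "(\<And>i. i \<in> A \<Longrightarrow> div_bound k (f i)) \<Longrightarrow> div_bound k (\<Sum>i\<in>A. f i)"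
  by (simp add: div_bound_def coeff_sum dvd_sum)

text \<open>The loss of 5 comes from rounding down twice: floor((x + y - 5)/6) \<le> floor(x/6) +
  floor(y/6).\<close>

lemma div_bound_mult:
  assumes "j \<ge> 0" "div_bound j p" "div_bound k q"
  shows   "div_bound (j + k - 5) (p * q)"
  unfolding div_bound_def coeff_mult
proof (intro allI dvd_sum)
  fix r l :: nat assume l: "l \<in> {..r}"
  have "nat ((x + y - 5) div 6) \<le> nat (x div 6) + nat (y div 6)" if "x \<ge> 0" for x y :: int
    using that by linarith
  from this[of "5 * int l + j" "5 * int (r - l) + k"]
  have "nat ((5 * int r + (j + k - 5)) div 6) \<le> nat ((5 * int l + j) div 6) + nat ((5 * int (r - l) + k) div 6)"
    using l assms(1) by (simp add: of_nat_diff algebra_simps)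
  hence "(5 :: int) ^ nat ((5 * int r + (j + k - 5)) div 6) dvd 5 ^ nat ((5 * int l + j) div 6) * 5 ^ nat ((5 * int (r - l) + k) div 6)"
    by (simp add: le_imp_power_dvd flip: power_add)
  also have "\<dots> dvd coeff p l * coeff q (r - l)"
    using assms(2,3) by (auto simp: div_bound_def intro: mult_dvd_mono)
  finally show "5 ^ nat ((5 * int r + (j + k - 5)) div 6) dvd coeff p l * coeff q (r - l)" .
qed

lemma less_5_cases: "(n :: nat) < 5 \<longleftrightarrow> n = 0 \<or> n = 1 \<or> n = 2 \<or> n = 3 \<or> n = 4"
  by auto

lemma div_bound_mod_coeff: "j < 5 \<Longrightarrow> div_bound (int j) (mod_coeff j)"
  unfolding less_5_cases by (elim disjE) (simp_all add: mod_coeff_def)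

text \<open>The weights j in \<open>div_bound_mod_coeff\<close> make the bound reproduce itself: j +
  (c - (n + j)) - 5 = c - (n + 5).\<close>

lemma div_bound_rec_poly:
  assumes "\<And>n. n < 5 \<Longrightarrow> div_bound (c - int n) (I ! n)"
  shows   "div_bound (c - int n) (rec_poly I n)"
proof (induction n rule: rec_poly_induct)
  case (step n)
  have "div_bound (int j + (c - int (n + j)) - 5) (mod_coeff j * rec_poly I (n + j))" if "j < 5" for j
    by (rule div_bound_mult) (use that step div_bound_mod_coeff in auto)
  thus ?case unfolding rec_poly_ge_5 by (intro div_bound_sum) (simp add: algebra_simps)
qed (simp add: assms rec_poly_less_5)

lemma coeff_0_rec_poly:
  assumes "\<And>n. n < 5 \<Longrightarrow> coeff (I ! n) 0 = 0"
  shows   "coeff (rec_poly I n) 0 = 0"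
  by (induction n rule: rec_poly_induct) (simp_all add: assms rec_poly_less_5 rec_poly_ge_5 coeff_sum coeff_mult_0)

lemma div_bound_one: "div_bound (- int n) (rec_poly init_one n)"
proof -
  have "div_bound (0 - int n) (rec_poly init_one n)"
    by (rule div_bound_rec_poly) (unfold less_5_cases, elim disjE, simp_all add: init_one_def)
  thus ?thesis by simp
qed

lemma div_bound_zero: "div_bound (- 3 - int n) (rec_poly init_zero n)"
  by (rule div_bound_rec_poly) (unfold less_5_cases, elim disjE, simp_all add: init_zero_def)

lemma coeff_0_one_zero: "coeff (rec_poly init_one n) 0 = 0" "coeff (rec_poly init_zero n) 0 = 0"
  by (rule coeff_0_rec_poly, unfold less_5_cases, elim disjE, simp_all add: init_one_def init_zero_def)+

section \<open>The equation for x = 1 + 5 y, and polynomials in 5 y\<close>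

definition x_coeff :: "nat \<Rightarrow> int poly" where
  "x_coeff k = [[:5, -150, -2750, -16875, -46875, -50000:],
     [:-10, -650, -12125, -85625, -262500, -300000:],
     [:10, -1275, -25875, -195000, -650000, -800000:],
     [:-5, -1025, -21500, -170000, -600000, -800000:],
     [:1:]] ! k"

lemma x_coeff_values:
  "x_coeff 0 = [:5, -150, -2750, -16875, -46875, -50000:]"
  "x_coeff 1 = [:-10, -650, -12125, -85625, -262500, -300000:]"
  "x_coeff 2 = [:10, -1275, -25875, -195000, -650000, -800000:]"
  "x_coeff 3 = [:-5, -1025, -21500, -170000, -600000, -800000:]"
  "x_coeff 4 = [:1:]"
  by (simp_all add: x_coeff_def)

text \<open>Substituting y = (x - 1)/5 in the modular equation leaves (1 + 5 t)^5 as the term free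
  of x. Isolating it makes the other side divisible by x, so x(5 \<tau>)^5 / x is a polynomial in
  x.\<close>

lemma xx_equation: "sub5 (xx ^ 5) = (\<Sum>k<5. sub5 (ev (x_coeff k)) * xx ^ Suc k)"
proof -
  have "(\<Sum>k<5. sub5 (ev (x_coeff k)) * xx ^ Suc k) =
     sub5 (ev (x_coeff 0)) * xx + sub5 (ev (x_coeff 1)) * xx ^ 2 + sub5 (ev (x_coeff 2)) * xx ^ 3
       + sub5 (ev (x_coeff 3)) * xx ^ 4 + sub5 (ev (x_coeff 4)) * xx ^ 5"
    by (simp add: sum_lessThan_5 numeral_eq_Suc)
  also have "\<dots> = sub5 (xx ^ 5)"
    unfolding x_coeff_values sub5_ev peval_simps using qy_modular_equation[unfolded sub5_ev peval_simps]
    by (simp add: xx_def) algebra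
  finally show ?thesis ..
qed

text \<open>For k = 0 these are the integer polynomials in 5 y; the offset k supports the recursion
  over coefficient lists.\<close>

definition five :: "nat \<Rightarrow> int poly \<Rightarrow> bool" where
  "five k p \<longleftrightarrow> (\<forall>l. 5 ^ (l + k) dvd coeff p l)"

lemma five_0 [simp]: "five k 0"
  by (simp add: five_def)

lemma five_pCons [simp]: "five k (pCons c p) \<longleftrightarrow> 5 ^ k dvd c \<and> five (Suc k) p"
  unfolding five_def by (subst all_nat_Suc) simp

lemma five_x_coeff: "k < 5 \<Longrightarrow> five 0 (x_coeff k)"
  unfolding less_5_cases by (elim disjE) (simp_all add: x_coeff_def)

lemma five_xp_power: "five 0 (xp ^ n)"
proof (induction n)
  case (Suc n)
  have "coeff (xp * xp ^ n) l = coeff (xp ^ n) l + (case l of 0 \<Rightarrow> 0 | Suc k \<Rightarrow> 5 * coeff (xp ^ n) k)" for l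
    by (cases l) (simp_all add: mult_pCons_left coeff_pCons)
  thus ?case using Suc by (auto simp: five_def split: nat.splits)
qed (simp add: one_pCons)

section \<open>Modules of polynomials with prescribed powers of 5\<close>

definition lat :: "(nat \<Rightarrow> nat) \<Rightarrow> int poly \<Rightarrow> bool" where
  "lat e p \<longleftrightarrow> coeff p 0 = 0 \<and> (\<forall>r\<ge>1. 5 ^ e r dvd coeff p r)"

text \<open>One degree more costs at most one factor 5. This makes \<open>lat e\<close> stable under
  multiplication by polynomials in 5 y and under division by 1 + 5 y.\<close>

definition slow :: "(nat \<Rightarrow> nat) \<Rightarrow> bool" where
  "slow e \<longleftrightarrow> (\<forall>r\<ge>1. e (Suc r) \<le> Suc (e r))"

lemma slow_add: "slow e \<Longrightarrow> r \<ge> 1 \<Longrightarrow> e (r + l) \<le> e r + l"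
proof (induction l)
  case (Suc l)
  have "e (Suc (r + l)) \<le> Suc (e (r + l))" using Suc.prems by (auto simp: slow_def)
  thus ?case using Suc by simp
qed simp

lemma lat_add: "lat e p \<Longrightarrow> lat e q \<Longrightarrow> lat e (p + q)"
  by (auto simp: lat_def)

lemma lat_mult:
  assumes "slow e" "five 0 p" "lat e q"
  shows   "lat e (p * q)"
  unfolding lat_def
proof (intro conjI allI impI)
  show "coeff (p * q) 0 = 0" using assms by (simp add: lat_def coeff_mult_0)
  fix r :: nat assume "r \<ge> 1"
  show "5 ^ e r dvd coeff (p * q) r"
    unfolding coeff_mult
  proof (rule dvd_sum)
    fix l assume l: "l \<in> {..r}"
    show "5 ^ e r dvd coeff p l * coeff q (r - l)"
    proof (cases "l = r")
      case False
      hence "1 \<le> r - l" using l by (simp add: Suc_le_eq)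
      from slow_add[OF assms(1) this, of l] have "e r \<le> l + e (r - l)" using l by simp
      hence "(5 :: int) ^ e r dvd 5 ^ l * 5 ^ e (r - l)" by (simp add: le_imp_power_dvd flip: power_add)
      also have "\<dots> dvd coeff p l * coeff q (r - l)"
        using assms(2,3) l False by (intro mult_dvd_mono) (auto simp: five_def lat_def)
      finally show ?thesis .
    qed (use assms(3) in \<open>simp add: lat_def\<close>)
  qed
qed

lemma coeff_xp_mult: "coeff (xp * q) 0 = coeff q 0" "coeff (xp * q) (Suc r) = coeff q (Suc r) + 5 * coeff q r"
  by (simp_all add: mult_pCons_left coeff_pCons)

text \<open>The coefficients are recovered upwards from q_(r+1) = (x q)_(r+1) - 5 q_r, where the
  factor 5 compensates the growth of e.\<close>

lemma lat_div:
  assumes "slow e" "lat e (xp * q)"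
  shows   "lat e q"
proof -
  have 0: "coeff q 0 = 0" using assms(2) by (simp add: lat_def coeff_xp_mult)
  have "5 ^ e (Suc r) dvd coeff q (Suc r)" for r
  proof (induction r)
    case 0
    have "5 ^ e (Suc 0) dvd coeff (xp * q) (Suc 0)" using assms(2) by (simp only: lat_def)
    thus ?case unfolding coeff_xp_mult using \<open>coeff q 0 = 0\<close> by simp
  next
    case (Suc r)
    have 1: "5 ^ e (Suc (Suc r)) dvd coeff (xp * q) (Suc (Suc r))" using assms(2) by (simp only: lat_def)
    have "e (Suc (Suc r)) \<le> Suc (e (Suc r))" using assms(1) by (simp add: slow_def)
    hence "(5 :: int) ^ e (Suc (Suc r)) dvd 5 * 5 ^ e (Suc r)" by (simp add: le_imp_power_dvd flip: power_Suc)
    also have "\<dots> dvd 5 * coeff q (Suc r)" using Suc by simp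
    finally show ?case using 1 unfolding coeff_xp_mult by (simp add: dvd_add_left_iff)
  qed
  thus ?thesis using 0 by (auto simp: lat_def Suc_le_eq gr0_conv_Suc)
qed

text \<open>The constant term of 1 + 5 y is 1, so a common divisor K of the coefficients of a
  product with it divides those of the cofactor, from the lowest one upwards.\<close>

lemma xp_power_smult:
  assumes "K > 0" "xp ^ k * h = smult K g"
  shows   "\<exists>h'. h = smult K h' \<and> xp ^ k * h' = g"
  using assms(2)
proof (induction k arbitrary: g)
  case (Suc k)
  have *: "xp * (xp ^ k * h) = smult K g" using Suc.prems by (simp only: power_Suc mult.assoc)
  have dvd: "K dvd coeff (xp ^ k * h) r" for r
  proof (induction r)
    case 0
    show ?case using arg_cong[OF *, of "\<lambda>p. coeff p 0"] unfolding coeff_xp_mult by simp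
  next
    case (Suc r)
    have "coeff (xp ^ k * h) (Suc r) = K * coeff g (Suc r) - 5 * coeff (xp ^ k * h) r"
      using arg_cong[OF *, of "\<lambda>p. coeff p (Suc r)"] unfolding coeff_xp_mult by simp
    thus ?case using Suc by simp
  qed
  then obtain g' where g': "xp ^ k * h = smult K g'"
    using const_poly_dvd_iff[of K "xp ^ k * h"] by (auto elim!: dvdE)
  from Suc.IH[OF this] obtain h' where h': "h = smult K h'" "xp ^ k * h' = g'" by blast
  have "smult K (xp * g') = smult K g" using * unfolding g' by simp
  hence "xp * g' = g" using assms(1) by (simp add: poly_eq_iff del: mult_pCons_left)
  thus ?case using h' by (intro exI[of _ h']) (simp only: power_Suc mult.assoc)
qed auto

lemma ev_sum: "ev (\<Sum>i\<in>A. f i) = (\<Sum>i\<in>A. ev (f i))"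
  by (induction A rule: infinite_finite_induct) (simp_all add: ev_0 ev_add)

lemma ev_monom: "ev (monom c n) = of_int c * qy ^ n"
  by (induction n) (simp_all add: monom_0 monom_Suc ev_pCons ev_0 mult_ac)

text \<open>The properties shared by \<open>U_one\<close> and \<open>U_zero\<close> from which the
  recurrences for powers of y and of 1/x follow.\<close>

locale linear_over_sub5 =
  fixes U :: "complex fls \<Rightarrow> complex fls"
  assumes U_add: "U (f + g) = U f + U g"
    and U_sub5: "U (sub5 f * g) = f * U g"
begin

lemma U_0 [simp]: "U 0 = 0"
  using U_add[of 0 0] by simp

lemma U_sum: "U (\<Sum>i\<in>A. f i) = (\<Sum>i\<in>A. U (f i))"
  by (induction A rule: infinite_finite_induct) (simp_all add: U_add)

lemma U_of_int_mult: "U (of_int c * f) = of_int c * U f"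
proof -
  have "sub5 (of_int c) = of_int c"
    by (metis fls_compose_power_const_left fls_of_int zero_less_numeral)
  thus ?thesis using U_sub5[of "of_int c" f] by simp
qed

lemma U_numeral_mult: "U (numeral k * f) = numeral k * U f"
  using U_of_int_mult[of "numeral k"] by simp

lemma U_diff: "U (f - g) = U f - U g"
  using U_add[of "f - g" g] by simp

text \<open>x(5 \<tau>)^5 leaves the operator as x^5, and the equation for x trades 1/x^(n+1) for
  x^k/x^n with k \<le> 4.\<close>

lemma U_recurrence: "xx ^ 5 * U (f / xx ^ Suc n) = (\<Sum>k<5. ev (x_coeff k) * U (f * xx ^ k / xx ^ n))"
proof -
  have "sub5 (xx ^ 5) * (f / xx ^ Suc n) = (\<Sum>k<5. sub5 (ev (x_coeff k)) * (f * xx ^ k / xx ^ n))"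
    unfolding xx_equation sum_distrib_right by (intro sum.cong refl) simp
  from arg_cong[OF this, of U] show ?thesis
    unfolding sum_lessThan_5 U_add U_sub5 .
qed

lemma U_induct_poly:
  assumes init: "\<And>n. n < 5 \<Longrightarrow> U (qy ^ Suc n) = ev (I ! n)"
  shows   "U (qy ^ Suc n) = ev (rec_poly I n)"
proof (induction n rule: rec_poly_induct)
  case (step n)
  have "qy ^ Suc (n + 5) = qy ^ Suc n * qy ^ 5" by (metis add_Suc power_add)
  also have "\<dots> = (\<Sum>j<5. sub5 (ev (mod_coeff j)) * qy ^ Suc (n + j))"
    unfolding qy_power_5 by (simp add: sum_distrib_left power_add mult_ac)
  finally have "U (qy ^ Suc (n + 5)) = (\<Sum>j<5. ev (mod_coeff j) * U (qy ^ Suc (n + j)))"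
    by (simp only: sum_lessThan_5 U_add U_sub5)
  also have "\<dots> = (\<Sum>j<5. ev (mod_coeff j) * ev (rec_poly I (n + j)))"
    by (intro sum.cong refl) (simp only: step lessThan_iff)
  also have "\<dots> = ev (rec_poly I (n + 5))"
    unfolding rec_poly_ge_5 sum_lessThan_5 ev_add ev_mult ..
  finally show ?case .
qed (simp only: init rec_poly_less_5)

lemma U_ev:
  assumes power: "\<And>n. U (qy ^ Suc n) = ev (P n)"
    and p: "coeff p 0 = 0" "degree p \<le> n"
  shows   "U (ev p) = ev (\<Sum>i=1..n. smult (coeff p i) (P (i - 1)))"
proof -
  have "p = (\<Sum>i\<le>n. monom (coeff p i) i)" using poly_as_sum_of_monoms'[OF p(2)] by simp
  also have "\<dots> = (\<Sum>i=1..n. monom (coeff p i) i)"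
    by (rule sum.mono_neutral_right) (use p(1) in \<open>auto simp: not_le\<close>)
  finally have "ev p = ev (\<Sum>i=1..n. monom (coeff p i) i)" by simp
  hence "U (ev p) = (\<Sum>i=1..n. of_int (coeff p i) * U (qy ^ i))"
    by (simp add: ev_sum ev_monom U_sum U_of_int_mult)
  also have "\<dots> = (\<Sum>i=1..n. ev (smult (coeff p i) (P (i - 1))))"
  proof (intro sum.cong refl)
    fix i assume "i \<in> {1..n}"
    then obtain j where "i = Suc j" by (cases i) auto
    thus "of_int (coeff p i) * U (qy ^ i) = ev (smult (coeff p i) (P (i - 1)))"
      by (simp only: power ev_smult diff_Suc_1)
  qed
  finally show ?thesis by (simp add: ev_sum)
qed

text \<open>The recurrence for n = 0 involves y x^k with k \<le> 4, hence only y, ..., y^5. In the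
  result a factor x^\<kappa> splits off with quotient \<open>H\<close>, and \<kappa> is the saving
  in the denominator.\<close>

lemma U_qy_divide_xx:
  assumes power: "\<And>n. U (qy ^ Suc n) = ev (P n)" and "\<kappa> \<le> 5"
    and H: "x_coeff 0 * P 0 + x_coeff 1 * (P 0 + smult 5 (P 1))
      + x_coeff 2 * (P 0 + smult 10 (P 1) + smult 25 (P 2))
      + x_coeff 3 * (P 0 + smult 15 (P 1) + smult 75 (P 2) + smult 125 (P 3))
      + x_coeff 4 * (P 0 + smult 20 (P 1) + smult 150 (P 2) + smult 500 (P 3) + smult 625 (P 4)) = xp ^ \<kappa> * H"
  shows   "U (qy / xx) * xx ^ (5 - \<kappa>) = ev H"
proof -
  have U: "U qy = ev (P 0)" "U (qy ^ 2) = ev (P 1)" "U (qy ^ 3) = ev (P 2)" "U (qy ^ 4) = ev (P 3)" "U (qy ^ 5) = ev (P 4)"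
    using power[of 0] power[of 1] power[of 2] power[of 3] power[of 4] by (simp_all add: numeral_eq_Suc)
  have "qy * xx = qy + 5 * qy ^ 2"
    "qy * xx ^ 2 = qy + 10 * qy ^ 2 + 25 * qy ^ 3"
    "qy * xx ^ 3 = qy + 15 * qy ^ 2 + 75 * qy ^ 3 + 125 * qy ^ 4"
    "qy * xx ^ 4 = qy + 20 * qy ^ 2 + 150 * qy ^ 3 + 500 * qy ^ 4 + 625 * qy ^ 5"
    unfolding xx_def by algebra+
  hence "xx ^ 5 * U (qy / xx) =
     ev (x_coeff 0) * U qy
     + ev (x_coeff 1) * (U qy + 5 * U (qy ^ 2))
     + ev (x_coeff 2) * (U qy + 10 * U (qy ^ 2) + 25 * U (qy ^ 3))
     + ev (x_coeff 3) * (U qy + 15 * U (qy ^ 2) + 75 * U (qy ^ 3) + 125 * U (qy ^ 4))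
     + ev (x_coeff 4) * (U qy + 20 * U (qy ^ 2) + 150 * U (qy ^ 3) + 500 * U (qy ^ 4) + 625 * U (qy ^ 5))"
    using U_recurrence[of qy 0] by (simp add: sum_lessThan_5 U_add U_numeral_mult)
  also have "\<dots> = ev (xp ^ \<kappa> * H)"
    unfolding H [symmetric] by (simp only: U ev_add ev_mult ev_smult of_int_numeral)
  finally have "xx ^ 5 * U (qy / xx) = xx ^ \<kappa> * ev H" by (simp only: ev_mult ev_power ev_xp)
  moreover have "xx ^ 5 = xx ^ \<kappa> * xx ^ (5 - \<kappa>)" using assms(2) by (simp flip: power_add)
  ultimately have "xx ^ \<kappa> * (U (qy / xx) * xx ^ (5 - \<kappa>)) = xx ^ \<kappa> * ev H"
    by (simp only: mult.left_commute mult.commute)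
  thus ?thesis by simp
qed

end

text \<open>\<open>S\<close> collects the admissible numerators and \<open>R\<close> those of the
  images. Stability of \<open>S\<close> under multiplication by x, and of \<open>R\<close> under
  sums, polynomials in 5 y and division by x, carries \<open>S_R\<close> over to all powers of x in
  the denominator.\<close>

locale five_operator = linear_over_sub5 U
  for U :: "complex fls \<Rightarrow> complex fls" +
  fixes P :: "nat \<Rightarrow> int poly" and H :: "int poly" and \<kappa> :: nat
    and S R :: "int poly \<Rightarrow> bool"
  assumes U_power: "U (qy ^ Suc m) = ev (P m)"
    and kappa: "\<kappa> \<le> 5"
    and U_base: "U (qy / xx) * xx ^ (5 - \<kappa>) = ev H"
    and S_0: "S p \<Longrightarrow> coeff p 0 = 0"
    and S_x: "S p \<Longrightarrow> S (xp * p)"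
    and S_R: "S p \<Longrightarrow> \<exists>q. R q \<and> U (ev p) = ev q"
    and R_add: "R p \<Longrightarrow> R q \<Longrightarrow> R (p + q)"
    and R_mult: "five 0 a \<Longrightarrow> R p \<Longrightarrow> R (a * p)"
    and R_div: "R (xp * p) \<Longrightarrow> R p"
begin

lemma S_x_power: "S p \<Longrightarrow> S (xp ^ k * p)"
  by (induction k) (auto simp: mult.assoc intro: S_x simp del: mult_pCons_left)

lemma R_div_power: "R (xp ^ k * p) \<Longrightarrow> R p"
  by (induction k) (auto simp: mult.assoc intro: R_div simp del: mult_pCons_left)

text \<open>
  Rational denominators \<open>K\<close> are harmless: the recurrence gives \<open>(1 + 5 y)\<^sup>\<kappa>\<close> times the same
  polynomial with integer coefficients, and \<open>1 + 5 y\<close> is primitive.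
\<close>

lemma shape_power: "\<exists>K>0. \<exists>h. of_int K * (U (qy ^ Suc m / xx) * xx ^ (5 - \<kappa>)) = ev h"
proof (induction m)
  case 0
  show ?case by (rule exI[of _ 1]) (use U_base in auto)
next
  case (Suc m)
  then obtain K h where K: "K > 0" "of_int K * (U (qy ^ Suc m / xx) * xx ^ (5 - \<kappa>)) = ev h" by blast
  \<comment> \<open>5 y / x = 1 - 1/x trades one power of y for a factor 5 in K.\<close>
  have "5 * qy = xx - 1" by (simp add: xx_def)
  moreover have "of_int 5 * (qy ^ Suc (Suc m) / xx) = 5 * qy * qy ^ Suc m / xx" by simp
  ultimately have "of_int 5 * (qy ^ Suc (Suc m) / xx) = qy ^ Suc m - qy ^ Suc m / xx"
    by (simp add: left_diff_distrib diff_divide_distrib)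
  from arg_cong[OF this, of U] have "5 * U (qy ^ Suc (Suc m) / xx) = ev (P m) - U (qy ^ Suc m / xx)"
    unfolding U_of_int_mult U_diff U_power by simp
  moreover have "of_int (5 * K) * (U (qy ^ Suc (Suc m) / xx) * xx ^ (5 - \<kappa>)) =
      of_int K * (5 * U (qy ^ Suc (Suc m) / xx)) * xx ^ (5 - \<kappa>)"
    by (simp add: mult_ac)
  ultimately have "of_int (5 * K) * (U (qy ^ Suc (Suc m) / xx) * xx ^ (5 - \<kappa>)) =
      of_int K * ev (P m) * xx ^ (5 - \<kappa>) - of_int K * (U (qy ^ Suc m / xx) * xx ^ (5 - \<kappa>))"
    by (simp only: left_diff_distrib right_diff_distrib mult.assoc)
  also have "\<dots> = ev (smult K (P m) * xp ^ (5 - \<kappa>) - h)"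
    unfolding K(2) by (simp only: ev_diff ev_mult ev_smult ev_power ev_xp)
  finally show ?case using K(1) by (intro exI[of _ "5 * K"]) auto
qed

lemma shape_poly: "\<exists>K>0. \<exists>h. of_int K * (U (qy ^ Suc m * ev p / xx) * xx ^ (5 - \<kappa>)) = ev h"
proof (induction p arbitrary: m)
  case 0
  have "U 0 = 0" using U_add[of 0 0] by simp
  thus ?case by (intro exI[of _ 1]) (auto simp: ev_0 intro: exI[of _ 0])
next
  case (pCons c p)
  obtain K h where K: "K > 0" "of_int K * (U (qy ^ Suc m / xx) * xx ^ (5 - \<kappa>)) = ev h"
    using shape_power by blast
  obtain K' h' where K': "K' > 0" "of_int K' * (U (qy ^ Suc (Suc m) * ev p / xx) * xx ^ (5 - \<kappa>)) = ev h'"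
    using pCons.IH by blast
  have "qy ^ Suc m * ev (pCons c p) / xx = of_int c * (qy ^ Suc m / xx) + qy ^ Suc (Suc m) * ev p / xx"
    by (simp add: ev_pCons distrib_left add_divide_distrib mult_ac)
  hence "U (qy ^ Suc m * ev (pCons c p) / xx) = of_int c * U (qy ^ Suc m / xx) + U (qy ^ Suc (Suc m) * ev p / xx)"
    by (simp only: U_add U_of_int_mult)
  hence "of_int (K * K') * (U (qy ^ Suc m * ev (pCons c p) / xx) * xx ^ (5 - \<kappa>)) =
      of_int (K' * c) * (of_int K * (U (qy ^ Suc m / xx) * xx ^ (5 - \<kappa>))) +
      of_int K * (of_int K' * (U (qy ^ Suc (Suc m) * ev p / xx) * xx ^ (5 - \<kappa>)))"
    by (simp add: algebra_simps)
  also have "\<dots> = ev (smult (K' * c) h + smult K h')"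
    unfolding K(2) K'(2) by (simp only: ev_add ev_smult)
  finally show ?case using K(1) K'(1) by (intro exI[of _ "K * K'"]) auto
qed

lemma sum_in_R: "(\<And>k. k < 5 \<Longrightarrow> R (f k)) \<Longrightarrow> R (\<Sum>k<5. x_coeff k * f k)"
  unfolding sum_lessThan_5 by (intro R_add R_mult five_x_coeff) auto

text \<open>The recurrence places x^5 U(p/x) in \<open>R\<close>, while \<open>shape_poly\<close>
  shows that it is divisible by x^\<kappa>; as \<open>R\<close> is stable under division by x, the
  quotient stays in \<open>R\<close>.\<close>

lemma U_ev_divide_xx:
  assumes "S p"
  shows   "\<exists>q. R q \<and> U (ev p / xx) = ev q / xx ^ (5 - \<kappa>)"
proof -
  have "\<exists>q. R q \<and> U (ev p * xx ^ k) = ev q" for k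
    using S_R[OF S_x_power[OF assms, of k]] by (simp only: ev_mult ev_power ev_xp mult.commute)
  then obtain q where q: "\<And>k. R (q k)" "\<And>k. U (ev p * xx ^ k) = ev (q k)" by metis
  define g where "g = (\<Sum>k<5. x_coeff k * q k)"
  have "R g" unfolding g_def by (rule sum_in_R) (rule q(1))
  have g: "xx ^ 5 * U (ev p / xx) = ev g"
    using U_recurrence[of "ev p" 0] unfolding g_def
    by (simp add: q(2) sum_lessThan_5 ev_add ev_mult)
  obtain p' where p: "p = pCons 0 p'" using S_0[OF assms] by (cases p) simp
  obtain K h where K: "K > 0" "of_int K * (U (qy ^ Suc 0 * ev p' / xx) * xx ^ (5 - \<kappa>)) = ev h"
    using shape_poly by blast
  hence h: "of_int K * (U (ev p / xx) * xx ^ (5 - \<kappa>)) = ev h" by (simp add: p ev_pCons)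
  have "xx ^ 5 = xx ^ \<kappa> * xx ^ (5 - \<kappa>)" using kappa by (simp flip: power_add)
  hence "ev (xp ^ \<kappa> * h) = ev (smult K g)"
    unfolding ev_mult ev_smult g [symmetric] h [symmetric] ev_power ev_xp by (simp add: mult_ac)
  hence "xp ^ \<kappa> * h = smult K g" unfolding ev_eq_iff .
  from xp_power_smult[OF K(1) this] obtain h' where h': "h = smult K h'" "xp ^ \<kappa> * h' = g" by blast
  have "R h'" using R_div_power[of \<kappa> h'] \<open>R g\<close> h'(2) by simp
  moreover have "of_int K * (U (ev p / xx) * xx ^ (5 - \<kappa>)) = of_int K * ev h'"
    unfolding h h'(1) ev_smult ..
  hence "U (ev p / xx) * xx ^ (5 - \<kappa>) = ev h'" using K(1) by simp
  hence "U (ev p / xx) = ev h' / xx ^ (5 - \<kappa>)" by (simp add: eq_divide_eq)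
  ultimately show ?thesis by blast
qed

text \<open>The recurrence reduces n to the exponents n - 1 - k, which are covered by the induction
  or leave a polynomial. Smaller denominators are filled up with powers of x, which keeps the
  numerators in \<open>R\<close>.\<close>

lemma U_ev_divide_xx_power:
  assumes "n \<ge> 1" "S p"
  shows   "\<exists>q. R q \<and> U (ev p / xx ^ n) = ev q / xx ^ (5 * n - \<kappa>)"
  using assms
proof (induction n arbitrary: p rule: less_induct)
  case (less n)
  show ?case
  proof (cases "n = 1")
    case True
    thus ?thesis using U_ev_divide_xx[OF less.prems(2)] by simp
  next
    case False
    then obtain m where m: "n = Suc m" "m \<ge> 1" using less.prems by (cases n) auto
    have "\<exists>q. R q \<and> U (ev p * xx ^ k / xx ^ m) * xx ^ (5 * n - \<kappa>) = xx ^ 5 * ev q" if "k < 5" for k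
    proof (cases "k < m")
      case True
      have e: "ev p * xx ^ k / xx ^ m = ev p / xx ^ (m - k)"
        using True by (simp add: power_diff)
      obtain q where q: "R q" "U (ev p / xx ^ (m - k)) = ev q / xx ^ (5 * (m - k) - \<kappa>)"
      proof -
        have "m - k < n" "1 \<le> m - k" using m True by simp_all
        from less.IH[OF this less.prems(2)] that show ?thesis by blast
      qed
      have "5 * n - \<kappa> = (5 * (m - k) - \<kappa>) + 5 + 5 * k" using m True kappa by simp
      hence "U (ev p * xx ^ k / xx ^ m) * xx ^ (5 * n - \<kappa>) = xx ^ 5 * ev (xp ^ (5 * k) * q)"
        unfolding e q(2) by (simp add: power_add ev_mult ev_power)
      thus ?thesis using R_mult[OF five_xp_power q(1)] by blast
    next
      case False
      have e: "ev p * xx ^ k / xx ^ m = ev (xp ^ (k - m) * p)"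
      proof -
        have "xx ^ k = xx ^ m * xx ^ (k - m)" using False by (simp flip: power_add)
        thus ?thesis by (simp add: ev_mult ev_power)
      qed
      obtain q where q: "R q" "U (ev (xp ^ (k - m) * p)) = ev q"
        using S_R[OF S_x_power[OF less.prems(2)]] by blast
      \<comment> \<open>Here n \<ge> 2, so 5 n - \<kappa> \<ge> 5 and x^5 splits off. For n = 1 and
        \<kappa> > 0 this fails, so that case rests on the explicit value of U(y/x).\<close>
      have "5 * n - \<kappa> = 5 + (5 * n - \<kappa> - 5)" using m kappa by simp
      hence "xx ^ (5 * n - \<kappa>) = xx ^ 5 * xx ^ (5 * n - \<kappa> - 5)" by (metis power_add)
      hence "U (ev p * xx ^ k / xx ^ m) * xx ^ (5 * n - \<kappa>) = xx ^ 5 * ev (xp ^ (5 * n - \<kappa> - 5) * q)"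
        unfolding e q(2) by (simp add: ev_mult ev_power)
      thus ?thesis using R_mult[OF five_xp_power q(1)] by blast
    qed
    then obtain q where q: "\<And>k. k < 5 \<Longrightarrow> R (q k)"
      "\<And>k. k < 5 \<Longrightarrow> U (ev p * xx ^ k / xx ^ m) * xx ^ (5 * n - \<kappa>) = xx ^ 5 * ev (q k)" by metis
    have "xx ^ 5 * (U (ev p / xx ^ n) * xx ^ (5 * n - \<kappa>)) =
        (\<Sum>k<5. ev (x_coeff k) * (U (ev p * xx ^ k / xx ^ m) * xx ^ (5 * n - \<kappa>)))"
      unfolding m(1) mult.assoc [symmetric] U_recurrence sum_distrib_right ..
    also have "\<dots> = (\<Sum>k<5. ev (x_coeff k) * (xx ^ 5 * ev (q k)))"
      by (intro sum.cong refl) (simp add: q(2))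
    also have "\<dots> = xx ^ 5 * ev (\<Sum>k<5. x_coeff k * q k)"
      by (simp add: sum_lessThan_5 ev_add ev_mult algebra_simps)
    finally have "U (ev p / xx ^ n) = ev (\<Sum>k<5. x_coeff k * q k) / xx ^ (5 * n - \<kappa>)"
      by (simp add: eq_divide_eq)
    thus ?thesis using sum_in_R[of q] q(1) by blast
  qed
qed

end

lemma U_zero_add: "U_zero (f + g) = U_zero f + U_zero g"
  by (simp add: U_zero_eq distrib_left U_one_add)

lemma U_zero_sub5_mult: "U_zero (sub5 f * g) = f * U_zero g"
  using U_one_sub5_mult[of f "qZ * g"] by (simp add: U_zero_eq mult_ac)

interpretation U_one: linear_over_sub5 U_one
  by standard (rule U_one_add U_one_sub5_mult)+

interpretation U_zero: linear_over_sub5 U_zero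
  by standard (rule U_zero_add U_zero_sub5_mult)+

lemma U_one_init: "n < 5 \<Longrightarrow> U_one (qy ^ Suc n) = ev (init_one ! n)"
  unfolding less_5_cases
  by (elim disjE; hypsubst) (use U_one_qy in \<open>simp_all only: Suc_eq_plus1 add_0 one_add_one numeral_plus_one arith_simps\<close>)

lemma U_zero_init: "n < 5 \<Longrightarrow> U_zero (qy ^ Suc n) = ev (init_zero ! n)"
  unfolding less_5_cases
  by (elim disjE; hypsubst) (use U_zero_qy in \<open>simp_all only: Suc_eq_plus1 add_0 one_add_one numeral_plus_one arith_simps\<close>)

lemmas U_one_rec = U_one.U_induct_poly[of init_one, OF U_one_init]
lemmas U_zero_rec = U_zero.U_induct_poly[of init_zero, OF U_zero_init]

section \<open>The exponents \<theta> and \<phi>\<close>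

lemma theta_phi_int:
  assumes "m \<ge> 1"
  shows   "\<theta> m = (5 * m - 5) div 6 - (if m \<le> 2 then 0 else 1)" "\<phi> m = (5 * m - 5) div 6 - (if m \<le> 3 then 0 else 1)"
proof -
  have "\<lfloor>(5 * real_of_int m - 5) / 6\<rfloor> = (5 * m - 5) div 6"
    using floor_divide_of_int_eq[of "5 * m - 5" 6, where ?'a = real] by simp
  thus "\<theta> m = (5 * m - 5) div 6 - (if m \<le> 2 then 0 else 1)" "\<phi> m = (5 * m - 5) div 6 - (if m \<le> 3 then 0 else 1)"
    by (simp_all add: \<theta>_def \<phi>_def)
qed

lemma theta_phi_nonneg: "m \<ge> 1 \<Longrightarrow> \<theta> m \<ge> 0" "m \<ge> 1 \<Longrightarrow> \<phi> m \<ge> 0"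
  by (auto simp: theta_phi_int)

definition th :: "nat \<Rightarrow> nat" where "th r = nat (\<theta> (int r))"
definition ph :: "nat \<Rightarrow> nat" where "ph r = nat (\<phi> (int r))"

lemma th_ph_int: "r \<ge> 1 \<Longrightarrow> int (th r) = (5 * int r - 5) div 6 - (if r \<le> 2 then 0 else 1)"
  "r \<ge> 1 \<Longrightarrow> int (ph r) = (5 * int r - 5) div 6 - (if r \<le> 3 then 0 else 1)"
  using theta_phi_nonneg[of "int r"] by (simp_all add: th_def ph_def theta_phi_int)

lemma th_ph_small: "th 1 = 0" "th 2 = 0" "th 3 = 0" "ph 1 = 0" "ph 2 = 0" "ph 3 = 1" "ph 4 = 1"
  by (simp_all add: th_def ph_def theta_phi_int)

lemma slow_th: "slow th" and slow_ph: "slow ph"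
  unfolding slow_def
proof (safe)
  fix r :: nat assume "r \<ge> 1"
  hence "int (th (Suc r)) \<le> int (th r) + 1" "int (ph (Suc r)) \<le> int (ph r) + 1"
    unfolding th_ph_int[OF \<open>r \<ge> 1\<close>] by (subst th_ph_int, simp, simp, linarith)+
  thus "th (Suc r) \<le> Suc (th r)" "ph (Suc r) \<le> Suc (ph r)" by simp_all
qed

lemma slow_Suc: "slow e \<Longrightarrow> slow (\<lambda>r. Suc (e r))"
  by (simp add: slow_def)

text \<open>The numerators in W^(1): \<theta> vanishes at 1, 2, 3, so the congruence for s is one
  for the coefficients themselves.\<close>

definition S_one :: "int poly \<Rightarrow> bool" where
  "S_one p \<longleftrightarrow> lat th p \<and> 5 dvd coeff p 1 + coeff p 2 + coeff p 3"

text \<open>Five times the numerators in W^(1); with the factor 5 still present, the congruence is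
  modulo 25.\<close>

definition R_zero :: "int poly \<Rightarrow> bool" where
  "R_zero p \<longleftrightarrow> lat (\<lambda>r. Suc (th r)) p \<and> 25 dvd coeff p 1 + coeff p 2 + coeff p 3"

lemma power_5_dvd_mult:
  fixes a b :: int
  assumes "5 ^ k dvd a" "5 ^ l dvd b" "n \<le> k + l"
  shows   "5 ^ n dvd a * b"
proof -
  have "(5 :: int) ^ n dvd 5 ^ k * 5 ^ l" using assms(3) by (simp add: le_imp_power_dvd flip: power_add)
  also have "\<dots> dvd a * b" using assms(1,2) by (rule mult_dvd_mono)
  finally show ?thesis .
qed

lemma sum_split_3:
  fixes n :: nat and f :: "nat \<Rightarrow> int"
  shows "n \<ge> 3 \<Longrightarrow> (\<Sum>i=1..n. f i) = f 1 + f 2 + f 3 + (\<Sum>i=4..n. f i)"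
  by (simp add: sum.atLeast_Suc_atMost numeral_eq_Suc)

lemma sum_split_4:
  fixes n :: nat and f :: "nat \<Rightarrow> int"
  shows "n \<ge> 4 \<Longrightarrow> (\<Sum>i=1..n. f i) = f 1 + f 2 + f 3 + f 4 + (\<Sum>i=5..n. f i)"
  by (simp add: sum.atLeast_Suc_atMost numeral_eq_Suc)

text \<open>For i \<ge> 4 the bound \<theta>(i) + floor((5r - i + 1)/6) suffices in every degree r,
  for i = 2, 3 from r = 2 on, and U^(1)(y) = y has no terms there. In degree r = 1 the congruence
  supplies the missing factor 5.\<close>

lemma U_one_S_one:
  assumes "S_one p"
  shows   "\<exists>q. lat (\<lambda>r. Suc (ph r)) q \<and> U_one (ev p) = ev q"
proof -
  define n where "n = max 3 (degree p)"
  define P where "P = rec_poly init_one"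
  define q where "q = (\<Sum>i=1..n. smult (coeff p i) (P (i - 1)))"
  have lat: "coeff p 0 = 0" "\<And>r. r \<ge> 1 \<Longrightarrow> 5 ^ th r dvd coeff p r"
    and sum: "5 dvd coeff p 1 + coeff p 2 + coeff p 3"
    using assms by (auto simp: S_one_def lat_def)
  have q: "coeff q r = (\<Sum>i=1..n. coeff p i * coeff (P (i - 1)) r)" for r
    by (simp add: q_def coeff_sum)
  have P: "5 ^ nat ((5 * int r - int m) div 6) dvd coeff (P m) r" for m r
    using div_bound_one[of m] by (simp add: div_bound_def P_def)
  have n: "n \<ge> 3" by (simp add: n_def)
  have "5 ^ Suc (ph r) dvd coeff q r" if r: "r \<ge> 1" for r
  proof -
    have "5 ^ Suc (ph r) dvd coeff p i * coeff (P (i - 1)) r" if "i \<in> {4..n}" for i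
    proof (rule power_5_dvd_mult[OF lat(2) P])
      have i: "1 \<le> i" "\<not> i \<le> 2" using that by auto
      have "int (Suc (ph r)) \<le> int (th i + nat ((5 * int r - int (i - 1)) div 6))"
        unfolding of_nat_Suc of_nat_add th_ph_int(1)[OF i(1)] th_ph_int(2)[OF r] int_nat_eq
        using that r by (auto simp: of_nat_diff; linarith)
      thus "Suc (ph r) \<le> th i + nat ((5 * int r - int (i - 1)) div 6)" by linarith
    qed (use that in auto)
    hence tail: "5 ^ Suc (ph r) dvd (\<Sum>i=4..n. coeff p i * coeff (P (i - 1)) r)"
      by (rule dvd_sum)
    have "5 ^ Suc (ph r) dvd coeff p 1 * coeff (P 0) r + coeff p 2 * coeff (P 1) r + coeff p 3 * coeff (P 2) r"
    proof (cases "r = 1")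
      case True
      have "coeff (P 0) 1 = 1" "coeff (P 1) 1 = 51" "coeff (P 2) 1 = 41"
        by (simp_all add: P_def rec_poly_less_5 init_one_def)
      moreover have "coeff p 1 + coeff p 2 * 51 + coeff p 3 * 41 =
          (coeff p 1 + coeff p 2 + coeff p 3) + 5 * (coeff p 2 * 10 + coeff p 3 * 8)" by simp
      hence "5 dvd coeff p 1 + coeff p 2 * 51 + coeff p 3 * 41" using sum by (metis dvd_add dvd_triv_left)
      ultimately show ?thesis by (simp add: True th_ph_small[unfolded One_nat_def])
    next
      case False
      have 0: "coeff (P 0) r = 0"
        using r False by (cases r; cases "r - 1") (auto simp: P_def rec_poly_less_5 init_one_def)
      have "2 \<le> r" using r False by simp
      have "5 ^ Suc (ph r) dvd coeff (P m) r" if m: "int m = 1 \<or> int m = 2" for m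
      proof (rule power_le_dvd[OF P])
        have "int (Suc (ph r)) \<le> (5 * int r - int m) div 6"
        proof (cases "r \<le> 3")
          case True
          hence "r = 2 \<or> r = 3" using \<open>2 \<le> r\<close> by linarith
          thus ?thesis using m unfolding of_nat_Suc th_ph_int(2)[OF r] by auto
        next
          case False
          have "(5 * int r - 5) div 6 \<le> (5 * int r - int m) div 6" by (rule zdiv_mono1) (use m in auto)
          thus ?thesis using False unfolding of_nat_Suc th_ph_int(2)[OF r] by simp
        qed
        thus "Suc (ph r) \<le> nat ((5 * int r - int m) div 6)" by linarith
      qed
      thus ?thesis unfolding 0 by (intro dvd_add dvd_mult) auto
    qed
    thus ?thesis using tail unfolding q sum_split_3[OF n] by simp
  qed
  moreover have "coeff q 0 = 0" unfolding q P_def by (simp add: coeff_0_one_zero)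
  ultimately have "lat (\<lambda>r. Suc (ph r)) q" by (simp add: lat_def)
  moreover have "U_one (ev p) = ev q"
    unfolding q_def P_def
    by (rule U_one.U_ev) (use lat(1) in \<open>simp_all add: U_one_rec n_def del: power_Suc\<close>)
  ultimately show ?thesis by blast
qed

text \<open>The general bound covers i \<ge> 5, and i \<ge> 2 once r \<ge> 3. As U^(0)(y) = 5 y + 20
  y^2, the degrees 1 and 2 of the first four images remain, and there the coefficient of the image
  or that of p is divisible by 5.\<close>

lemma U_zero_lat_ph:
  assumes "lat ph p"
  shows   "\<exists>q. R_zero q \<and> U_zero (ev p) = ev q"
proof -
  define n where "n = max 4 (degree p)"
  define P where "P = rec_poly init_zero"
  define q where "q = (\<Sum>i=1..n. smult (coeff p i) (P (i - 1)))"
  have lat: "coeff p 0 = 0" "\<And>r. r \<ge> 1 \<Longrightarrow> 5 ^ ph r dvd coeff p r"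
    using assms by (auto simp: lat_def)
  have q: "coeff q r = (\<Sum>i=1..n. coeff p i * coeff (P (i - 1)) r)" for r
    by (simp add: q_def coeff_sum)
  have P: "5 ^ nat ((5 * int r - 3 - int m) div 6) dvd coeff (P m) r" for m r
    using div_bound_zero[of m] by (simp add: div_bound_def P_def algebra_simps)
  have n: "n \<ge> 4" by (simp add: n_def)
  have P_values: "coeff (P 0) 1 = 5" "coeff (P 0) 2 = 20" "coeff (P 0) 3 = 0"
    "coeff (P 1) 1 = 5" "coeff (P 1) 2 = 765" "coeff (P 1) 3 = 19780"
    "coeff (P 2) 1 = 1" "coeff (P 2) 2 = 1874" "coeff (P 2) 3 = 200505"
    "coeff (P 3) 1 = 0" "coeff (P 3) 2 = 1645" "coeff (P 3) 3 = 584630"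
    by (simp_all add: P_def rec_poly_less_5 init_zero_def numeral_eq_Suc)
  have p34: "5 dvd coeff p 3" "5 dvd coeff p 4" using lat(2)[of 3] lat(2)[of 4] by (simp_all add: th_ph_small)
  have "5 ^ Suc (th r) dvd coeff q r" if r: "r \<ge> 1" for r
  proof -
    have gen: "5 ^ Suc (th r) dvd coeff p i * coeff (P (i - 1)) r"
      if "i \<ge> 1" "r \<ge> 3 \<and> i \<ge> 2 \<or> i \<ge> 5" for i
    proof (rule power_5_dvd_mult[OF lat(2) P])
      have "int (Suc (th r)) \<le> int (ph i + nat ((5 * int r - 3 - int (i - 1)) div 6))"
        unfolding of_nat_Suc of_nat_add th_ph_int(2)[OF that(1)] th_ph_int(1)[OF r] int_nat_eq
        using that r by (auto simp: of_nat_diff; linarith)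
      thus "Suc (th r) \<le> ph i + nat ((5 * int r - 3 - int (i - 1)) div 6)" by linarith
    qed (use that in auto)
    have tail: "5 ^ Suc (th r) dvd (\<Sum>i=5..n. coeff p i * coeff (P (i - 1)) r)"
      by (rule dvd_sum, rule gen) auto
    have "5 ^ Suc (th r) dvd coeff p 1 * coeff (P 0) r + coeff p 2 * coeff (P 1) r + coeff p 3 * coeff (P 2) r + coeff p 4 * coeff (P 3) r"
    proof (cases "r \<ge> 3")
      case True
      have 0: "coeff (P 0) r = 0"
        using True by (intro coeff_eq_0) (simp add: P_def rec_poly_less_5 init_zero_def)
      show ?thesis unfolding 0 using gen[of 2] gen[of 3] gen[of 4] True
        by (intro dvd_add) simp_all
    next
      case False
      hence "r = 1 \<or> r = 2" using r by auto
      thus ?thesis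
      proof
        assume "r = 1"
        have "5 dvd coeff p 1 * 5 + coeff p 2 * 5 + coeff p 3 * 1 + coeff p 4 * 0"
          using p34 by (intro dvd_add) simp_all
        thus ?thesis unfolding \<open>r = 1\<close> P_values th_ph_small by simp
      next
        assume "r = 2"
        have "5 dvd coeff p 1 * 20 + coeff p 2 * 765 + coeff p 3 * 1874 + coeff p 4 * 1645"
          using p34 by (intro dvd_add dvd_mult dvd_mult2) simp_all
        thus ?thesis unfolding \<open>r = 2\<close> P_values th_ph_small by simp
      qed
    qed
    thus ?thesis using tail unfolding q sum_split_4[OF n] by simp
  qed
  moreover have "coeff q 0 = 0" unfolding q P_def by (simp add: coeff_0_one_zero)
  ultimately have "lat (\<lambda>r. Suc (th r)) q" by (simp add: lat_def)
  moreover have "25 dvd coeff q 1 + coeff q 2 + coeff q 3"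
  proof -
    obtain a b where ab: "coeff p 3 = 5 * a" "coeff p 4 = 5 * b" using p34 by (auto elim!: dvdE)
    define T where "T = (\<Sum>i=5..n. coeff p i * (coeff (P (i - 1)) 1 + coeff (P (i - 1)) 2 + coeff (P (i - 1)) 3))"
    have "25 dvd T"
      unfolding T_def
    proof (rule dvd_sum)
      fix i assume i: "i \<in> {5..n}"
      hence "i \<ge> 1" by simp
      have "int 2 \<le> int (ph i)" unfolding th_ph_int(2)[OF \<open>i \<ge> 1\<close>] using i by (auto; linarith)
      hence "(5 :: int) ^ 2 dvd 5 ^ ph i" by (intro le_imp_power_dvd) linarith
      also have "\<dots> dvd coeff p i" using lat(2) \<open>i \<ge> 1\<close> by blast
      finally show "25 dvd coeff p i * (coeff (P (i - 1)) 1 + coeff (P (i - 1)) 2 + coeff (P (i - 1)) 3)" by simp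
    qed
    \<comment> \<open>The coefficients of y, y^2, y^3 in the first four images add up to 25, 25 *
      822, 5 * 40476 and 5 * 117255; the last two are multiplied by 5 a and 5 b.\<close>
    moreover have "coeff q 1 + coeff q 2 + coeff q 3 =
        25 * (coeff p 1 + 822 * coeff p 2 + 40476 * a + 117255 * b) + T"
      unfolding q sum_split_4[OF n] T_def distrib_left sum.distrib
      by (simp add: P_values[unfolded One_nat_def] ab algebra_simps)
    ultimately show ?thesis by simp
  qed
  ultimately have "R_zero q" by (simp add: R_zero_def)
  moreover have "U_zero (ev p) = ev q"
    unfolding q_def P_def
    by (rule U_zero.U_ev) (use lat(1) in \<open>simp_all add: U_zero_rec n_def del: power_Suc\<close>)
  ultimately show ?thesis by blast
qed

text \<open>The factor x^4 that splits off here, and x^2 for \<open>U_zero\<close>, account for the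
  exponents 5n - 4 and 5n - 2.\<close>

lemma U_one_base: "U_one (qy / xx) * xx ^ (5 - 4) = ev [:0, 21, 80:]"
  by (rule U_one.U_qy_divide_xx[OF U_one_rec]) (simp_all add: x_coeff_def rec_poly_less_5 init_one_def power_numeral_reduce)

lemma U_zero_base: "U_zero (qy / xx) * xx ^ (5 - 2) = ev [:0, 5, -5, -225, -500:]"
  by (rule U_zero.U_qy_divide_xx[OF U_zero_rec]) (simp_all add: x_coeff_def rec_poly_less_5 init_zero_def power_numeral_reduce)

lemma coeff_xp_mult_1_2_3: "coeff (xp * q) 1 = coeff q 1 + 5 * coeff q 0"
  "coeff (xp * q) 2 = coeff q 2 + 5 * coeff q 1" "coeff (xp * q) 3 = coeff q 3 + 5 * coeff q 2"
  using coeff_xp_mult(2)[of q 0] coeff_xp_mult(2)[of q 1] coeff_xp_mult(2)[of q 2]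
  by (simp_all add: numeral_eq_Suc)

lemma five_xp: "five 0 xp"
  using five_xp_power[of 1] by simp

lemma S_one_xp_mult:
  assumes "S_one p"
  shows   "S_one (xp * p)"
proof -
  have "coeff p 0 = 0" "5 dvd coeff p 1 + coeff p 2 + coeff p 3" using assms by (auto simp: S_one_def lat_def)
  moreover have "coeff (xp * p) 1 + coeff (xp * p) 2 + coeff (xp * p) 3 =
      coeff p 1 + coeff p 2 + coeff p 3 + 5 * (coeff p 0 + coeff p 1 + coeff p 2)"
    unfolding coeff_xp_mult_1_2_3 by simp
  ultimately have "5 dvd coeff (xp * p) 1 + coeff (xp * p) 2 + coeff (xp * p) 3"
    by (metis dvd_add dvd_triv_left)
  thus ?thesis using lat_mult[OF slow_th five_xp] assms unfolding S_one_def by blast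
qed

lemma R_zero_add:
  assumes "R_zero p" "R_zero q"
  shows   "R_zero (p + q)"
proof -
  have "coeff (p + q) 1 + coeff (p + q) 2 + coeff (p + q) 3 =
      (coeff p 1 + coeff p 2 + coeff p 3) + (coeff q 1 + coeff q 2 + coeff q 3)" by simp
  moreover have "25 dvd \<dots>" using assms by (simp only: R_zero_def dvd_add)
  ultimately show ?thesis using assms lat_add unfolding R_zero_def by metis
qed

text \<open>Beyond a_0 (p_1 + p_2 + p_3) the sum of the first three coefficients of the product
  contains a_1 (p_1 + p_2) and a_2 p_1; here 5 divides a_1, 25 divides a_2, and 5 divides p_1 and
  p_2.\<close>

lemma R_zero_mult:
  assumes "five 0 a" "R_zero p"
  shows   "R_zero (a * p)"
proof -
  have p: "coeff p 0 = 0" "25 dvd coeff p 1 + coeff p 2 + coeff p 3"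
    and lat: "\<And>r. r \<ge> 1 \<Longrightarrow> 5 ^ Suc (th r) dvd coeff p r"
    using assms(2) by (auto simp: R_zero_def lat_def)
  have "5 dvd coeff p 1" "5 dvd coeff p 2" using lat[of 1] lat[of 2] by (auto simp: th_ph_small [unfolded One_nat_def])
  then obtain b c where bc: "coeff p 1 = 5 * b" "coeff p 2 = 5 * c" by (auto elim!: dvdE)
  from p(2) obtain d where d: "coeff p 1 + coeff p 2 + coeff p 3 = 25 * d" by (auto elim!: dvdE)
  have "5 ^ 1 dvd coeff a 1" "5 ^ 2 dvd coeff a 2" using assms(1) by (metis five_def add_0_right)+
  then obtain e f where ef: "coeff a 1 = 5 * e" "coeff a 2 = 25 * f" by (auto elim!: dvdE)
  have "coeff (a * p) 1 + coeff (a * p) 2 + coeff (a * p) 3 =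
     coeff a 0 * (coeff p 1 + coeff p 2 + coeff p 3) + coeff a 1 * (coeff p 1 + coeff p 2) + coeff a 2 * coeff p 1"
    using p(1) by (simp add: coeff_mult numeral_eq_Suc algebra_simps)
  also have "\<dots> = 25 * (coeff a 0 * d + e * (b + c) + 5 * f * b)"
    unfolding d unfolding bc ef by (simp add: algebra_simps)
  finally have "25 dvd coeff (a * p) 1 + coeff (a * p) 2 + coeff (a * p) 3" by simp
  thus ?thesis using lat_mult[OF slow_Suc[OF slow_th] assms(1)] assms(2) unfolding R_zero_def by blast
qed

text \<open>Multiplication by x changes the sum of the first three coefficients by 5 (p_1 + p_2), a
  multiple of 25.\<close>

lemma R_zero_div:
  assumes "R_zero (xp * p)"
  shows   "R_zero p"
proof -
  have "lat (\<lambda>r. Suc (th r)) (xp * p)" using assms by (simp only: R_zero_def)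
  hence lat: "lat (\<lambda>r. Suc (th r)) p" by (rule lat_div[OF slow_Suc[OF slow_th]])
  hence p: "coeff p 0 = 0" "\<And>r. r \<ge> 1 \<Longrightarrow> 5 ^ Suc (th r) dvd coeff p r" by (simp_all add: lat_def)
  have "5 dvd coeff p 1" "5 dvd coeff p 2" using p(2)[of 1] p(2)[of 2] by (auto simp: th_ph_small [unfolded One_nat_def])
  then obtain b c where bc: "coeff p 1 = 5 * b" "coeff p 2 = 5 * c" by (auto elim!: dvdE)
  have "coeff p 1 + coeff p 2 + coeff p 3 =
      coeff (xp * p) 1 + coeff (xp * p) 2 + coeff (xp * p) 3 - 25 * (b + c)"
    unfolding coeff_xp_mult_1_2_3 p(1) bc by simp
  moreover have "25 dvd \<dots>" using assms unfolding R_zero_def by (intro dvd_diff) auto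
  ultimately show ?thesis using lat unfolding R_zero_def by metis
qed

interpretation U_one: five_operator U_one "rec_poly init_one" "[:0, 21, 80:]" 4 S_one "lat (\<lambda>r. Suc (ph r))"
proof
  show "U_one (qy ^ Suc m) = ev (rec_poly init_one m)" for m by (rule U_one_rec)
  show "U_one (qy / xx) * xx ^ (5 - 4) = ev [:0, 21, 80:]" by (rule U_one_base)
  show "coeff p 0 = 0" if "S_one p" for p using that by (simp add: S_one_def lat_def)
qed (fact S_one_xp_mult U_one_S_one lat_add lat_mult[OF slow_Suc[OF slow_ph]] lat_div[OF slow_Suc[OF slow_ph]] | simp)+

lemma R_zero_lat: "R_zero p \<Longrightarrow> lat (\<lambda>r. Suc (th r)) p"
  by (simp add: R_zero_def)

interpretation U_zero: five_operator U_zero "rec_poly init_zero" "[:0, 5, -5, -225, -500:]" 2 "lat ph" R_zero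
proof
  show "U_zero (qy ^ Suc m) = ev (rec_poly init_zero m)" for m by (rule U_zero_rec)
  show "U_zero (qy / xx) * xx ^ (5 - 2) = ev [:0, 5, -5, -225, -500:]" by (rule U_zero_base)
  show "coeff p 0 = 0" if "lat ph p" for p using that by (simp add: lat_def)
  show "lat ph (xp * p)" if "lat ph p" for p using lat_mult[OF slow_ph five_xp that] .
qed (fact U_zero_lat_ph R_zero_add R_zero_mult R_zero_div | simp)+

section \<open>Translation between \<open>y_series\<close> and polynomial numerators\<close>

lemma y_series_ev:
  assumes s: "discrete_fun s" and e: "\<And>m. m \<ge> 1 \<Longrightarrow> e m \<ge> 0"
    and p: "coeff p 0 = 0" "\<And>r. r \<ge> 1 \<Longrightarrow> coeff p r = s (int r) * 5 ^ nat (e (int r))"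
  shows   "y_series (int n) e s = ev p / xx ^ n"
proof -
  define M where "M = {m. 1 \<le> m \<and> s m \<noteq> 0}"
  have [simp]: "finite M" unfolding M_def by (rule finite_support_discrete_fun[OF s])
  have p_eq: "p = (\<Sum>m\<in>M. monom (s m * 5 ^ nat (e m)) (nat m))"
  proof (rule poly_eqI)
    fix r
    have "coeff (\<Sum>m\<in>M. monom (s m * 5 ^ nat (e m)) (nat m)) r =
        (\<Sum>m\<in>M. if m = int r then s m * 5 ^ nat (e m) else 0)"
      unfolding coeff_sum by (intro sum.cong refl) (auto simp: M_def)
    also have "\<dots> = (if int r \<in> M then s (int r) * 5 ^ nat (e (int r)) else 0)"
      by simp
    also have "\<dots> = coeff p r"
      using p by (cases "r = 0") (auto simp: M_def)
    finally show "coeff p r = coeff (\<Sum>m\<in>M. monom (s m * 5 ^ nat (e m)) (nat m)) r" ..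
  qed
  have "(\<Sum>m\<in>M. of_int (s m) * 5 powi e m * qy powi m) = ev p"
    unfolding p_eq ev_sum ev_monom
  proof (intro sum.cong refl)
    fix m assume "m \<in> M"
    hence "m \<ge> 1" by (simp add: M_def)
    thus "of_int (s m) * 5 powi e m * qy powi m = of_int (s m * 5 ^ nat (e m)) * qy ^ nat m"
      using e[of m] by (simp add: power_int_def)
  qed
  thus ?thesis
    by (simp add: y_series_def M_def xx_def power_int_minus power_int_of_nat divide_inverse mult.commute)
qed

lemma y_series_to_ev:
  assumes "discrete_fun s"
  obtains p where "coeff p 0 = 0" "\<And>r. r \<ge> 1 \<Longrightarrow> coeff p r = s (int r) * 5 ^ nat (e (int r))"
proof -
  obtain N where N: "\<And>m. m \<ge> N \<Longrightarrow> s m = 0" using assms by (auto simp: discrete_fun_def)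
  define c where "c r = (if r = 0 then 0 else s (int r) * 5 ^ nat (e (int r)))" for r :: nat
  have "eventually (\<lambda>r. c r = 0) cofinite"
    unfolding cofinite_eq_sequentially eventually_sequentially
    by (rule exI[of _ "nat N"]) (auto simp: c_def intro: N)
  hence "coeff (Abs_poly c) = c"
    by (intro coeff_Abs_poly_If_le[THEN trans] Abs_poly_inverse) (simp add: MOST_iff_cofinite)
  thus ?thesis by (intro that[of "Abs_poly c"]) (simp_all add: c_def)
qed

lemma ev_to_y_series:
  assumes p: "lat (\<lambda>r. nat (e (int r))) p" and e: "\<And>m. m \<ge> 1 \<Longrightarrow> e m \<ge> 0"
  obtains s where "discrete_fun s" "\<And>r. r \<ge> 1 \<Longrightarrow> coeff p r = s (int r) * 5 ^ nat (e (int r))"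
    "\<And>n. ev p / xx ^ n = y_series (int n) e s"
proof -
  define s where "s m = (if m \<ge> 1 then coeff p (nat m) div 5 ^ nat (e m) else 0)" for m :: int
  have s: "discrete_fun s"
    unfolding discrete_fun_def
    by (rule exI[of _ "int (Suc (degree p))"]) (auto simp: s_def coeff_eq_0)
  have c: "coeff p r = s (int r) * 5 ^ nat (e (int r))" if "r \<ge> 1" for r
    using p that by (simp add: s_def lat_def)
  show ?thesis
    by (rule that[OF s c]) (use p in \<open>auto simp: lat_def intro!: y_series_ev[OF s e _ c, symmetric]\<close>)
qed

text \<open>Extracts the factor 5 that the prefactors 1/5 and 1/25 cancel, one for each
  operator.\<close>

lemma lat_Suc_smult:
  assumes "lat (\<lambda>r. Suc (e r)) p"
  obtains q where "p = smult 5 q" "lat e q"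
proof -
  have "5 dvd coeff p r" for r
    using assms by (cases r) (auto simp: lat_def intro: dvd_mult_left)
  then obtain q where q: "p = smult 5 q" using const_poly_dvd_iff[of 5 p] by (auto elim!: dvdE)
  have "lat e q" using assms by (simp add: lat_def q)
  thus ?thesis using that q by blast
qed

theorem theorem4p4:
  fixes n :: int and f :: "complex fls"
  assumes "n \<ge> 1" and "f \<in> W_one n"
  shows "1 / 5 * U_one f \<in> V_zero (5 * n - 4)
    \<and> 1 / 5 ^ 2 * U_zero (U_one f) \<in> W_one (25 * n - 22)"
proof -
  obtain k where k: "n = int k" "k \<ge> 1" using assms(1) by (cases n) auto
  \<comment> \<open>The savings 4 and 2 combine as 5 (5 k - 4) - 2 = 25 k - 22.\<close>
  have ints: "5 * n - 4 = int (5 * k - 4)" "25 * n - 22 = int (5 * (5 * k - 4) - 2)"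
    using k by (simp_all add: of_nat_diff)
  obtain s where s: "discrete_fun s" "[s 1 + s 2 + s 3 = 0] (mod 5)" "f = y_series (int k) \<theta> s"
    using assms(2) unfolding W_one_def k(1) by blast
  obtain p where p: "coeff p 0 = 0" "\<And>r. r \<ge> 1 \<Longrightarrow> coeff p r = s (int r) * 5 ^ nat (\<theta> (int r))"
    using y_series_to_ev[OF s(1), of \<theta>] by metis
  have f: "f = ev p / xx ^ k"
    unfolding s(3) by (rule y_series_ev[OF s(1) theta_phi_nonneg(1) p])
  have "S_one p"
    using s(2) p(1) p(2)[of 1] p(2)[of 2] p(2)[of 3] th_ph_small(1-3)
    by (auto simp: S_one_def lat_def p(2) th_def cong_0_iff)
  from U_one.U_ev_divide_xx_power[OF k(2) this] obtain q0 where q0: "lat (\<lambda>r. Suc (ph r)) q0" "U_one f = ev q0 / xx ^ (5 * k - 4)"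
    unfolding f by blast
  from lat_Suc_smult[OF q0(1)] obtain q where q: "q0 = smult 5 q" "lat ph q" by metis
  have U_f: "U_one f = 5 * (ev q / xx ^ (5 * k - 4))" unfolding q0(2) q(1) ev_smult by simp
  have "\<exists>s. discrete_fun s \<and> ev q / xx ^ (5 * k - 4) = y_series (int (5 * k - 4)) \<phi> s"
    using ev_to_y_series[OF q(2)[unfolded ph_def] theta_phi_nonneg(2)] by metis
  hence V: "1 / 5 * U_one f \<in> V_zero (5 * n - 4)"
    unfolding V_zero_def ints U_f by auto
  have "5 * k - 4 \<ge> 1" using k by simp
  from U_zero.U_ev_divide_xx_power[OF this q(2)] obtain g0 where g0: "R_zero g0"
    "U_zero (ev q / xx ^ (5 * k - 4)) = ev g0 / xx ^ (5 * (5 * k - 4) - 2)" by blast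
  from lat_Suc_smult[OF R_zero_lat[OF g0(1)]] obtain g where g: "g0 = smult 5 g" "lat th g" by metis
  have "U_zero (U_one f) = 5 * U_zero (ev q / xx ^ (5 * k - 4))" unfolding U_f U_zero.U_numeral_mult ..
  also have "\<dots> = 5 ^ 2 * (ev g / xx ^ (5 * (5 * k - 4) - 2))" unfolding g0(2) g(1) ev_smult by simp
  finally have UU: "1 / 5 ^ 2 * U_zero (U_one f) = ev g / xx ^ (5 * (5 * k - 4) - 2)" by simp
  obtain t where t: "discrete_fun t" "\<And>r. r \<ge> 1 \<Longrightarrow> coeff g r = t (int r) * 5 ^ nat (\<theta> (int r))"
    "\<And>n. ev g / xx ^ n = y_series (int n) \<theta> t"
    using ev_to_y_series[OF g(2)[unfolded th_def] theta_phi_nonneg(1)] by metis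
  \<comment> \<open>Cancelling the extracted 5 turns the congruence modulo 25 of
    \<open>R_zero\<close> into the one modulo 5 of \<open>W_one\<close>.\<close>
  have "25 dvd 5 * (coeff g 1 + coeff g 2 + coeff g 3)" using g0(1) by (simp add: R_zero_def g(1))
  hence "5 dvd coeff g 1 + coeff g 2 + coeff g 3"
    using dvd_times_left_cancel_iff[of 5 5 "coeff g 1 + coeff g 2 + coeff g 3"] by simp
  hence "[t 1 + t 2 + t 3 = 0] (mod 5)"
    using t(2)[of 1] t(2)[of 2] t(2)[of 3] th_ph_small(1-3) by (simp add: th_def cong_0_iff)
  hence "1 / 5 ^ 2 * U_zero (U_one f) \<in> W_one (25 * n - 22)"
    unfolding W_one_def ints UU t(3) using t(1) by blast
  with V show ?thesis by blast
qed

end
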